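(* Let $(\eta_n)$ be a sequence of positive reals, let $C_n\sim\operatorname{LKJ}_n(\eta_n)$, and let $\nu_n=n+2\eta_n-1$. (i) If $\eta_n/n\rightarrow\theta\in[0,\infty)$ as $n\to\infty$, then the empirical spectral distribution of $C_n$ converges weakly, in probability, to the Marchenko--Pastur law with ratio $c_\theta=1/(1+2\theta)$. (ii) $\mathbb{E}\|C_n-I_n\|_F^2=n(n-1)/\nu_n$, and $\|C_n-I_n\|_F^2/\mathbb{E}\|C_n-I_n\|_F^2\rightarrow1$ in probability as $n\to\infty$. In particular, $\tfrac{1}{n}\|C_n-I_n\|_F^2\rightarrow1/(1+2\theta)$ in probability when $\eta_n/n\rightarrow\theta\in[0,\infty)$; and when $\eta_n/n\rightarrow\infty$, the Frobenius distance $\|C_n-I_n\|_F$ diverges (to infinity in probability) if $\eta_n=o(n^2)$, is bounded in probability if $\eta_n\asymp n^2$, and vanishes (converges to zero in probability) if $n^2=o(\eta_n)$.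
   Context: $\mathcal{E}_n=\{C\in\mathbb{R}^{n\times n}: C=C',\ C\succeq 0,\ C_{ii}=1 \text{ for all } i\}$ is the set of $n\times n$ correlation matrices, equipped with $d$-dimensional Lebesgue measure, $d=n(n-1)/2$, in the off-diagonal coordinates $(C_{ij})_{i<j}$. For real $\eta>0$, $\operatorname{LKJ}_n(\eta)$ is the probability distribution on $\mathcal{E}_n$ with density proportional to $\det(C)^{\eta-1}$. $\|\cdot\|_F$ is the Frobenius norm. The empirical spectral distribution of an $n\times n$ symmetric matrix with eigenvalues $\lambda_1,\dots,\lambda_n$ is $F_n(x)=\frac1n\#\{i:\lambda_i\le x\}$. For $c\in(0,1]$, the Marchenko--Pastur law with ratio $c$ is the probability measure with density $\frac{1}{2\pi c x}\sqrt{(b-x)(x-a)}$ on $(a,b)$, where $a=(1-\sqrt c)^2$ and $b=(1+\sqrt c)^2$. *)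

theory Defs
  imports
    "HOL-Probability.Probability"
    "HOL-Library.Landau_Symbols"
    "Jordan_Normal_Form.Char_Poly"
begin

text \<open>
  The dimension varies along the sequence, so matrices are the dynamically sized ones of
  Jordan_Normal_Form, with indices in \<open>{0..<n}\<close>. Several names are qualified because
  HOL-Analysis uses them as well.
\<close>

definition psd_mat :: "real mat \<Rightarrow> bool" where
  "psd_mat A \<longleftrightarrow> (\<forall>v \<in> carrier_vec (dim_row A). scalar_prod v (A *\<^sub>v v) \<ge> 0)"

definition corr_mats :: "nat \<Rightarrow> real mat set" where
  "corr_mats n = {C \<in> carrier_mat n n.
     transpose_mat C = C \<and> psd_mat C \<and> (\<forall>i<n. C $$ (i, i) = 1)}"

definition upper_idx :: "nat \<Rightarrow> (nat \<times> nat) set" where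
  "upper_idx n = {(i, j). i < j \<and> j < n}"

definition offdiag :: "nat \<Rightarrow> real mat \<Rightarrow> nat \<times> nat \<Rightarrow> real" where
  "offdiag n C = (\<lambda>ij \<in> upper_idx n. C $$ ij)"

definition mat_of_offdiag :: "nat \<Rightarrow> (nat \<times> nat \<Rightarrow> real) \<Rightarrow> real mat" where
  "mat_of_offdiag n x = Matrix.mat n n
     (\<lambda>(i, j). if i = j then 1 else if i < j then x (i, j) else x (j, i))"

text \<open>
  Lebesgue measure on the correlation matrices in the coordinates \<^const>\<open>offdiag\<close>: the
  product of one copy of \<^const>\<open>lborel\<close> per pair \<open>i < j\<close>, restricted to the coordinate image
  of \<^const>\<open>corr_mats\<close> and transported to the matrices. The events are the sets of correlation
  matrices that are Borel in the coordinates.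
\<close>

definition corr_lborel :: "nat \<Rightarrow> real mat measure" where
  "corr_lborel n =
     distr (restrict_space (\<Pi>\<^sub>M ij \<in> upper_idx n. lborel) {x. mat_of_offdiag n x \<in> corr_mats n})
       (vimage_algebra (corr_mats n) (offdiag n) (\<Pi>\<^sub>M ij \<in> upper_idx n. lborel))
       (mat_of_offdiag n)"

text \<open>
  For \<open>\<eta> \<le> 1\<close> the value of the density at singular matrices is immaterial, as these form a null
  set; \<open>0 powr a = 0\<close> makes it 0 there.
\<close>

definition lkj :: "nat \<Rightarrow> real \<Rightarrow> real mat measure" where
  "lkj n \<eta> = density (corr_lborel n)
     (\<lambda>C. ennreal (Determinant.det C powr (\<eta> - 1)) /
        (\<integral>\<^sup>+ B. ennreal (Determinant.det B powr (\<eta> - 1)) \<partial>corr_lborel n))"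

definition frob_norm :: "real mat \<Rightarrow> real" where
  "frob_norm A = sqrt (\<Sum>i<dim_row A. \<Sum>j<dim_col A. (A $$ (i, j))\<^sup>2)"

text \<open>
  \<^const>\<open>proots\<close> is the multiset of roots with multiplicity, so for a real symmetric matrix it
  lists all the eigenvalues \<open>\<lambda>\<^sub>1, \<dots>, \<lambda>\<^sub>n\<close>.
\<close>

definition esd :: "real mat \<Rightarrow> real \<Rightarrow> real" where
  "esd A x = real (size {#l \<in># proots (char_poly A). l \<le> x#}) / real (dim_row A)"

definition mp_law :: "real \<Rightarrow> real measure" where
  "mp_law c = (let a = (1 - sqrt c)\<^sup>2; b = (1 + sqrt c)\<^sup>2 in
     density lborel (\<lambda>x. ennreal
       (indicator {a<..<b} x * (1 / (2 * pi * c * x) * sqrt ((b - x) * (x - a))))))"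

text \<open>
  The \<open>n\<close>-th random variable of a sequence lives on its own probability space \<open>M n\<close>.
\<close>

definition tendsto_in_prob ::
    "(nat \<Rightarrow> 'a measure) \<Rightarrow> (nat \<Rightarrow> 'a \<Rightarrow> real) \<Rightarrow> real \<Rightarrow> bool" where
  "tendsto_in_prob M X l \<longleftrightarrow>
     (\<forall>\<epsilon>>0. (\<lambda>n. measure (M n) {\<omega> \<in> space (M n). \<bar>X n \<omega> - l\<bar> > \<epsilon>}) \<longlonglongrightarrow> 0)"

definition diverges_in_prob :: "(nat \<Rightarrow> 'a measure) \<Rightarrow> (nat \<Rightarrow> 'a \<Rightarrow> real) \<Rightarrow> bool" where
  "diverges_in_prob M X \<longleftrightarrow>
     (\<forall>K. (\<lambda>n. measure (M n) {\<omega> \<in> space (M n). X n \<omega> > K}) \<longlonglongrightarrow> 1)"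

definition bounded_in_prob :: "(nat \<Rightarrow> 'a measure) \<Rightarrow> (nat \<Rightarrow> 'a \<Rightarrow> real) \<Rightarrow> bool" where
  "bounded_in_prob M X \<longleftrightarrow>
     (\<forall>\<epsilon>>0. \<exists>K. \<forall>n\<ge>1. measure (M n) {\<omega> \<in> space (M n). \<bar>X n \<omega>\<bar> > K} \<le> \<epsilon>)"

text \<open>
  The analogue of \<^const>\<open>weak_conv\<close> for random distribution functions.
\<close>

definition weak_conv_in_prob ::
    "(nat \<Rightarrow> 'a measure) \<Rightarrow> (nat \<Rightarrow> 'a \<Rightarrow> real \<Rightarrow> real) \<Rightarrow> (real \<Rightarrow> real) \<Rightarrow> bool" where
  "weak_conv_in_prob M F G \<longleftrightarrow>
     (\<forall>x. isCont G x \<longrightarrow> tendsto_in_prob M (\<lambda>n \<omega>. F n \<omega> x) (G x))"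

end

theory Submission
  imports Defs
begin

text \<open>
  Write \<open>\<nu> = n + 2 * \<eta> - 1\<close>. The Cholesky factor of an LKJ matrix has independent rows, and the
  row that is added in passing from dimension \<open>n\<close> to \<open>n + 1\<close> has a density proportional to
  \<open>(1 - \<bar>v\<bar>\<^sup>2)\<close> to the power \<open>(\<nu> - n) / 2 - 1\<close> on the unit ball of dimension \<open>n\<close>, so all
  its moments are explicit. A quadratic form \<open>v\<^sup>T A v\<close> in such a row has mean \<open>tr A / \<nu>\<close>
  and variance at most of order \<open>\<parallel>A\<parallel>\<^sup>2 / \<nu>\<^sup>2\<close>.

  Adding up the squares of the new entries row by row gives the mean of the Frobenius norm and
  a variance of order \<open>n\<^sup>2 / \<nu>\<^sup>2\<close>; part (ii) follows from the inequalities of Chebyshev and Markov.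

  For part (i), the last diagonal entry of the resolvent at \<open>-t\<close> is the inverse of the Schur complement
  \<open>1 + t - q\<close>, where \<open>q\<close> is a quadratic form in the last row and concentrates at
  \<open>(n - t * tr R) / \<nu>\<close>, \<open>R\<close> being the resolvent of the smaller matrix. By exchangeability the
  same holds for every diagonal entry, so the normalized trace of the resolvent satisfies
  \<open>s = 1 / (1 + t - c * (1 - t * s))\<close> up to an error tending to zero in \<open>L\<^sup>2\<close>. The Stieltjes transform
  of the Marchenko--Pastur law solves this equation, and closeness of Stieltjes transforms at
  finitely many points forces closeness of distribution functions at continuity points.
\<close>

subsection \<open>Resolvents of positive semidefinite matrices\<close>

text \<open>The linear map from a new Cholesky row to the new column of the correlation matrix has
  as Jacobian the square root of the determinant of the leading block. Integrating the last row out
  therefore raises the exponent of the determinant by 1/2. Lowering n by 1 and raising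
  \<open>\<eta>\<close> by 1/2 leaves \<open>\<nu>\<close> unchanged, so \<open>\<nu>\<close> is the
  parameter held fixed in every induction, and c arises as the limit of n / \<open>\<nu>\<close>.
  Two descriptions of the law are needed. Cholesky coordinates give independent rows and hence
  moments, but they order the indices; the density with respect to Lebesgue measure shows the
  exchangeability. The spectral parameter is a negative real number -t. Resolvents stay real and the
  relevant denominators are at least t. In return the distribution has to be recovered from the
  Stieltjes transform on the half line t > 0: u = 1 / (l + 1) maps the nonnegative spectrum into
  [0, 1], where polynomials are uniformly dense.\<close>

definition psd_fun :: "nat \<Rightarrow> (nat \<Rightarrow> nat \<Rightarrow> real) \<Rightarrow> bool" where
  "psd_fun n c \<longleftrightarrow> (\<forall>u. 0 \<le> (\<Sum>i<n. \<Sum>j<n. u i * c i j * u j))"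

lemma psd_fun_Suc_D:
  assumes "psd_fun (Suc n) c" shows "psd_fun n c"
  unfolding psd_fun_def
proof
  fix u
  have "0 \<le> (\<Sum>i<Suc n. \<Sum>j<Suc n. (u(n := 0)) i * c i j * (u(n := 0)) j)"
    using assms unfolding psd_fun_def by blast
  also have "\<dots> = (\<Sum>i<n. \<Sum>j<n. u i * c i j * u j)"
    by simp
  finally show "0 \<le> (\<Sum>i<n. \<Sum>j<n. u i * c i j * u j)" .
qed

text \<open>The inverse of \<open>c + x\<close> on the leading \<open>n \<times> n\<close> block, by bordering: \<open>b\<close> is the inverse Schur
  complement. Matrices are functions here, so that blocks of all sizes share one type.\<close>

primrec res :: "real \<Rightarrow> (nat \<Rightarrow> nat \<Rightarrow> real) \<Rightarrow> nat \<Rightarrow> nat \<Rightarrow> nat \<Rightarrow> real" where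
  "res x c 0 = (\<lambda>i j. 0)"
| "res x c (Suc n) = (\<lambda>i j.
     let y = (\<lambda>i. \<Sum>k<n. res x c n i k * c k n);
         b = 1 / (c n n + x - (\<Sum>k<n. c k n * y k))
     in if i < n \<and> j < n then res x c n i j + b * y i * y j
        else if i < n \<and> j = n then - (b * y i)
        else if i = n \<and> j < n then - (b * y j)
        else if i = n \<and> j = n then b else 0)"

lemma res_sym: "res x c n i j = res x c n j i"
proof (induction n arbitrary: i j)
  case (Suc n)
  have eq: "res x c n i j = res x c n j i" by (rule Suc)
  consider "i < n" "j < n" | "i < n" "j = n" | "i = n" "j < n" | "i = n" "j = n" | "i > n" | "j > n"
    by linarith
  then show ?case by cases (simp_all add: Let_def eq mult.assoc mult.left_commute[of _ "sum _ _"])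
qed simp

context
  fixes x :: real and c :: "nat \<Rightarrow> nat \<Rightarrow> real"
  assumes x: "x > 0" and sym: "\<And>i j. c i j = c j i"
begin

text \<open>\<open>rcol n\<close> is the resolvent of the leading block applied to the next column,
  and \<open>rden n\<close> is the Schur complement of the new diagonal entry in
  \<open>c + x\<close>; \<open>res_Suc\<close> rewrites the recursion in these terms.\<close>

definition rcol where "rcol n i = (\<Sum>k<n. res x c n i k * c k n)"
definition rden where "rden n = c n n + x - (\<Sum>k<n. c k n * rcol n k)"

lemma res_Suc:
  "res x c (Suc n) i j =
    (if i < n \<and> j < n then res x c n i j + 1 / rden n * rcol n i * rcol n j
     else if i < n \<and> j = n then - (1 / rden n * rcol n i)
     else if i = n \<and> j < n then - (1 / rden n * rcol n j)
     else if i = n \<and> j = n then 1 / rden n else 0)"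
  by (simp add: rcol_def rden_def Let_def)

declare res.simps(2)[simp del]

text \<open>The inverse property is a hypothesis here because \<open>res_inv\<close> needs this
  equation inside the induction that establishes it.\<close>

lemma rcol_eq:
  assumes inv: "\<And>i j. i < n \<Longrightarrow> j < n \<Longrightarrow>
     (\<Sum>k<n. c i k * res x c n k j) + x * res x c n i j = (if i = j then 1 else 0)" and i: "i < n"
  shows "(\<Sum>k<n. c i k * rcol n k) + x * rcol n i = c i n"
proof -
  have "(\<Sum>k<n. c i k * rcol n k) = (\<Sum>j<n. (\<Sum>k<n. c i k * res x c n k j) * c j n)"
    unfolding rcol_def sum_distrib_left sum_distrib_right
    by (subst sum.swap) (simp add: mult_ac)
  moreover have "x * rcol n i = (\<Sum>j<n. x * res x c n i j * c j n)"
    unfolding rcol_def sum_distrib_left by (simp add: mult_ac)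
  ultimately have "(\<Sum>k<n. c i k * rcol n k) + x * rcol n i =
     (\<Sum>j<n. ((\<Sum>k<n. c i k * res x c n k j) + x * res x c n i j) * c j n)"
    by (simp add: sum.distrib[symmetric] algebra_simps)
  also have "\<dots> = (\<Sum>j<n. (if i = j then 1 else 0) * c j n)"
    using i by (intro sum.cong refl) (simp add: inv)
  also have "\<dots> = c i n" using i by (simp add: if_distrib if_distribR sum.delta cong: if_cong)
  finally show ?thesis .
qed

lemma rden_ge_aux:
  assumes psd: "psd_fun (Suc n) c"
    and eq: "\<And>i. i < n \<Longrightarrow> (\<Sum>k<n. c i k * rcol n k) + x * rcol n i = c i n"
  shows "rden n \<ge> x * (1 + (\<Sum>i<n. (rcol n i)\<^sup>2))"
proof -
  let ?y = "rcol n"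
  \<comment> \<open>With y = \<open>rcol n\<close>, the vector (-y, 1) minimizes the form of
    \<open>c + x\<close> among vectors with last entry 1, and the minimum is \<open>rden n\<close>.
    The form of \<open>c\<close> at this vector is \<open>rden n - x * (1 + |y|^2)\<close>, which is
    nonnegative.\<close>
  define u where "u = (\<lambda>i. if i < n then - ?y i else 1)"
  have "0 \<le> (\<Sum>i<Suc n. \<Sum>j<Suc n. u i * c i j * u j)"
    using psd unfolding psd_fun_def by blast
  also have "\<dots> = (\<Sum>i<n. \<Sum>j<n. ?y i * c i j * ?y j) - (\<Sum>i<n. ?y i * c i n)
                  - (\<Sum>j<n. c n j * ?y j) + c n n"
    by (simp add: u_def sum.distrib sum_negf sum_subtractf)
  also have "(\<Sum>i<n. \<Sum>j<n. ?y i * c i j * ?y j) = (\<Sum>i<n. ?y i * (c i n - x * ?y i))"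
  proof (intro sum.cong refl)
    fix i assume "i \<in> {..<n}"
    then have "c i n - x * ?y i = (\<Sum>k<n. c i k * ?y k)" using eq[of i] by simp
    then show "(\<Sum>j<n. ?y i * c i j * ?y j) = ?y i * (c i n - x * ?y i)"
      by (simp add: sum_distrib_left mult_ac)
  qed
  also have "\<dots> = (\<Sum>i<n. ?y i * c i n) - x * (\<Sum>i<n. (?y i)\<^sup>2)"
    by (simp add: algebra_simps sum_subtractf sum_distrib_left power2_eq_square)
  also have "(\<Sum>j<n. c n j * ?y j) = (\<Sum>k<n. c k n * ?y k)"
    by (subst sym) simp
  finally show ?thesis unfolding rden_def by (simp add: algebra_simps)
qed

text \<open>Positive semidefiniteness enters through \<open>rden n > 0\<close>, which makes division
  by the Schur complement legitimate. The four cases are the blocks of the bordered matrix.\<close>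

lemma res_inv:
  assumes "psd_fun n c" "i < n" "j < n"
  shows "(\<Sum>k<n. c i k * res x c n k j) + x * res x c n i j = (if i = j then 1 else 0)"
  using assms
proof (induction n arbitrary: i j)
  case 0 then show ?case by simp
next
  case (Suc n)
  have psd: "psd_fun n c" using Suc.prems(1) by (rule psd_fun_Suc_D)
  note IH = Suc.IH[OF psd]
  have eq: "\<And>i. i < n \<Longrightarrow> (\<Sum>k<n. c i k * rcol n k) + x * rcol n i = c i n"
    by (rule rcol_eq) (use IH in auto)
  have ge: "rden n \<ge> x * (1 + (\<Sum>i<n. (rcol n i)\<^sup>2))"
    by (rule rden_ge_aux[OF Suc.prems(1) eq])
  have pos: "rden n > 0"
  proof -
    have "0 \<le> (\<Sum>i<n. (rcol n i)\<^sup>2)" by (intro sum_nonneg) auto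
    then have "0 < x * (1 + (\<Sum>i<n. (rcol n i)\<^sup>2))" using x by (intro mult_pos_pos) auto
    then show ?thesis using ge by linarith
  qed
  let ?b = "1 / rden n" and ?y = "rcol n"
  have cy: "(\<Sum>k<n. c k n * ?y k) = c n n + x - rden n" by (simp add: rden_def)
  have cy': "(\<Sum>k<n. c n k * ?y k) = c n n + x - rden n" using cy by (subst (asm) sym)
  have cr: "(\<Sum>k<n. c n k * res x c n k j) = ?y j" for j
    unfolding rcol_def by (intro sum.cong refl) (subst sym, subst res_sym, simp add: mult.commute)
  consider "i < n" "j < n" | "i < n" "j = n" | "i = n" "j < n" | "i = n" "j = n"
    using Suc.prems by linarith
  then show ?case
  proof cases
    case 1
    have "(\<Sum>k<Suc n. c i k * res x c (Suc n) k j) + x * res x c (Suc n) i j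
      = ((\<Sum>k<n. c i k * res x c n k j) + x * res x c n i j)
        + ?b * ?y j * ((\<Sum>k<n. c i k * ?y k) + x * ?y i) - c i n * (?b * ?y j)"
      using 1 by (simp add: res_Suc algebra_simps sum.distrib sum_distrib_left sum_divide_distrib)
    also have "\<dots> = (if i = j then 1 else 0)"
      using 1 by (simp add: eq IH)
    finally show ?thesis .
  next
    case 2
    have "(\<Sum>k<Suc n. c i k * res x c (Suc n) k j) + x * res x c (Suc n) i j
      = - ?b * ((\<Sum>k<n. c i k * ?y k) + x * ?y i) + c i n * ?b"
      using 2 by (simp add: res_Suc algebra_simps sum.distrib sum_distrib_left sum_divide_distrib sum_negf)
    also have "\<dots> = 0"
      using 2 by (simp add: eq)
    finally show ?thesis using 2 by simp
  next
    case 3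
    have "(\<Sum>k<Suc n. c i k * res x c (Suc n) k j) + x * res x c (Suc n) i j
      = (\<Sum>k<n. c n k * res x c n k j) + ?b * ?y j * (\<Sum>k<n. c n k * ?y k) - (c n n + x) * ?b * ?y j"
      using 3 by (simp add: res_Suc algebra_simps sum.distrib sum_distrib_left sum_divide_distrib add_divide_distrib)
    also have "\<dots> = ?y j - ?b * rden n * ?y j"
      unfolding cr cy' by (simp add: algebra_simps diff_divide_distrib add_divide_distrib)
    also have "\<dots> = 0" using pos by simp
    finally show ?thesis using 3 by simp
  next
    case 4
    have "(\<Sum>k<Suc n. c i k * res x c (Suc n) k j) + x * res x c (Suc n) i j
      = ?b * ((c n n + x) - (\<Sum>k<n. c n k * ?y k))"
      using 4 by (simp add: res_Suc algebra_simps sum.distrib sum_distrib_left sum_divide_distrib sum_negf add_divide_distrib diff_divide_distrib)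
    also have "\<dots> = 1" unfolding cy' using pos by simp
    finally show ?thesis using 4 by simp
  qed
qed

lemma rcol_eqn: "psd_fun n c \<Longrightarrow> i < n \<Longrightarrow> (\<Sum>k<n. c i k * rcol n k) + x * rcol n i = c i n"
  by (rule rcol_eq) (use res_inv in auto)

lemma rden_ge: "psd_fun (Suc n) c \<Longrightarrow> rden n \<ge> x * (1 + (\<Sum>i<n. (rcol n i)\<^sup>2))"
  by (rule rden_ge_aux) (auto intro!: rcol_eqn dest: psd_fun_Suc_D)

lemma rden_ge_x: assumes "psd_fun (Suc n) c" shows "rden n \<ge> x"
proof -
  have "0 \<le> (\<Sum>i<n. (rcol n i)\<^sup>2)" by (intro sum_nonneg) auto
  then have "x * 1 \<le> x * (1 + (\<Sum>i<n. (rcol n i)\<^sup>2))" using x by (intro mult_left_mono) auto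
  then show ?thesis using rden_ge[OF assms] by linarith
qed

definition tres where "tres n = (\<Sum>i<n. res x c n i i)"

lemma tres_Suc: "tres (Suc n) = tres n + 1 / rden n * (1 + (\<Sum>i<n. (rcol n i)\<^sup>2))"
proof -
  have "(\<Sum>i<n. res x c (Suc n) i i) = (\<Sum>i<n. res x c n i i + 1 / rden n * (rcol n i)\<^sup>2)"
    by (intro sum.cong refl) (simp add: res_Suc power2_eq_square)
  then show ?thesis
    by (simp add: tres_def res_Suc[of n n n] sum.distrib sum_divide_distrib[symmetric] distrib_left add_divide_distrib)
qed

text \<open>The increment is \<open>(1 + |rcol n|^2) / rden n\<close>, and \<open>rden_ge\<close>
  bounds it by 1 / x whatever the new row is. Thus the trace of the smaller resolvent can be
  exchanged for that of the larger one at bounded cost.\<close>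

lemma tres_incr:
  assumes "psd_fun (Suc n) c"
  shows "tres n \<le> tres (Suc n)" "tres (Suc n) \<le> tres n + 1 / x"
proof -
  let ?s = "1 + (\<Sum>i<n. (rcol n i)\<^sup>2)"
  have s: "?s > 0" by (intro add_pos_nonneg sum_nonneg) auto
  have d: "rden n > 0" using rden_ge_x[OF assms] x by linarith
  show "tres n \<le> tres (Suc n)" unfolding tres_Suc using s d by simp
  have "1 / rden n * ?s \<le> 1 / x"
    using rden_ge[OF assms] d x by (simp add: field_simps)
  then show "tres (Suc n) \<le> tres n + 1 / x" unfolding tres_Suc by simp
qed

lemma tres_bounds:
  assumes "psd_fun n c" shows "0 \<le> tres n" "tres n \<le> n / x"
proof -
  have "0 \<le> tres n \<and> tres n \<le> n / x" using assms
  proof (induction n)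
    case 0 then show ?case by (simp add: tres_def)
  next
    case (Suc n)
    then show ?case using tres_incr[of n] psd_fun_Suc_D[of n c] x
      by (auto simp: add_divide_distrib)
  qed
  then show "0 \<le> tres n" "tres n \<le> n / x" by auto
qed

lemma res_last: "res x c (Suc n) n n = 1 / rden n"
  by (simp add: res_Suc)

text \<open>The product of \<open>res\<close>, \<open>c + x\<close> and \<open>B\<close> is
  evaluated with either bracketing. Uniqueness gives facts about \<open>res\<close> that its
  recursion hides: covariance under permutations, and diagonal entries as quotients of
  determinants.\<close>

lemma inverse_unique:
  assumes psd: "psd_fun n c"
    and B: "\<And>i j. i < n \<Longrightarrow> j < n \<Longrightarrow> (\<Sum>k<n. c i k * B k j) + x * B i j = (if i = j then 1 else 0)"
    and ij: "i < n" "j < n"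
  shows "B i j = res x c n i j"
proof -
  have "(\<Sum>l<n. res x c n i l * ((\<Sum>k<n. c l k * B k j) + x * B l j)) = (\<Sum>l<n. res x c n i l * (if l = j then 1 else 0))"
    using ij by (intro sum.cong refl) (simp add: B)
  also have "\<dots> = res x c n i j" using ij by (simp add: if_distrib if_distribR sum.delta cong: if_cong)
  finally have 1: "(\<Sum>l<n. res x c n i l * ((\<Sum>k<n. c l k * B k j) + x * B l j)) = res x c n i j" .
  have "(\<Sum>l<n. res x c n i l * ((\<Sum>k<n. c l k * B k j) + x * B l j))
      = (\<Sum>k<n. ((\<Sum>l<n. c k l * res x c n l i) + x * res x c n k i) * B k j)"
  proof -
    have "(\<Sum>l<n. res x c n i l * (\<Sum>k<n. c l k * B k j)) = (\<Sum>k<n. (\<Sum>l<n. c k l * res x c n l i) * B k j)"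
      unfolding sum_distrib_left sum_distrib_right
      by (subst sum.swap) (intro sum.cong refl, subst res_sym, simp add: sym mult_ac)
    moreover have "(\<Sum>l<n. res x c n i l * (x * B l j)) = (\<Sum>k<n. x * res x c n k i * B k j)"
      by (intro sum.cong refl) (simp add: res_sym[of x c n i])
    ultimately show ?thesis by (simp add: algebra_simps sum.distrib)
  qed
  also have "\<dots> = (\<Sum>k<n. (if k = i then 1 else 0) * B k j)"
    using ij by (intro sum.cong refl) (simp add: res_inv[OF psd])
  also have "\<dots> = B i j" using ij by (simp add: if_distrib if_distribR sum.delta cong: if_cong)
  finally show ?thesis using 1 by simp
qed

end

section \<open>Resolvents under permutations of the indices\<close>

lemma sum_permutes:
  fixes g :: "nat \<Rightarrow> real"
  assumes "p permutes A"
  shows "(\<Sum>i\<in>A. g (p i)) = (\<Sum>i\<in>A. g i)"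
  using sum.permute[OF assms, of g] by (simp add: comp_def)

lemma psd_fun_permute:
  assumes p: "p permutes {..<n}" and psd: "psd_fun n c"
  shows "psd_fun n (\<lambda>i j. c (p i) (p j))"
  unfolding psd_fun_def
proof
  fix u :: "nat \<Rightarrow> real"
  define v where "v i = u (Hilbert_Choice.inv p i)" for i
  have v: "u i = v (p i)" for i
    unfolding v_def using permutes_inverses(2)[OF p] by simp
  have "(\<Sum>i<n. \<Sum>j<n. v (p i) * c (p i) (p j) * v (p j)) = (\<Sum>i<n. \<Sum>j<n. v i * c i j * v j)"
    by (simp add: sum_permutes[OF p, of "\<lambda>j. v (p i) * c (p i) j * v j" for i]
       sum_permutes[OF p, of "\<lambda>i. \<Sum>j<n. v i * c i j * v j"])
  then show "0 \<le> (\<Sum>i<n. \<Sum>j<n. u i * c (p i) (p j) * u j)"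
    using psd unfolding v psd_fun_def by simp
qed

text \<open>The recursion singles out the last index, so covariance cannot be read off from it. The
  permuted resolvent inverts the permuted matrix, and inverses are unique.\<close>

lemma res_permute:
  assumes x: "x > 0" and sym: "\<And>i j. c i j = c j i" and psd: "psd_fun n c"
    and p: "p permutes {..<n}" and ij: "i < n" "j < n"
  shows "res x (\<lambda>i j. c (p i) (p j)) n i j = res x c n (p i) (p j)"
proof (rule inverse_unique[OF x _ psd_fun_permute[OF p psd], where B = "\<lambda>i j. res x c n (p i) (p j)", symmetric])
  show "c (p i) (p j) = c (p j) (p i)" for i j by (rule sym)
  have pn: "p k < n \<longleftrightarrow> k < n" for k using permutes_in_image[OF p, of k] by simp
  fix i j assume ij: "i < n" "j < n"
  have "(\<Sum>k<n. c (p i) (p k) * res x c n (p k) (p j)) = (\<Sum>k<n. c (p i) k * res x c n k (p j))"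
    by (rule sum_permutes[OF p, of "\<lambda>k. c (p i) k * res x c n k (p j)"])
  then show "(\<Sum>k<n. c (p i) (p k) * res x c n (p k) (p j)) + x * res x c n (p i) (p j) =
      (if i = j then 1 else 0)"
    using ij pn res_inv[OF x sym psd, of "p i" "p j"] permutes_inj[OF p] by (simp add: inj_eq)
qed (fact x ij)+

section \<open>Resolvents of Gram matrices\<close>

lemma gram:
  fixes L :: "nat \<Rightarrow> nat \<Rightarrow> real"
  shows "(\<Sum>k<m. (\<Sum>i<n. a i * L i k) * (\<Sum>p<n. b p * L p k)) =
         (\<Sum>i<n. \<Sum>p<n. a i * b p * (\<Sum>k<m. L i k * L p k))"
proof -
  have "(\<Sum>k<m. (\<Sum>i<n. a i * L i k) * (\<Sum>p<n. b p * L p k)) =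
        (\<Sum>k<m. \<Sum>i<n. \<Sum>p<n. a i * b p * (L i k * L p k))"
    by (simp add: sum_product mult_ac)
  also have "\<dots> = (\<Sum>i<n. \<Sum>k<m. \<Sum>p<n. a i * b p * (L i k * L p k))" by (rule sum.swap)
  also have "\<dots> = (\<Sum>i<n. \<Sum>p<n. \<Sum>k<m. a i * b p * (L i k * L p k))"
    by (intro sum.cong refl sum.swap)
  finally show ?thesis by (simp add: sum_distrib_left)
qed

context
  fixes x :: real and c L :: "nat \<Rightarrow> nat \<Rightarrow> real" and n :: nat
  assumes x: "x > 0" and sym: "\<And>i j. c i j = c j i"
    and gramL: "\<And>i j. i < n \<Longrightarrow> j < n \<Longrightarrow> c i j = (\<Sum>k<n. L i k * L j k)"
begin

lemma gram': "(\<Sum>k<n. (\<Sum>i<n. a i * L i k) * (\<Sum>p<n. b p * L p k)) = (\<Sum>i<n. \<Sum>p<n. a i * b p * c i p)"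
  unfolding gram by (intro sum.cong refl) (simp add: gramL)

lemma psd_gram: "psd_fun n c"
  unfolding psd_fun_def
proof
  fix u
  have "(\<Sum>i<n. \<Sum>j<n. u i * c i j * u j) = (\<Sum>k<n. (\<Sum>i<n. u i * L i k) * (\<Sum>i<n. u i * L i k))"
    unfolding gram' by (simp add: mult_ac)
  then show "0 \<le> (\<Sum>i<n. \<Sum>j<n. u i * c i j * u j)" by (simp add: sum_nonneg)
qed

text \<open>Cyclicity of the trace: tr (L' L L' L) = tr (L L' L L'), with L' the transpose of
  L.\<close>

lemma frob_gram: "(\<Sum>k<n. \<Sum>l<n. (\<Sum>i<n. L i k * L i l)\<^sup>2) = (\<Sum>i<n. \<Sum>j<n. (c i j)\<^sup>2)"
proof -
  have "(\<Sum>k<n. \<Sum>l<n. (\<Sum>i<n. L i k * L i l)\<^sup>2) =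
        (\<Sum>l<n. \<Sum>k<n. (\<Sum>i<n. L i l * L i k) * (\<Sum>i<n. L i l * L i k))"
    by (subst sum.swap) (simp add: power2_eq_square mult_ac)
  also have "\<dots> = (\<Sum>l<n. \<Sum>i<n. \<Sum>p<n. L i l * L p l * c i p)"
    unfolding gram' ..
  also have "\<dots> = (\<Sum>i<n. \<Sum>l<n. \<Sum>p<n. L i l * L p l * c i p)" by (rule sum.swap)
  also have "\<dots> = (\<Sum>i<n. \<Sum>p<n. \<Sum>l<n. L i l * L p l * c i p)"
    by (intro sum.cong refl sum.swap)
  also have "\<dots> = (\<Sum>i<n. \<Sum>j<n. (c i j)\<^sup>2)"
    by (intro sum.cong refl) (simp add: gramL power2_eq_square sum_distrib_right)
  finally show ?thesis .
qed

text \<open>The matrix L' R L with R the resolvent. For a new row r = L v, the form r' R r becomes a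
  quadratic form in v (\<open>quad_sandwich\<close>), to which the moment formulas for the ball
  apply.\<close>

definition sandwich where "sandwich k l = (\<Sum>i<n. L i k * (\<Sum>j<n. res x c n i j * L j l))"

lemma res_c: assumes "i < n" "j < n"
  shows "(\<Sum>k<n. res x c n i k * c k j) = (if i = j then 1 else 0) - x * res x c n i j"
proof -
  have "(\<Sum>k<n. res x c n i k * c k j) = (\<Sum>k<n. c j k * res x c n k i)"
    by (intro sum.cong refl) (subst res_sym, subst sym, simp)
  then show ?thesis using res_inv[OF x sym psd_gram assms(2,1)] by (simp add: res_sym[of x c n j i] eq_commute[of j i])
qed

text \<open>By cyclicity this is the trace of R c = 1 - x R.\<close>

lemma trace_sandwich: "(\<Sum>k<n. sandwich k k) = n - x * tres x c n"
proof -
  have "(\<Sum>k<n. sandwich k k) = (\<Sum>k<n. \<Sum>i<n. \<Sum>j<n. res x c n i j * (L i k * L j k))"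
    unfolding sandwich_def by (simp add: sum_distrib_left mult_ac)
  also have "\<dots> = (\<Sum>i<n. \<Sum>k<n. \<Sum>j<n. res x c n i j * (L i k * L j k))" by (rule sum.swap)
  also have "\<dots> = (\<Sum>i<n. \<Sum>j<n. \<Sum>k<n. res x c n i j * (L i k * L j k))"
    by (intro sum.cong refl sum.swap)
  also have "\<dots> = (\<Sum>i<n. \<Sum>j<n. res x c n i j * c j i)"
    by (intro sum.cong refl) (simp add: sum_distrib_left gramL mult_ac)
  also have "\<dots> = (\<Sum>i<n. 1 - x * res x c n i i)"
    by (intro sum.cong refl) (simp add: res_c)
  finally show ?thesis by (simp add: tres_def[OF x sym] sum_subtractf sum_distrib_left)
qed

text \<open>Row i of R serves as test vector for \<open>c\<close>. Since R c = 1 - x R, the form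
  there is the i-th diagonal entry of R - x R R; it is nonnegative, and the entries are summed over
  i.\<close>

lemma res_sq_le: "x * (\<Sum>i<n. \<Sum>j<n. (res x c n i j)\<^sup>2) \<le> tres x c n"
proof -
  have "x * (\<Sum>j<n. (res x c n i j)\<^sup>2) \<le> res x c n i i" if i: "i < n" for i
  proof -
    let ?u = "res x c n i"
    have "0 \<le> (\<Sum>p<n. \<Sum>q<n. ?u p * c p q * ?u q)"
      using psd_gram unfolding psd_fun_def by simp
    also have "\<dots> = (\<Sum>q<n. (\<Sum>p<n. ?u p * c p q) * ?u q)"
      by (subst sum.swap) (simp add: sum_distrib_right)
    also have "\<dots> = (\<Sum>q<n. ((if i = q then 1 else 0) - x * ?u q) * ?u q)"
      by (intro sum.cong refl) (simp add: res_c i)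
    also have "\<dots> = (\<Sum>q<n. (if i = q then ?u q else 0) - x * (?u q)\<^sup>2)"
      by (intro sum.cong refl) (simp add: algebra_simps power2_eq_square)
    also have "\<dots> = ?u i - x * (\<Sum>q<n. (?u q)\<^sup>2)"
      using i by (simp add: sum_subtractf sum_distrib_left)
    finally show ?thesis by simp
  qed
  then have "(\<Sum>i<n. x * (\<Sum>j<n. (res x c n i j)\<^sup>2)) \<le> (\<Sum>i<n. res x c n i i)"
    by (intro sum_mono) auto
  then show ?thesis by (simp add: tres_def[OF x sym] sum_distrib_left)
qed

text \<open>By cyclicity the left side is tr ((1 - x R)^2) = n - 2 x tr R + x^2 tr (R^2), and
  \<open>res_sq_le\<close> bounds the last term by x tr R.\<close>

lemma frob_sandwich: "(\<Sum>k<n. \<Sum>l<n. (sandwich k l)\<^sup>2) \<le> n"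
proof -
  let ?G = "res x c n"
  let ?B = "\<lambda>i l. \<Sum>j<n. ?G i j * L j l"
  have "(\<Sum>k<n. \<Sum>l<n. (sandwich k l)\<^sup>2) = (\<Sum>l<n. \<Sum>k<n. (\<Sum>i<n. ?B i l * L i k) * (\<Sum>i<n. ?B i l * L i k))"
    by (subst sum.swap) (simp add: sandwich_def power2_eq_square mult_ac)
  also have "\<dots> = (\<Sum>l<n. \<Sum>i<n. \<Sum>p<n. ?B i l * ?B p l * c i p)" unfolding gram' ..
  also have "\<dots> = (\<Sum>i<n. \<Sum>l<n. \<Sum>p<n. ?B i l * ?B p l * c i p)" by (rule sum.swap)
  also have "\<dots> = (\<Sum>i<n. \<Sum>p<n. \<Sum>l<n. ?B i l * ?B p l * c i p)"
    by (intro sum.cong refl sum.swap)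
  also have "\<dots> = (\<Sum>i<n. \<Sum>p<n. (\<Sum>j<n. \<Sum>q<n. ?G i j * ?G p q * c j q) * c i p)"
    by (simp add: sum_distrib_right[symmetric] gram')
  also have "\<dots> = (\<Sum>i<n. \<Sum>p<n. \<Sum>q<n. (\<Sum>j<n. ?G i j * c j q) * (?G p q * c i p))"
  proof (intro sum.cong refl)
    fix i p
    show "(\<Sum>j<n. \<Sum>q<n. ?G i j * ?G p q * c j q) * c i p = (\<Sum>q<n. (\<Sum>j<n. ?G i j * c j q) * (?G p q * c i p))"
      by (subst sum.swap) (simp add: sum_distrib_right sum_distrib_left mult_ac)
  qed
  also have "\<dots> = (\<Sum>i<n. \<Sum>q<n. \<Sum>p<n. (\<Sum>j<n. ?G i j * c j q) * (?G p q * c i p))"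
    by (intro sum.cong refl sum.swap)
  also have "\<dots> = (\<Sum>i<n. \<Sum>q<n. (\<Sum>j<n. ?G i j * c j q) * (\<Sum>p<n. ?G q p * c p i))"
    unfolding sum_distrib_left by (intro sum.cong refl) (subst res_sym, subst sym, simp)
  also have "\<dots> = (\<Sum>i<n. \<Sum>q<n. ((if i = q then 1 else 0) - x * ?G i q) * ((if q = i then 1 else 0) - x * ?G q i))"
    by (intro sum.cong refl) (simp add: res_c)
  also have "\<dots> = (\<Sum>i<n. \<Sum>q<n. (if q = i then 1 - 2 * x * ?G i q else 0) + x * (x * (?G i q)\<^sup>2))"
    by (intro sum.cong refl) (subst (2) res_sym, auto simp: algebra_simps power2_eq_square)
  also have "\<dots> = (\<Sum>i<n. 1 - 2 * x * ?G i i) + x * (x * (\<Sum>i<n. \<Sum>q<n. (?G i q)\<^sup>2))"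
    by (simp add: sum.distrib sum.delta sum_distrib_left)
  also have "(\<Sum>i<n. 1 - 2 * x * ?G i i) = n - 2 * x * tres x c n"
    by (simp add: tres_def[OF x sym] sum_subtractf sum_distrib_left)
  also have "n - 2 * x * tres x c n + x * (x * (\<Sum>i<n. \<Sum>q<n. (?G i q)\<^sup>2)) \<le>
             n - 2 * x * tres x c n + x * tres x c n"
    using res_sq_le x by (intro add_left_mono mult_left_mono) auto
  also have "\<dots> \<le> n"
    using tres_bounds(1)[OF x sym psd_gram] x by simp
  finally show ?thesis .
qed

lemma quad_sandwich:
  assumes r: "\<And>i. i < n \<Longrightarrow> r i = (\<Sum>k<n. L i k * v k)"
  shows "(\<Sum>i<n. r i * (\<Sum>j<n. res x c n i j * r j)) = (\<Sum>k<n. \<Sum>l<n. v k * sandwich k l * v l)"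
proof -
  let ?G = "res x c n"
  have "(\<Sum>k<n. \<Sum>l<n. v k * sandwich k l * v l) =
     (\<Sum>k<n. v k * (\<Sum>i<n. L i k * (\<Sum>j<n. ?G i j * (\<Sum>l<n. L j l * v l))))"
  proof (intro sum.cong refl)
    fix k
    have "(\<Sum>l<n. sandwich k l * v l) = (\<Sum>l<n. \<Sum>i<n. L i k * (\<Sum>j<n. ?G i j * L j l * v l))"
      unfolding sandwich_def by (simp add: sum_distrib_left sum_distrib_right mult_ac)
    also have "\<dots> = (\<Sum>i<n. L i k * (\<Sum>l<n. \<Sum>j<n. ?G i j * L j l * v l))"
      by (subst sum.swap) (simp add: sum_distrib_left)
    also have "\<dots> = (\<Sum>i<n. L i k * (\<Sum>j<n. ?G i j * (\<Sum>l<n. L j l * v l)))"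
      by (intro sum.cong refl, subst sum.swap) (simp add: sum_distrib_left mult_ac)
    finally show "(\<Sum>l<n. v k * sandwich k l * v l) = v k * (\<Sum>i<n. L i k * (\<Sum>j<n. ?G i j * (\<Sum>l<n. L j l * v l)))"
      by (simp add: sum_distrib_left[symmetric] mult.assoc)
  qed
  also have "\<dots> = (\<Sum>k<n. v k * (\<Sum>i<n. L i k * (\<Sum>j<n. ?G i j * r j)))"
    by (simp add: r)
  also have "\<dots> = (\<Sum>i<n. (\<Sum>k<n. L i k * v k) * (\<Sum>j<n. ?G i j * r j))"
    unfolding sum_distrib_left[of "v _"] by (subst sum.swap) (simp add: sum_distrib_right mult_ac)
  also have "\<dots> = (\<Sum>i<n. r i * (\<Sum>j<n. ?G i j * r j))" by (simp add: r)
  finally show ?thesis ..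
qed

end

subsection \<open>Eigenvalues\<close>

lemma scalar_prod_mult_mat_vec:
  assumes "C \<in> carrier_mat n n" "v \<in> carrier_vec n" "w \<in> carrier_vec n"
  shows "scalar_prod v (C *\<^sub>v w) = (\<Sum>i<n. \<Sum>j<n. vec_index v i * C $$ (i, j) * vec_index w j)"
  using assms
  by (auto simp: scalar_prod_def sum_distrib_left mult.assoc atLeast0LessThan intro!: sum.cong)

lemma psd_mat_iff:
  assumes C: "C \<in> carrier_mat n n"
  shows "psd_mat C \<longleftrightarrow> psd_fun n (\<lambda>i j. C $$ (i, j))"
proof
  assume P: "psd_mat C"
  show "psd_fun n (\<lambda>i j. C $$ (i, j))"
    unfolding psd_fun_def
  proof
    fix u :: "nat \<Rightarrow> real"
    have "0 \<le> scalar_prod (vec n u) (C *\<^sub>v vec n u)" using P C unfolding psd_mat_def by auto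
    then show "0 \<le> (\<Sum>i<n. \<Sum>j<n. u i * C $$ (i, j) * u j)"
      using C by (simp add: scalar_prod_mult_mat_vec[of C n])
  qed
next
  assume P: "psd_fun n (\<lambda>i j. C $$ (i, j))"
  show "psd_mat C" unfolding psd_mat_def
  proof
    fix v :: "real vec" assume "v \<in> carrier_vec (dim_row C)"
    then have v: "v \<in> carrier_vec n" using C by simp
    show "0 \<le> scalar_prod v (C *\<^sub>v v)"
      using P[unfolded psd_fun_def, rule_format, of "\<lambda>i. vec_index v i"] scalar_prod_mult_mat_vec[OF C v v] by simp
  qed
qed

lemma proots_prod_linear:
  "proots (\<Prod>a\<leftarrow>ls. [:- a, 1:]) = mset (ls :: real list)"
proof (induction ls)
  case (Cons a ls)
  have "(\<Prod>a\<leftarrow>ls. [:- a, 1:]) \<noteq> 0" by (auto simp: prod_list_zero_iff)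
  then have "proots (\<Prod>a\<leftarrow>a # ls. [:- a, 1:]) = proots [:- a, 1:] + proots (\<Prod>a\<leftarrow>ls. [:- a, 1:])"
    by (simp only: list.map prod_list.Cons) (rule proots_mult, auto)
  then show ?case using Cons by simp
qed simp

lemma poly_pderiv_prod_linear:
  fixes ls :: "real list"
  assumes "\<And>l. l \<in> set ls \<Longrightarrow> z \<noteq> l"
  shows "poly (pderiv (\<Prod>a\<leftarrow>ls. [:- a, 1:])) z = poly (\<Prod>a\<leftarrow>ls. [:- a, 1:]) z * (\<Sum>l\<leftarrow>ls. 1 / (z - l))"
  using assms
proof (induction ls)
  case (Cons a ls)
  have "z - a \<noteq> 0" using Cons.prems by auto
  then show ?case using Cons
    by (simp add: pderiv_mult pderiv_pCons algebra_simps del: mult_pCons_left mult_pCons_right) (simp add: field_simps)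
qed (simp add: pderiv_1)

text \<open>The eigenvector is split into its real part p and imaginary part q. Evaluating the
  bilinear form at p and q in both orders gives \<open>Im a * N = 0\<close>; adding the forms at p
  and at q gives \<open>Re a * N \<ge> 0\<close>, where N is the squared norm.\<close>

lemma symmetric_eigenvalue_aux:
  fixes C :: "nat \<Rightarrow> nat \<Rightarrow> real" and v :: "nat \<Rightarrow> complex" and a :: complex
  assumes sym: "\<And>i j. i < n \<Longrightarrow> j < n \<Longrightarrow> C i j = C j i" and psd: "psd_fun n C"
    and ev: "\<And>i. i < n \<Longrightarrow> (\<Sum>j<n. of_real (C i j) * v j) = a * v i"
    and nz: "k < n" "v k \<noteq> 0"
  shows "a \<in> \<real> \<and> Re a \<ge> 0"
proof -
  define p where "p i = Re (v i)" for i
  define q where "q i = Im (v i)" for i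
  define N where "N = (\<Sum>i<n. (p i)\<^sup>2 + (q i)\<^sup>2)"
  have 1: "(\<Sum>j<n. C i j * p j) = Re a * p i - Im a * q i" if "i < n" for i
    using arg_cong[OF ev[OF that], of Re] by (simp add: p_def q_def)
  have 2: "(\<Sum>j<n. C i j * q j) = Re a * q i + Im a * p i" if "i < n" for i
    using arg_cong[OF ev[OF that], of Im] by (simp add: p_def q_def)
  have N: "N > 0"
  proof -
    have "(p k)\<^sup>2 + (q k)\<^sup>2 > 0"
      using nz(2) unfolding p_def q_def by (simp add: complex_eq_iff sum_power2_gt_zero_iff)
    then show ?thesis unfolding N_def using nz(1)
      by (intro sum_pos2[of _ k]) auto
  qed
  have "(\<Sum>i<n. q i * (\<Sum>j<n. C i j * p j)) = (\<Sum>i<n. p i * (\<Sum>j<n. C i j * q j))"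
    unfolding sum_distrib_left
    by (subst sum.swap) (intro sum.cong refl, simp add: sym mult_ac)
  then have "(\<Sum>i<n. q i * (Re a * p i - Im a * q i)) = (\<Sum>i<n. p i * (Re a * q i + Im a * p i))"
    by (simp add: 1 2)
  then have "0 = (\<Sum>i<n. p i * (Re a * q i + Im a * p i) - q i * (Re a * p i - Im a * q i))"
    by (simp add: sum_subtractf)
  also have "\<dots> = Im a * N"
    unfolding N_def sum_distrib_left by (intro sum.cong refl) (simp add: algebra_simps power2_eq_square)
  finally have im: "Im a = 0" using N by simp
  have "0 \<le> (\<Sum>i<n. \<Sum>j<n. p i * C i j * p j) + (\<Sum>i<n. \<Sum>j<n. q i * C i j * q j)"
    using psd unfolding psd_fun_def by (intro add_nonneg_nonneg) auto
  also have "\<dots> = (\<Sum>i<n. p i * (\<Sum>j<n. C i j * p j)) + (\<Sum>i<n. q i * (\<Sum>j<n. C i j * q j))"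
    by (simp add: sum_distrib_left mult_ac)
  also have "\<dots> = (\<Sum>i<n. p i * (Re a * p i)) + (\<Sum>i<n. q i * (Re a * q i))"
    by (simp add: 1 2 im)
  also have "\<dots> = Re a * N"
    unfolding N_def sum_distrib_left sum.distrib[symmetric]
    by (intro sum.cong refl) (simp add: algebra_simps power2_eq_square)
  finally have "Re a \<ge> 0" using N by (simp add: zero_le_mult_iff)
  then show ?thesis using im by (simp add: complex_is_Real_iff)
qed

text \<open>The factorization is taken over the complex numbers, where it always exists. All roots
  turn out to be real, so the product over their real parts agrees with the characteristic
  polynomial at every real point.\<close>

lemma char_poly_psd_splits:
  fixes C :: "real mat"
  assumes C: "C \<in> carrier_mat n n" and sym: "transpose_mat C = C" and psd: "psd_mat C"
  shows "\<exists>ls. char_poly C = (\<Prod>a\<leftarrow>ls. [:- a, 1:]) \<and> length ls = n \<and> (\<forall>l\<in>set ls. l \<ge> 0)"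
proof -
  let ?A = "map_mat complex_of_real C"
  have A: "?A \<in> carrier_mat n n" using C by simp
  obtain as where as: "char_poly ?A = (\<Prod>a\<leftarrow>as. [:- a, 1:])" "length as = n"
    using char_poly_factorized[OF A] by blast
  have symC: "C $$ (i, j) = C $$ (j, i)" if "i < n" "j < n" for i j
    using arg_cong[OF sym, of "\<lambda>M. M $$ (i, j)"] that C by simp
  have re: "a \<in> \<real> \<and> Re a \<ge> 0" if a: "a \<in> set as" for a
  proof -
    have "poly (char_poly ?A) a = 0" unfolding as poly_prod_list using a
      by (auto simp: prod_list_zero_iff image_iff)
    then have "eigenvalue ?A a" using eigenvalue_root_char_poly[OF A] by simp
    then obtain v where v: "v \<in> carrier_vec n" "v \<noteq> 0\<^sub>v n" "?A *\<^sub>v v = a \<cdot>\<^sub>v v"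
      using A unfolding eigenvalue_def eigenvector_def by auto
    from v(1,2) obtain k where k: "k < n" "vec_index v k \<noteq> 0"
      by (metis carrier_vecD eq_vecI index_zero_vec)
    show ?thesis
    proof (rule symmetric_eigenvalue_aux[where C = "\<lambda>i j. C $$ (i, j)" and v = "\<lambda>i. vec_index v i"])
      show "psd_fun n (\<lambda>i j. C $$ (i, j))" using psd psd_mat_iff[OF C] by simp
      show "vec_index v k \<noteq> 0" "k < n" using k by auto
      fix i assume i: "i < n"
      have "vec_index (?A *\<^sub>v v) i = a * vec_index v i" using v(1) i unfolding v(3) by simp
      moreover have "vec_index (?A *\<^sub>v v) i = (\<Sum>j<n. of_real (C $$ (i, j)) * vec_index v j)"
        using C v(1) i by (auto simp: scalar_prod_def atLeast0LessThan intro!: sum.cong)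
      ultimately show "(\<Sum>j<n. of_real (C $$ (i, j)) * vec_index v j) = a * vec_index v i" by simp
    qed (use symC in auto)
  qed
  let ?ls = "map Re as"
  have "poly (char_poly C) t = poly (\<Prod>a\<leftarrow>?ls. [:- a, 1:]) t" for t
  proof -
    have "complex_of_real (poly (char_poly C) t) = poly (char_poly ?A) (of_real t)"
      unfolding of_real_hom.char_poly_hom[OF C] by (simp add: of_real_hom.poly_map_poly)
    also have "\<dots> = (\<Prod>a\<leftarrow>as. of_real t - a)"
      unfolding as poly_prod_list by (simp add: comp_def)
    also have "\<dots> = (\<Prod>a\<leftarrow>as. of_real (t - Re a))"
      using re by (intro arg_cong[of _ _ prod_list] map_cong refl) (auto simp: complex_is_Real_iff complex_eq_iff)
    also have "\<dots> = of_real (\<Prod>a\<leftarrow>as. (t - Re a))"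
      by (induction as) auto
    also have "(\<Prod>a\<leftarrow>as. (t - Re a)) = poly (\<Prod>a\<leftarrow>?ls. [:- a, 1:]) t"
      unfolding poly_prod_list by (simp add: comp_def)
    finally show ?thesis by (simp only: of_real_eq_iff)
  qed
  then have "char_poly C = (\<Prod>a\<leftarrow>?ls. [:- a, 1:])"
    by (simp add: poly_eq_poly_eq_iff[symmetric] fun_eq_iff)
  then show ?thesis using re as(2) by (intro exI[of _ ?ls]) auto
qed

text \<open>Both sides are -p'(-x) / p(-x) for the characteristic polynomial p. Its derivative is
  the sum of the characteristic polynomials of the principal submatrices, whose quotients by p yield
  the diagonal resolvent entries; its linear factors yield the logarithmic derivative.\<close>

lemma trace_res_eigenvalues:
  fixes C :: "real mat"
  assumes C: "C \<in> carrier_mat n n" and sym: "\<And>i j. c i j = c j i"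
    and c: "\<And>i j. i < n \<Longrightarrow> j < n \<Longrightarrow> C $$ (i, j) = c i j" and psd: "psd_fun n c"
    and ls: "char_poly C = (\<Prod>a\<leftarrow>ls. [:- a, 1:])" "\<forall>l\<in>set ls. l \<ge> 0"
    and x: "x > 0" and n: "n > 0"
  shows "tres x c n = (\<Sum>l\<leftarrow>ls. 1 / (l + x))"
proof -
  let ?M = "C + x \<cdot>\<^sub>m 1\<^sub>m n"
  let ?d = "Determinant.det"
  have M: "?M \<in> carrier_mat n n" using C by simp
  have neg: "?d (- B) = (-1) ^ m * ?d B" if "B \<in> carrier_mat m m" for B :: "real mat" and m
  proof -
    have "- B = (-1) \<cdot>\<^sub>m B" by auto
    then show ?thesis using that by simp
  qed
  have p: "poly (char_poly B) (- x) = (-1) ^ m * ?d (B + x \<cdot>\<^sub>m 1\<^sub>m m)" if B: "B \<in> carrier_mat m m" for B m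
  proof -
    have "char_matrix B (- x) = B + x \<cdot>\<^sub>m 1\<^sub>m m" using B unfolding char_matrix_def by auto
    then show ?thesis using B by (subst char_poly_matrix[OF B]) (simp add: neg[of _ m])
  qed
  have "poly (char_poly C) (- x) \<noteq> 0"
    unfolding ls(1) poly_prod_list using ls(2) x by (force simp: prod_list_zero_iff)
  then have d: "?d ?M \<noteq> 0" using p[OF C] by auto
  have res: "res x c n i i = ?d (mat_delete ?M i i) / ?d ?M" if i: "i < n" for i
  proof -
    have adj: "adj_mat ?M \<in> carrier_mat n n" "?M * adj_mat ?M = ?d ?M \<cdot>\<^sub>m 1\<^sub>m n"
      using adj_mat[OF M] by auto
    \<comment> \<open>The adjugate divided by the determinant inverts \<open>?M\<close>, so
      uniqueness identifies it with \<open>res\<close>.\<close>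
    have "adj_mat ?M $$ (i, i) / ?d ?M = res x c n i i"
    proof (rule inverse_unique[OF x sym psd, where B = "\<lambda>i j. adj_mat ?M $$ (i, j) / ?d ?M"])
      fix i j assume ij: "i < n" "j < n"
      have "(?M * adj_mat ?M) $$ (i, j) = (\<Sum>k<n. (C $$ (i, k) + (if i = k then x else 0)) * adj_mat ?M $$ (k, j))"
        using ij C adj(1) by (auto simp: scalar_prod_def atLeast0LessThan intro!: sum.cong)
      also have "\<dots> = (\<Sum>k<n. c i k * adj_mat ?M $$ (k, j)) + x * adj_mat ?M $$ (i, j)"
      proof -
        have "(\<Sum>k<n. (C $$ (i, k) + (if i = k then x else 0)) * adj_mat ?M $$ (k, j)) =
          (\<Sum>k<n. c i k * adj_mat ?M $$ (k, j) + (if i = k then x * adj_mat ?M $$ (k, j) else 0))"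
          using ij by (intro sum.cong refl) (simp add: c algebra_simps)
        then show ?thesis using ij by (simp add: sum.distrib)
      qed
      finally have "(\<Sum>k<n. c i k * adj_mat ?M $$ (k, j)) + x * adj_mat ?M $$ (i, j) = ?d ?M * (if i = j then 1 else 0)"
        using ij unfolding adj(2) by simp
      then show "(\<Sum>k<n. c i k * (adj_mat ?M $$ (k, j) / ?d ?M)) + x * (adj_mat ?M $$ (i, j) / ?d ?M) = (if i = j then 1 else 0)"
        using d by (simp add: sum_divide_distrib[symmetric] add_divide_distrib[symmetric])
    qed (use i in auto)
    moreover have "adj_mat ?M $$ (i, i) = ?d (mat_delete ?M i i)"
      using M i unfolding adj_mat_def cofactor_def by (simp add: power_add[symmetric] mult_2[symmetric])
    ultimately show ?thesis by simp
  qed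
  have "poly (pderiv (char_poly C)) (- x) = (\<Sum>i<n. poly (char_poly (mat_delete C i i)) (- x))"
    unfolding pderiv_char_poly[OF C] by (simp add: poly_sum)
  also have "\<dots> = (\<Sum>i<n. (-1) ^ (n - 1) * ?d (mat_delete ?M i i))"
  proof (intro sum.cong refl)
    fix i assume "i \<in> {..<n}"
    then have i: "i < n" by simp
    have "mat_delete C i i + x \<cdot>\<^sub>m 1\<^sub>m (n - 1) = mat_delete ?M i i"
      using C i unfolding mat_delete_def by (intro eq_matI) auto
    then show "poly (char_poly (mat_delete C i i)) (- x) = (-1) ^ (n - 1) * ?d (mat_delete ?M i i)"
      using p[OF mat_delete_carrier[OF C], of i i] by simp
  qed
  also have "\<dots> = (-1) ^ (n - 1) * (tres x c n * ?d ?M)"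
    using d by (simp add: tres_def[OF x sym] res sum_distrib_left sum_distrib_right)
  finally have 1: "poly (pderiv (char_poly C)) (- x) = (-1) ^ (n - 1) * (tres x c n * ?d ?M)" .
  have "poly (pderiv (char_poly C)) (- x) = poly (char_poly C) (- x) * (\<Sum>l\<leftarrow>ls. 1 / (- x - l))"
    unfolding ls(1) by (rule poly_pderiv_prod_linear) (use ls(2) x in auto)
  also have "(\<Sum>l\<leftarrow>ls. 1 / (- x - l)) = - (\<Sum>l\<leftarrow>ls. 1 / (l + x))"
  proof (induction ls)
    case (Cons a ls)
    have "- x - a = - (a + x)" by simp
    then have "1 / (- x - a) = - (1 / (a + x))" by (simp only: minus_divide_right[symmetric])
    then show ?case using Cons by simp
  qed simp
  finally have "(-1) ^ (n - 1) * (tres x c n * ?d ?M) = (-1) ^ n * ?d ?M * - (\<Sum>l\<leftarrow>ls. 1 / (l + x))"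
    using 1 p[OF C] by simp
  moreover have "(-1::real) ^ n = - ((-1) ^ (n - 1))" using n by (cases n) auto
  ultimately show ?thesis using d by simp
qed

subsection \<open>Moments of rotation invariant laws on the ball\<close>

definition sqn :: "'i set \<Rightarrow> ('i \<Rightarrow> real) \<Rightarrow> real" where
  "sqn I v = (\<Sum>i\<in>I. (v i)\<^sup>2)"

text \<open>With s the squared norm of a Cholesky row, this is its density up to normalization. The
  cutoff has to be explicit, since \<open>powr\<close> of a negative number is not 0.\<close>

definition ball_weight :: "real \<Rightarrow> real \<Rightarrow> real" where
  "ball_weight a s = (if s < 1 then (1 - s) powr (a - 1) else 0)"

lemma ball_weight_nonneg [simp]: "ball_weight a s \<ge> 0"
  by (simp add: ball_weight_def)

lemma measurable_ball_weight [measurable]: "ball_weight a \<in> borel_measurable borel"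
  unfolding ball_weight_def by measurable

lemma measurable_sqn [measurable]: "sqn I \<in> borel_measurable (Pi\<^sub>M I (\<lambda>_. lborel))"
  unfolding sqn_def by measurable

lemma power2_powr: "x > 0 \<Longrightarrow> (x\<^sup>2) powr c = x powr (2 * c)" for x :: real
proof -
  assume "x > 0"
  then have "x\<^sup>2 = x powr 2" by simp
  then show ?thesis by (simp only: powr_powr)
qed

text \<open>This is the Beta integral over [0, 1] after substituting the square, and doubled because
  the integrand is even.\<close>

lemma nn_integral_ball_weight:
  assumes a: "a > 0"
  shows "(\<integral>\<^sup>+t. ennreal (ball_weight a (t\<^sup>2) * t ^ (2 * p)) \<partial>lborel) = ennreal (Beta (p + 1 / 2) a)"
proof -
  let ?q = "real p + 1 / 2"
  let ?h = "\<lambda>x. ennreal ((1 - x\<^sup>2) powr (a - 1) * x ^ (2 * p) * indicator {0..1} x)"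
  have "((\<lambda>t. t powr (?q - 1) * (1 - t) powr (a - 1)) has_integral Beta ?q a) {0..1}"
    using has_integral_Beta_real[of ?q a] a by simp
  from nn_integral_has_integral_lebesgue[OF _ this] have
     "ennreal (Beta ?q a) =
        nn_integral lborel (\<lambda>t. ennreal (t powr (?q - 1) * (1 - t) powr (a - 1) * indicator {0^2..1^2} t))"
    by (simp add: mult_ac ennreal_mult' ennreal_indicator)
  also have "\<dots> = (\<integral>\<^sup>+ x. ennreal (x\<^sup>2 powr (?q - 1) * (1 - x\<^sup>2) powr (a - 1) * (2 * x) * indicator {0..1} x) \<partial>lborel)"
    by (subst nn_integral_substitution[where g = "\<lambda>x. x ^ 2" and g' = "\<lambda>x. 2 * x"])
       (auto intro!: derivative_eq_intros continuous_intros simp: set_borel_measurable_def)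
  also have "\<dots> = (\<integral>\<^sup>+ x. 2 * ?h x \<partial>lborel)"
  \<comment> \<open>For \<open>p = 0\<close> the two integrands differ at the origin: the factor
    \<open>2 * x\<close> is 0 there while \<open>x ^ 0\<close> is 1.\<close>
  proof (intro nn_integral_cong_AE AE_I[of _ _ "{0}"] subsetI)
    fix x assume "x \<in> {x \<in> space lborel. \<not> ennreal (x\<^sup>2 powr (?q - 1) * (1 - x\<^sup>2) powr (a - 1) * (2 * x) * indicator {0..1} x) = 2 * ?h x}"
    moreover have "ennreal (x\<^sup>2 powr (?q - 1) * (1 - x\<^sup>2) powr (a - 1) * (2 * x) * indicator {0..1} x) = 2 * ?h x" if "x > 0"
    proof -
      have "x\<^sup>2 powr (?q - 1) * x = x powr (2 * (?q - 1)) * x powr 1"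
        using that by (simp add: power2_powr)
      also have "\<dots> = x powr real (2 * p)"
        proof -
        have "real (2 * p) = 2 * (?q - 1) + 1" by simp
        then show ?thesis by (simp only: powr_add)
      qed
      also have "\<dots> = x ^ (2 * p)" using that by (rule powr_realpow)
      finally have eq: "x\<^sup>2 powr (?q - 1) * x = x ^ (2 * p)" .
      have "x\<^sup>2 powr (?q - 1) * (1 - x\<^sup>2) powr (a - 1) * (2 * x) * indicator {0..1} x =
         2 * ((1 - x\<^sup>2) powr (a - 1) * x ^ (2 * p) * indicator {0..1} x)"
        unfolding eq[symmetric] by (simp only: mult_ac)
      then show ?thesis by (simp only: ennreal_mult'[of 2] ennreal_numeral zero_le_numeral)
    qed
    moreover have "ennreal (x\<^sup>2 powr (?q - 1) * (1 - x\<^sup>2) powr (a - 1) * (2 * x) * indicator {0..1} x) = 2 * ?h x" if "x < 0"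
      using that by simp
    ultimately have "\<not> x > 0 \<and> \<not> x < 0" by blast
    then show "x \<in> {0}" by simp
  qed auto
  also have "\<dots> = (\<integral>\<^sup>+ x. ?h x \<partial>lborel) + (\<integral>\<^sup>+ x. ?h x \<partial>lborel)" (is "_ = ?I + _")
    by (simp add: mult_2 nn_integral_add)
  also have "?I = (\<integral>\<^sup>+ x. ennreal ((1 - x\<^sup>2) powr (a - 1) * x ^ (2 * p) * indicator {-1..0} x) \<partial>lborel)"
    by (subst nn_integral_real_affine[of _ "-1" 0])
       (auto simp: indicator_def intro!: nn_integral_cong)
  hence "?I + ?I = \<dots> + ?I" by simp
  also have "\<dots> = (\<integral>\<^sup>+ x. ennreal ((1 - x\<^sup>2) powr (a - 1) * x ^ (2 * p) *
                    (indicator {-1..0} x + indicator{0..1} x)) \<partial>lborel)"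
    by (subst nn_integral_add [symmetric]) (auto simp: algebra_simps zero_le_even_power)
  also have "\<dots> = (\<integral>\<^sup>+ x. ennreal (ball_weight a (x\<^sup>2) * x ^ (2 * p)) \<partial>lborel)"
  \<comment> \<open>The half intervals overlap at 0; their end points are put into the null set as
    well.\<close>
  proof (intro nn_integral_cong_AE AE_I[of _ _ "{0, 1, -1}"] subsetI)
    fix x :: real
    assume x: "x \<in> {x \<in> space lborel. \<not> ennreal ((1 - x\<^sup>2) powr (a - 1) * x ^ (2 * p) * (indicator {-1..0} x + indicator{0..1} x)) = ennreal (ball_weight a (x\<^sup>2) * x ^ (2 * p))}"
    have "x\<^sup>2 < 1 \<longleftrightarrow> -1 < x \<and> x < 1" by (simp add: abs_square_less_1 abs_less_iff) auto
    then show "x \<in> {0, 1, -1}" using x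
      by (cases "x \<le> 0") (auto simp: ball_weight_def indicator_def split: if_splits)
  qed (auto simp: emeasure_lborel_countable)
  finally show ?thesis ..
qed

text \<open>Scaling by \<open>r = sqrt (1 - s)\<close> reduces this to the case s = 0. Integrating
  out a coordinate raises the parameter by \<open>p + 1 / 2\<close> and keeps the shape of the
  weight, which is what lets the induction over the coordinates close.\<close>

lemma nn_integral_ball_weight_shift:
  assumes a: "a > 0"
  shows "(\<integral>\<^sup>+t. ennreal (ball_weight a (s + t\<^sup>2) * t ^ (2 * p)) \<partial>lborel) =
    ennreal (ball_weight (a + p + 1 / 2) s * Beta (p + 1 / 2) a)"
proof (cases "s < 1")
  case False
  then have "ball_weight a (s + t\<^sup>2) = 0" for t
    unfolding ball_weight_def using zero_le_power2[of t] by (simp add: not_less add_increasing2)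
  then show ?thesis using False by (simp add: ball_weight_def)
next
  case True
  define r where "r = sqrt (1 - s)"
  have r: "r > 0" "r\<^sup>2 = 1 - s" using True by (auto simp: r_def)
  have "ball_weight a (s + (r * t)\<^sup>2) * (r * t) ^ (2 * p) = (r\<^sup>2) powr (a - 1) * r ^ (2 * p) * (ball_weight a (t\<^sup>2) * t ^ (2 * p))" for t
  proof -
    have eq: "1 - (s + (r * t)\<^sup>2) = r\<^sup>2 * (1 - t\<^sup>2)" by (simp add: r(2) power_mult_distrib algebra_simps)
    have "s + (r * t)\<^sup>2 < 1 \<longleftrightarrow> r\<^sup>2 * (1 - t\<^sup>2) > 0" using eq by linarith
    also have "\<dots> \<longleftrightarrow> t\<^sup>2 < 1" using r(1) by (simp add: zero_less_mult_iff)
    finally show ?thesis unfolding ball_weight_def eq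
      by (auto simp: powr_mult power_mult_distrib)
  qed
  note eq = this
  have c: "r * ((r\<^sup>2) powr (a - 1) * r ^ (2 * p)) = ball_weight (a + p + 1 / 2) s"
  proof -
    have "r * ((r\<^sup>2) powr (a - 1) * r ^ (2 * p)) = r powr 1 * (r powr (2 * (a - 1)) * r powr (2 * p))"
    proof -
      have "r ^ (2 * p) = r powr real (2 * p)" by (rule powr_realpow[symmetric, OF r(1)])
      moreover have "r powr 1 = r" using r(1) by simp
      ultimately show ?thesis by (simp only: power2_powr[OF r(1)])
    qed
    also have "\<dots> = r powr (2 * (a + p + 1 / 2 - 1))"
    proof -
      have "2 * (a + p + 1 / 2 - 1) = 1 + (2 * (a - 1) + real (2 * p))" by simp
      then show ?thesis by (simp only: powr_add)
    qed
    also have "\<dots> = (r\<^sup>2) powr (a + p + 1 / 2 - 1)"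
      using r(1) by (simp add: power2_powr)
    finally show ?thesis using True r(2) by (simp add: ball_weight_def)
  qed
  have "(\<integral>\<^sup>+t. ennreal (ball_weight a (s + t\<^sup>2) * t ^ (2 * p)) \<partial>lborel) =
     ennreal r * (\<integral>\<^sup>+t. ennreal (ball_weight a (s + (r * t)\<^sup>2) * (r * t) ^ (2 * p)) \<partial>lborel)"
    using r(1) by (subst nn_integral_real_affine[of _ r 0]) (simp_all add: abs_of_pos)
  also have "\<dots> = ennreal r * (ennreal ((r\<^sup>2) powr (a - 1) * r ^ (2 * p)) * ennreal (Beta (p + 1 / 2) a))"
    unfolding eq using r(1) nn_integral_ball_weight[OF a, of p]
    by (simp add: ennreal_mult' nn_integral_cmult zero_le_even_power)
  also have "\<dots> = ennreal (ball_weight (a + p + 1 / 2) s * Beta (p + 1 / 2) a)"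
    unfolding c[symmetric] using r(1) a
    by (simp add: ennreal_mult' mult.assoc zero_le_even_power)
  finally show ?thesis .
qed

text \<open>The value of a Dirichlet integral. Only even powers are represented, the exponents being
  \<open>2 * p i\<close>; moments with an odd exponent vanish by reflection.\<close>

definition ball_moment :: "'i set \<Rightarrow> real \<Rightarrow> ('i \<Rightarrow> nat) \<Rightarrow> real" where
  "ball_moment I a p = (\<Prod>i\<in>I. Gamma (p i + 1 / 2)) * Gamma a / Gamma (real (\<Sum>i\<in>I. p i) + real (card I) / 2 + a)"

text \<open>One coordinate is integrated out at a time. Each contributes a Beta value with the
  parameter reached so far, and the product of these values telescopes to the quotient of Gamma
  values.\<close>

lemma nn_integral_ball_moment:
  assumes "finite I" "a > 0"
  shows "(\<integral>\<^sup>+v. ennreal (ball_weight a (sqn I v) * (\<Prod>i\<in>I. v i ^ (2 * p i))) \<partial>Pi\<^sub>M I (\<lambda>_. lborel)) =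
    ennreal (ball_moment I a p)"
  using assms
proof (induction I arbitrary: a)
  case empty
  interpret product_sigma_finite "\<lambda>_::'a. lborel :: real measure" by standard
  have "ball_moment {} a p = 1"
    using Gamma_real_pos[OF empty(1)] by (simp add: ball_moment_def)
  then show ?case
    by (subst nn_integral_empty) (auto simp: sqn_def ball_weight_def)
next
  case (insert i I)
  interpret product_sigma_finite "\<lambda>_::'a. lborel :: real measure" by standard
  let ?a = "a + p i + 1 / 2"
  have "(\<integral>\<^sup>+v. ennreal (ball_weight a (sqn (insert i I) v) * (\<Prod>j\<in>insert i I. v j ^ (2 * p j))) \<partial>Pi\<^sub>M (insert i I) (\<lambda>_. lborel))
    = (\<integral>\<^sup>+x. \<integral>\<^sup>+y. ennreal (ball_weight a (sqn (insert i I) (x(i := y))) * (\<Prod>j\<in>insert i I. (x(i := y)) j ^ (2 * p j))) \<partial>lborel \<partial>Pi\<^sub>M I (\<lambda>_. lborel))"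
    by (rule product_nn_integral_insert) (use insert in auto)
  also have "\<dots> = (\<integral>\<^sup>+x. ennreal (\<Prod>j\<in>I. x j ^ (2 * p j)) * (\<integral>\<^sup>+y. ennreal (ball_weight a (sqn I x + y\<^sup>2) * y ^ (2 * p i)) \<partial>lborel) \<partial>Pi\<^sub>M I (\<lambda>_. lborel))"
  proof (intro nn_integral_cong)
    fix x :: "'a \<Rightarrow> real"
    have 1: "sqn (insert i I) (x(i := y)) = sqn I x + y\<^sup>2" for y
    proof -
      have "(\<Sum>j\<in>I. ((x(i := y)) j)\<^sup>2) = (\<Sum>j\<in>I. (x j)\<^sup>2)" using insert by (intro sum.cong) auto
      then show ?thesis unfolding sqn_def using insert by simp
    qed
    have 2: "(\<Prod>j\<in>insert i I. (x(i := y)) j ^ (2 * p j)) = (\<Prod>j\<in>I. x j ^ (2 * p j)) * y ^ (2 * p i)" for y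
    proof -
      have "(\<Prod>j\<in>I. (x(i := y)) j ^ (2 * p j)) = (\<Prod>j\<in>I. x j ^ (2 * p j))" using insert by (intro prod.cong) auto
      then show ?thesis using insert by simp
    qed
    have 3: "(\<Prod>j\<in>I. x j ^ (2 * p j)) \<ge> 0" by (intro prod_nonneg) (auto simp: zero_le_even_power)
    show "(\<integral>\<^sup>+y. ennreal (ball_weight a (sqn (insert i I) (x(i := y))) * (\<Prod>j\<in>insert i I. (x(i := y)) j ^ (2 * p j))) \<partial>lborel)
      = ennreal (\<Prod>j\<in>I. x j ^ (2 * p j)) * (\<integral>\<^sup>+y. ennreal (ball_weight a (sqn I x + y\<^sup>2) * y ^ (2 * p i)) \<partial>lborel)"
      unfolding 1 2 using 3
      by (subst nn_integral_cmult[symmetric]) (auto simp: ennreal_mult'[symmetric] mult_ac)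
  qed
  also have "\<dots> = (\<integral>\<^sup>+x. ennreal (Beta (p i + 1 / 2) a) * ennreal (ball_weight ?a (sqn I x) * (\<Prod>j\<in>I. x j ^ (2 * p j))) \<partial>Pi\<^sub>M I (\<lambda>_. lborel))"
    unfolding nn_integral_ball_weight_shift[OF insert.prems]
  proof (intro nn_integral_cong)
    fix x :: "'a \<Rightarrow> real"
    have 3: "(\<Prod>j\<in>I. x j ^ (2 * p j)) \<ge> 0" by (intro prod_nonneg) (auto simp: zero_le_even_power)
    show "ennreal (\<Prod>j\<in>I. x j ^ (2 * p j)) * ennreal (ball_weight ?a (sqn I x) * Beta (p i + 1 / 2) a) =
      ennreal (Beta (p i + 1 / 2) a) * ennreal (ball_weight ?a (sqn I x) * (\<Prod>j\<in>I. x j ^ (2 * p j)))"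
      using 3 insert.prems
      by (simp add: ennreal_mult'[symmetric] ennreal_mult''[symmetric] Beta_def mult_ac)
  qed
  also have "\<dots> = ennreal (Beta (p i + 1 / 2) a) * ennreal (ball_moment I ?a p)"
    using insert.IH[of ?a] insert.prems by (subst nn_integral_cmult) auto
  also have "\<dots> = ennreal (Beta (p i + 1 / 2) a * ball_moment I ?a p)"
  proof -
    have "Beta (p i + 1 / 2) a \<ge> 0" unfolding Beta_def using insert.prems
      by (intro divide_nonneg_pos mult_nonneg_nonneg less_imp_le[OF Gamma_real_pos] Gamma_real_pos) auto
    then show ?thesis by (rule ennreal_mult'[symmetric])
  qed
  also have "Beta (p i + 1 / 2) a * ball_moment I ?a p = ball_moment (insert i I) a p"
  proof -
    have g: "Gamma ?a > 0" using insert.prems by (intro Gamma_real_pos) auto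
    have s: "real (\<Sum>j\<in>insert i I. p j) + real (card (insert i I)) / 2 + a = real (\<Sum>j\<in>I. p j) + real (card I) / 2 + ?a"
      using insert.hyps by (simp add: field_simps)
    have e: "real (p i) + 1 / 2 + a = ?a" by simp
    have gen: "P * A / G * (Q * G / T) = P * Q * A / T" if "G \<noteq> 0" for P A G Q T :: real
      using that by simp
    show ?thesis unfolding ball_moment_def s Beta_def e prod.insert[OF insert.hyps]
      by (rule gen) (use g in simp)
  qed
  finally show ?case .
qed

lemma ball_moment_pos: "finite I \<Longrightarrow> a > 0 \<Longrightarrow> ball_moment I a p > 0"
  unfolding ball_moment_def
  by (intro divide_pos_pos mult_pos_pos prod_pos ballI Gamma_real_pos add_nonneg_pos add_nonneg_nonneg) (auto intro!: sum_nonneg)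

definition ball_norm :: "'i set \<Rightarrow> real \<Rightarrow> real" where
  "ball_norm I a = ball_moment I a (\<lambda>_. 0)"

definition ball_law :: "'i set \<Rightarrow> real \<Rightarrow> ('i \<Rightarrow> real) measure" where
  "ball_law I a = density (Pi\<^sub>M I (\<lambda>_. lborel)) (\<lambda>v. ennreal (ball_weight a (sqn I v) / ball_norm I a))"

lemma sets_ball_law [measurable_cong, simp]: "sets (ball_law I a) = sets (Pi\<^sub>M I (\<lambda>_. borel))"
  unfolding ball_law_def sets_density by (intro sets_PiM_cong) auto

context
  fixes I :: "'i set" and a :: real
  assumes I: "finite I" and a: "a > 0"
begin

lemma ball_norm_pos: "ball_norm I a > 0"
  unfolding ball_norm_def using I a by (rule ball_moment_pos)

text \<open>The constant is multiplied across so that no division by an \<open>ennreal\<close>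
  occurs.\<close>

lemma nn_integral_ball_law:
  assumes [measurable]: "f \<in> borel_measurable (Pi\<^sub>M I (\<lambda>_. borel))"
  shows "ennreal (ball_norm I a) * (\<integral>\<^sup>+v. f v \<partial>ball_law I a) =
     (\<integral>\<^sup>+v. ennreal (ball_weight a (sqn I v)) * f v \<partial>Pi\<^sub>M I (\<lambda>_. lborel))"
proof -
  have [measurable]: "f \<in> borel_measurable (Pi\<^sub>M I (\<lambda>_. lborel))"
    using assms by (simp cong: measurable_cong_sets sets_PiM_cong)
  show ?thesis
    unfolding ball_law_def using ball_norm_pos
    by (subst nn_integral_density, simp, simp, subst nn_integral_cmult[symmetric], simp)
       (auto intro!: nn_integral_cong simp: mult.assoc[symmetric] ennreal_mult'[symmetric])
qed

lemma nn_integral_ball_law_moment: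
  "(\<integral>\<^sup>+v. ennreal (\<Prod>i\<in>I. v i ^ (2 * p i)) \<partial>ball_law I a) = ennreal (ball_moment I a p / ball_norm I a)"
proof -
  have "ennreal (ball_norm I a) * (\<integral>\<^sup>+v. ennreal (\<Prod>i\<in>I. v i ^ (2 * p i)) \<partial>ball_law I a) = ennreal (ball_moment I a p)"
    by (subst nn_integral_ball_law) (simp, simp add: nn_integral_ball_moment[OF I a, symmetric] ennreal_mult')
  then have "ennreal (1 / ball_norm I a) * (ennreal (ball_norm I a) * (\<integral>\<^sup>+v. ennreal (\<Prod>i\<in>I. v i ^ (2 * p i)) \<partial>ball_law I a))
     = ennreal (ball_moment I a p / ball_norm I a)"
    using ball_norm_pos by (simp add: ennreal_mult'[symmetric])
  then show ?thesis using ball_norm_pos by (simp add: mult.assoc[symmetric] ennreal_mult'[symmetric])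
qed

lemma prob_space_ball_law: "prob_space (ball_law I a)"
proof
  have "emeasure (ball_law I a) (space (ball_law I a)) = (\<integral>\<^sup>+v. ennreal (\<Prod>i\<in>I. v i ^ (2 * 0)) \<partial>ball_law I a)"
    by simp
  also have "\<dots> = 1"
    unfolding nn_integral_ball_law_moment using ball_norm_pos by (simp add: ball_norm_def)
  finally show "emeasure (ball_law I a) (space (ball_law I a)) = 1" .
qed

interpretation prob_space "ball_law I a" by (rule prob_space_ball_law)

lemma AE_ball_law: "AE v in ball_law I a. sqn I v < 1"
  unfolding ball_law_def by (subst AE_density) (auto simp: ball_weight_def split: if_splits)

lemma abs_le_1_of_sqn: "sqn I v < 1 \<Longrightarrow> i \<in> I \<Longrightarrow> \<bar>v i\<bar> \<le> 1"
proof -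
  assume s: "sqn I v < 1" and i: "i \<in> I"
  have "(v i)\<^sup>2 \<le> sqn I v" unfolding sqn_def using I i by (intro member_le_sum) auto
  then have "(v i)\<^sup>2 \<le> 1" using s by linarith
  then show ?thesis by (simp add: abs_square_le_1)
qed

lemma integrable_ball_law:
  fixes f :: "('i \<Rightarrow> real) \<Rightarrow> real"
  assumes [measurable]: "f \<in> borel_measurable (Pi\<^sub>M I (\<lambda>_. borel))"
    and "\<And>v. sqn I v < 1 \<Longrightarrow> \<bar>f v\<bar> \<le> B"
  shows "integrable (ball_law I a) f"
proof (rule integrable_const_bound)
  show "AE v in ball_law I a. norm (f v) \<le> B" using AE_ball_law assms(2) by auto
qed simp

text \<open>Coordinate i is separated by Fubini and reflected in its one-dimensional integral; the
  weight depends on its square only.\<close>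

lemma nn_integral_flip:
  assumes i: "i \<in> I" and f[measurable]: "f \<in> borel_measurable (Pi\<^sub>M I (\<lambda>_. borel))"
  shows "(\<integral>\<^sup>+v. f (v(i := - v i)) \<partial>ball_law I a) = (\<integral>\<^sup>+v. f v \<partial>ball_law I a)"
proof -
  interpret product_sigma_finite "\<lambda>_::'i. lborel :: real measure" by standard
  let ?J = "I - {i}"
  have IJ: "I = insert i ?J" using i by auto
  have fl[measurable]: "(\<lambda>v. v(i := - v i)) \<in> measurable (Pi\<^sub>M I (\<lambda>_. borel)) (Pi\<^sub>M I (\<lambda>_. borel :: real measure))"
  proof (rule measurable_PiM_single')
    fix j assume j: "j \<in> I"
    show "(\<lambda>v. (v(i := - v i)) j) \<in> borel_measurable (Pi\<^sub>M I (\<lambda>_. borel :: real measure))"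
      using i j by (cases "j = i") auto
  qed (use i in \<open>auto simp: space_PiM PiE_def extensional_def\<close>)
  define g where "g v = ennreal (ball_weight a (sqn I v)) * f v" for v
  have sb: "sets (Pi\<^sub>M I (\<lambda>_. lborel)) = sets (Pi\<^sub>M I (\<lambda>_. borel :: real measure))"
    by (intro sets_PiM_cong) auto
  have [measurable]: "f \<in> borel_measurable (Pi\<^sub>M I (\<lambda>_. lborel))"
    using f sb by (simp cong: measurable_cong_sets)
  have g: "g \<in> borel_measurable (Pi\<^sub>M I (\<lambda>_. lborel))" unfolding g_def by measurable
  have g': "g \<in> borel_measurable (Pi\<^sub>M (insert i ?J) (\<lambda>_. lborel))" using g IJ by simp
  have flg: "(\<lambda>v. v(i := - v i)) \<in> measurable (Pi\<^sub>M I (\<lambda>_. lborel)) (Pi\<^sub>M I (\<lambda>_. lborel :: real measure))"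
    using fl sb by (simp cong: measurable_cong_sets)
  have sq: "sqn I (v(i := - v i)) = sqn I v" for v
    unfolding sqn_def by (intro sum.cong) auto
  have "(\<integral>\<^sup>+v. g (v(i := - v i)) \<partial>Pi\<^sub>M I (\<lambda>_. lborel)) =
     (\<integral>\<^sup>+x. \<integral>\<^sup>+y. g ((x(i := y))(i := - (x(i := y)) i)) \<partial>lborel \<partial>Pi\<^sub>M ?J (\<lambda>_. lborel))"
    by (subst IJ, rule product_nn_integral_insert) (use I measurable_compose[OF flg g] in \<open>auto simp: insert_absorb[OF i]\<close>)
  also have "\<dots> = (\<integral>\<^sup>+x. \<integral>\<^sup>+y. g (x(i := y)) \<partial>lborel \<partial>Pi\<^sub>M ?J (\<lambda>_. lborel))"
  proof (rule nn_integral_cong)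
    fix x assume x: "x \<in> space (Pi\<^sub>M ?J (\<lambda>_. lborel :: real measure))"
    have "(\<lambda>y. g (x(i := y))) \<in> borel_measurable lborel"
      using measurable_comp[OF measurable_component_update g', OF x] unfolding comp_def by blast
    then have [measurable]: "(\<lambda>y. g (x(i := y))) \<in> borel_measurable borel"
      by (simp only: measurable_lborel2)
    show "(\<integral>\<^sup>+y. g ((x(i := y))(i := - (x(i := y)) i)) \<partial>lborel) = (\<integral>\<^sup>+y. g (x(i := y)) \<partial>lborel)"
      by (subst (2) nn_integral_real_affine[of _ "-1" 0]) auto
  qed
  also have "\<dots> = (\<integral>\<^sup>+v. g v \<partial>Pi\<^sub>M I (\<lambda>_. lborel))"
    by (subst (2) IJ, rule product_nn_integral_insert[symmetric]) (use I g in \<open>auto simp: insert_absorb[OF i]\<close>)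
  finally have eq: "(\<integral>\<^sup>+v. g (v(i := - v i)) \<partial>Pi\<^sub>M I (\<lambda>_. lborel)) = (\<integral>\<^sup>+v. g v \<partial>Pi\<^sub>M I (\<lambda>_. lborel))" .
  have "ennreal (ball_norm I a) * (\<integral>\<^sup>+v. f (v(i := - v i)) \<partial>ball_law I a) = (\<integral>\<^sup>+v. g (v(i := - v i)) \<partial>Pi\<^sub>M I (\<lambda>_. lborel))"
    by (subst nn_integral_ball_law) (use measurable_compose[OF fl f] in \<open>auto simp: g_def sq\<close>)
  also have "\<dots> = ennreal (ball_norm I a) * (\<integral>\<^sup>+v. f v \<partial>ball_law I a)"
    by (simp only: eq nn_integral_ball_law[OF f]) (simp only: g_def[abs_def])
  finally have "ennreal (ball_norm I a) * (\<integral>\<^sup>+v. f (v(i := - v i)) \<partial>ball_law I a) = ennreal (ball_norm I a) * (\<integral>\<^sup>+v. f v \<partial>ball_law I a)" .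
  then show ?thesis using ball_norm_pos by (simp add: ennreal_mult_cancel_left)
qed

lemma integral_odd_eq_0:
  fixes h :: "('i \<Rightarrow> real) \<Rightarrow> real"
  assumes i: "i \<in> I" and h[measurable]: "h \<in> borel_measurable (Pi\<^sub>M I (\<lambda>_. borel))"
    and odd: "\<And>v. h (v(i := - v i)) = - h v"
  shows "integral\<^sup>L (ball_law I a) h = 0"
proof (cases "integrable (ball_law I a) h")
  case True
  have "(\<integral>\<^sup>+v. ennreal (- h v) \<partial>ball_law I a) = (\<integral>\<^sup>+v. ennreal (h v) \<partial>ball_law I a)"
    using nn_integral_flip[OF i, of "\<lambda>v. ennreal (h v)"] by (simp add: odd)
  then show ?thesis by (simp add: real_lebesgue_integral_def[OF True])
\<comment> \<open>In the remaining case the integral is 0 by convention.\<close>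
qed (rule not_integrable_integral_eq)

text \<open>The moments of order two and four depend on \<open>card I\<close> and \<open>a\<close>
  through this number alone. For the Cholesky row of length n, with
  \<open>a = (\<nu> - n) / 2\<close>, it equals \<open>\<nu>\<close> for every n
  (\<open>dof_col\<close>).\<close>

definition dof where "dof = card I + 2 * a"

lemma dof_pos: "dof > 0" unfolding dof_def using a by simp

lemma integral_moment:
  "integral\<^sup>L (ball_law I a) (\<lambda>v. \<Prod>i\<in>I. v i ^ (2 * p i)) = ball_moment I a p / ball_norm I a"
proof -
  have "has_bochner_integral (ball_law I a) (\<lambda>v. \<Prod>i\<in>I. v i ^ (2 * p i)) (ball_moment I a p / ball_norm I a)"
    using nn_integral_ball_law_moment[of p] ball_moment_pos[OF I a, of p] ball_norm_pos
    by (intro has_bochner_integral_nn_integral) (auto intro!: prod_nonneg simp: zero_le_even_power)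
  then show ?thesis by (rule has_bochner_integral_integral_eq)
qed

lemma Gamma_half_Suc: "Gamma (3 / 2 :: real) = Gamma (1 / 2) / 2" "Gamma (5 / 2 :: real) = 3 / 4 * Gamma (1 / 2)"
proof -
  have 1: "Gamma (1 / 2 + 1 :: real) = 1 / 2 * Gamma (1 / 2)" by (rule Gamma_plus1) (auto elim!: nonpos_Ints_cases)
  have 2: "Gamma (3 / 2 + 1 :: real) = 3 / 2 * Gamma (3 / 2)" by (rule Gamma_plus1) (auto elim!: nonpos_Ints_cases)
  show "Gamma (3 / 2 :: real) = Gamma (1 / 2) / 2" using 1 by simp
  then show "Gamma (5 / 2 :: real) = 3 / 4 * Gamma (1 / 2)" using 2 by simp
qed

lemma Gamma_dof: "Gamma (1 + card I / 2 + a) = dof / 2 * Gamma (card I / 2 + a)"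
  "Gamma (2 + card I / 2 + a) = dof * (dof + 2) / 4 * Gamma (card I / 2 + a)"
proof -
  let ?d = "card I / 2 + a"
  have d: "?d > 0" "?d = dof / 2" using a by (auto simp: dof_def)
  have 1: "Gamma (?d + 1) = ?d * Gamma ?d" using d by (intro Gamma_plus1) auto
  have 2: "Gamma (?d + 1 + 1) = (?d + 1) * Gamma (?d + 1)" using d by (intro Gamma_plus1) auto
  have e1: "1 + card I / 2 + a = ?d + 1" and e2: "2 + card I / 2 + a = ?d + 1 + 1" by auto
  show "Gamma (1 + card I / 2 + a) = dof / 2 * Gamma ?d" unfolding e1 1 by (rule arg_cong2[of _ _ _ _ times, OF d(2) refl])
  show "Gamma (2 + card I / 2 + a) = dof * (dof + 2) / 4 * Gamma ?d" 
  proof -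
    have "(?d + 1) * ?d = dof * (dof + 2) / 4" unfolding d(2) by (simp add: field_simps)
    then show ?thesis unfolding e2 2 1 by (simp only: mult.assoc[symmetric])
  qed
qed

lemma Gamma_d_pos: "Gamma (card I / 2 + a) > 0" using a by (intro Gamma_real_pos) auto

lemma ball_norm_eq: "ball_norm I a = (\<Prod>i\<in>I. Gamma (1 / 2)) * Gamma a / Gamma (card I / 2 + a)"
  by (simp add: ball_norm_def ball_moment_def)

lemma moment_sq: assumes i: "i \<in> I"
  shows "integral\<^sup>L (ball_law I a) (\<lambda>v. (v i)\<^sup>2) = 1 / dof"
    and moment_4: "integral\<^sup>L (ball_law I a) (\<lambda>v. (v i) ^ 4) = 3 / (dof * (dof + 2))"
proof -
  define J where "J = I - {i}"
  have IJ: "I = insert i J" "i \<notin> J" "finite J" using i I by (auto simp: J_def)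
  define P where "P = (\<Prod>j\<in>J. Gamma (1 / 2 :: real))"
  define h where "h = Gamma (1 / 2 :: real)"
  define G where "G = Gamma (card I / 2 + a)"
  have pos: "P > 0" "h > 0" "G > 0" "Gamma a > 0" "dof > 0"
    using Gamma_d_pos dof_pos a by (auto simp: P_def h_def G_def intro!: prod_pos)
  have norm: "ball_norm I a = h * P * Gamma a / G"
    unfolding ball_norm_eq G_def[symmetric] using IJ by (simp add: P_def h_def)
  have "integral\<^sup>L (ball_law I a) (\<lambda>v. (v i) ^ (2 * m)) = Gamma (m + 1 / 2) * P * Gamma a / Gamma (m + card I / 2 + a) / ball_norm I a" for m
  proof -
    let ?p = "\<lambda>j. if j = i then m else (0::nat)"
    have J: "(\<Prod>k\<in>J. f (?p k) k) = (\<Prod>k\<in>J. f 0 k)" "(\<Sum>k\<in>J. ?p k) = 0" for f :: "nat \<Rightarrow> 'i \<Rightarrow> real"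
      using IJ by (auto intro!: prod.cong sum.neutral)
    have pr: "(\<Prod>j\<in>I. v j ^ (2 * ?p j)) = (v i) ^ (2 * m)" for v :: "'i \<Rightarrow> real"
      unfolding IJ(1) prod.insert[OF IJ(3,2)] J(1)[of "\<lambda>q k. v k ^ (2 * q)"] by simp
    have g: "(\<Prod>j\<in>I. Gamma (real (?p j) + 1 / 2)) = Gamma (m + 1 / 2) * P"
      unfolding IJ(1) prod.insert[OF IJ(3,2)] J(1)[of "\<lambda>q k. Gamma (real q + 1 / 2)"] P_def by simp
    have s: "(\<Sum>j\<in>I. ?p j) = m" unfolding IJ(1) sum.insert[OF IJ(3,2)] J(2) by simp
    show ?thesis using integral_moment[of ?p] unfolding pr ball_moment_def g s .
  qed
  note * = this
  have "integral\<^sup>L (ball_law I a) (\<lambda>v. (v i) ^ 2) = h / 2 * P * Gamma a / (dof / 2 * G) / ball_norm I a"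
    using *[of 1] Gamma_dof(1) by (simp add: Gamma_half_Suc h_def G_def add.assoc)
  then show "integral\<^sup>L (ball_law I a) (\<lambda>v. (v i)\<^sup>2) = 1 / dof"
    unfolding norm using pos by (simp add: field_simps)
  have "integral\<^sup>L (ball_law I a) (\<lambda>v. (v i) ^ 4) = 3 / 4 * h * P * Gamma a / (dof * (dof + 2) / 4 * G) / ball_norm I a"
  proof -
    have e: "real 2 + 1 / 2 = (5 / 2::real)" "real 2 + card I / 2 + a = 2 + card I / 2 + a" "2 * 2 = (4::nat)" by auto
    show ?thesis using *[of 2] unfolding e Gamma_half_Suc Gamma_dof G_def[symmetric] h_def[symmetric] .
  qed
  then show "integral\<^sup>L (ball_law I a) (\<lambda>v. (v i) ^ 4) = 3 / (dof * (dof + 2))"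
    unfolding norm using pos by (simp add: divide_simps) 
qed

lemma moment_22: assumes i: "i \<in> I" and j: "j \<in> I" and ne: "i \<noteq> j"
  shows "integral\<^sup>L (ball_law I a) (\<lambda>v. (v i)\<^sup>2 * (v j)\<^sup>2) = 1 / (dof * (dof + 2))"
proof -
  let ?p = "\<lambda>k. if k = i \<or> k = j then 1 else (0::nat)"
  define J where "J = I - {i, j}"
  have IJ: "I = insert i (insert j J)" "i \<notin> insert j J" "finite (insert j J)" "j \<notin> J" "finite J"
    using i j I ne by (auto simp: J_def)
  define P where "P = (\<Prod>j\<in>J. Gamma (1 / 2 :: real))"
  define h where "h = Gamma (1 / 2 :: real)"
  define G where "G = Gamma (card I / 2 + a)"
  have pos: "P > 0" "h > 0" "G > 0" "Gamma a > 0" "dof > 0"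
    using Gamma_d_pos dof_pos a by (auto simp: P_def h_def G_def intro!: prod_pos)
  have norm: "ball_norm I a = h * (h * P) * Gamma a / G"
    unfolding ball_norm_eq G_def[symmetric] unfolding IJ(1) prod.insert[OF IJ(3,2)] prod.insert[OF IJ(5,4)]
    by (simp add: P_def h_def)
  have J: "(\<Prod>k\<in>J. f (?p k) k) = (\<Prod>k\<in>J. f 0 k)" "(\<Sum>k\<in>J. ?p k) = 0" for f :: "nat \<Rightarrow> 'i \<Rightarrow> real"
    using IJ(5) by (auto intro!: prod.cong sum.neutral simp: J_def)
  have pr: "(\<Prod>k\<in>I. v k ^ (2 * ?p k)) = (v i)\<^sup>2 * (v j)\<^sup>2" for v :: "'i \<Rightarrow> real"
    unfolding IJ(1) prod.insert[OF IJ(3,2)] prod.insert[OF IJ(5,4)] J(1)[of "\<lambda>q k. v k ^ (2 * q)"] by simp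
  have g: "(\<Prod>k\<in>I. Gamma (real (?p k) + 1 / 2)) = h / 2 * (h / 2 * P)"
    unfolding IJ(1) prod.insert[OF IJ(3,2)] prod.insert[OF IJ(5,4)] J(1)[of "\<lambda>q k. Gamma (real q + 1 / 2)"] P_def
    by (simp add: Gamma_half_Suc h_def)
  have s: "(\<Sum>k\<in>I. ?p k) = 2" unfolding IJ(1) sum.insert[OF IJ(3,2)] sum.insert[OF IJ(5,4)] J(2) by simp
  have "integral\<^sup>L (ball_law I a) (\<lambda>v. (v i)\<^sup>2 * (v j)\<^sup>2) = h / 2 * (h / 2 * P) * Gamma a / (dof * (dof + 2) / 4 * G) / ball_norm I a"
  proof -
    have e: "real 2 + card I / 2 + a = 2 + card I / 2 + a" by auto
    show ?thesis using integral_moment[of ?p] unfolding pr ball_moment_def g s e Gamma_dof G_def[symmetric] .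
  qed
  then show ?thesis
    unfolding norm using pos by (simp add: divide_simps)
qed

lemma moment_2:
  assumes i: "i \<in> I" and j: "j \<in> I"
  shows "integral\<^sup>L (ball_law I a) (\<lambda>v. v i * v j) = (if i = j then 1 / dof else 0)"
  using moment_sq[OF i] integral_odd_eq_0[OF i, of "\<lambda>v. v i * v j"] i j
  by (auto simp: power2_eq_square)

text \<open>Either the remaining two indices agree, and an even moment applies, or one coordinate
  occurs an odd number of times and reflecting it shows that the integral is 0.\<close>

lemma moment_211:
  assumes i: "i \<in> I" and k: "k \<in> I" and l: "l \<in> I"
  shows "integral\<^sup>L (ball_law I a) (\<lambda>v. v i * v i * v k * v l) =
    ((if k = l then 1 else 0) + 2 * (if i = k \<and> i = l then 1 else 0)) / (dof * (dof + 2))"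
proof -
  consider "k = l" "i = k" | "k = l" "i \<noteq> k" | "k \<noteq> l" "k \<noteq> i" | "k \<noteq> l" "k = i" by blast
  then show ?thesis
  proof cases
    case 1
    then show ?thesis using moment_4[OF i] by (simp add: power4_eq_xxxx)
  next
    case 2
    then show ?thesis using moment_22[OF i k] by (simp add: power2_eq_square mult.assoc)
  next
    case 3
    have "integral\<^sup>L (ball_law I a) (\<lambda>v. v i * v i * v k * v l) = 0"
      by (rule integral_odd_eq_0[OF k]) (use 3 i k l in auto)
    then show ?thesis using 3 by simp
  next
    case 4
    have "integral\<^sup>L (ball_law I a) (\<lambda>v. v i * v i * v k * v l) = 0"
      by (rule integral_odd_eq_0[OF l]) (use 4 i k l in auto)
    then show ?thesis using 4 by simp
  qed
qed

text \<open>The three pairings of the Isserlis formula for Gaussian vectors, with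
  \<open>1 / (dof * (dof + 2))\<close> in place of the squared variance. If the first index meets
  none of the others, reflection gives 0; otherwise \<open>moment_211\<close> applies.\<close>

lemma moment_1111:
  assumes i: "i \<in> I" and j: "j \<in> I" and k: "k \<in> I" and l: "l \<in> I"
  shows "integral\<^sup>L (ball_law I a) (\<lambda>v. v i * v j * v k * v l) =
    ((if i = j \<and> k = l then 1 else 0) + (if i = k \<and> j = l then 1 else 0) + (if i = l \<and> j = k then 1 else 0)) / (dof * (dof + 2))"
proof -
  consider "i = j" | "i = k" | "i = l" | "i \<noteq> j" "i \<noteq> k" "i \<noteq> l" by blast
  then show ?thesis
  proof cases
    case 1
    then show ?thesis using moment_211[OF i k l] by auto
  next
    case 2
    then show ?thesis using moment_211[OF i j l] by (auto simp: mult_ac)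
  next
    case 3
    then show ?thesis using moment_211[OF i j k] by (auto simp: mult_ac)
  next
    case 4
    have "integral\<^sup>L (ball_law I a) (\<lambda>v. v i * v j * v k * v l) = 0"
      by (rule integral_odd_eq_0[OF i]) (use 4 i j k l in auto)
    then show ?thesis using 4 by simp
  qed
qed

end

lemma sum_diag_if:
  fixes A :: "nat \<Rightarrow> nat \<Rightarrow> real"
  shows "(\<Sum>k<m. \<Sum>l<m. if k = l then A k l else 0) = (\<Sum>k<m. A k k)"
  by (intro sum.cong refl) simp

lemma integral_sum_lessThan:
  fixes f :: "nat \<Rightarrow> 'a \<Rightarrow> real"
  assumes "\<And>k. k < m \<Longrightarrow> integrable M (f k)"
  shows "integral\<^sup>L M (\<lambda>v. \<Sum>k<m. f k v) = (\<Sum>k<m. integral\<^sup>L M (f k))"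
  using assms by (intro Bochner_Integration.integral_sum) auto

context
  fixes I :: "'i set" and a :: real and e :: "nat \<Rightarrow> 'i" and m :: nat and A :: "nat \<Rightarrow> nat \<Rightarrow> real"
  assumes I: "finite I" and a: "a > 0" and e: "inj_on e {..<m}" "e ` {..<m} \<subseteq> I"
    and sym: "\<And>k l. k < m \<Longrightarrow> l < m \<Longrightarrow> A k l = A l k"
begin

interpretation prob_space "ball_law I a" by (rule prob_space_ball_law[OF I a])

text \<open>The coordinates of the ball will be indexed by pairs \<open>(k, n)\<close>;
  \<open>e\<close> translates the matrix indices into them.\<close>

definition qform where "qform v = (\<Sum>k<m. \<Sum>l<m. v (e k) * A k l * v (e l))"

lemma e_eq: "k < m \<Longrightarrow> l < m \<Longrightarrow> e k = e l \<longleftrightarrow> k = l"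
  using e(1) by (auto simp: inj_on_def)

lemma e_in: "k < m \<Longrightarrow> e k \<in> I" using e(2) by auto

lemma integrable_monomials:
  assumes "i \<in> I" "j \<in> I" "k \<in> I" "l \<in> I"
  shows "integrable (ball_law I a) (\<lambda>v. v i * v j)" "integrable (ball_law I a) (\<lambda>v. v i * v j * v k * v l)"
proof -
  have m: "\<bar>x * y\<bar> \<le> 1" if "\<bar>x\<bar> \<le> 1" "\<bar>y\<bar> \<le> 1" for x y :: real
    using that by (simp add: abs_mult mult_le_one)
  show "integrable (ball_law I a) (\<lambda>v. v i * v j)"
    by (rule integrable_ball_law[OF I a, where B = 1]) (use assms abs_le_1_of_sqn[OF I a] in \<open>auto intro!: m\<close>)
  show "integrable (ball_law I a) (\<lambda>v. v i * v j * v k * v l)"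
    by (rule integrable_ball_law[OF I a, where B = 1]) (use assms abs_le_1_of_sqn[OF I a] in \<open>auto intro!: m\<close>)
qed

lemma qform_mean:
  "integrable (ball_law I a) qform" "integral\<^sup>L (ball_law I a) qform = (\<Sum>k<m. A k k) / dof I a"
proof -
  have eq: "qform = (\<lambda>v. \<Sum>k<m. \<Sum>l<m. A k l * (v (e k) * v (e l)))"
    unfolding qform_def by (simp add: mult_ac)
  have int: "integrable (ball_law I a) (\<lambda>v. v (e k) * v (e l))" if "k < m" "l < m" for k l
    using integrable_monomials(1)[OF e_in e_in e_in e_in, OF that that] .
  show "integrable (ball_law I a) qform"
    unfolding eq by (intro Bochner_Integration.integrable_sum integrable_mult_right int) auto
  have "integral\<^sup>L (ball_law I a) qform = (\<Sum>k<m. \<Sum>l<m. A k l * integral\<^sup>L (ball_law I a) (\<lambda>v. v (e k) * v (e l)))"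
    unfolding eq
    by (subst integral_sum_lessThan, (intro Bochner_Integration.integrable_sum integrable_mult_right int; simp),
        intro sum.cong refl, subst integral_sum_lessThan, (intro integrable_mult_right int; simp), simp)
  also have "\<dots> = (\<Sum>k<m. \<Sum>l<m. if k = l then A k l / dof I a else 0)"
    by (intro sum.cong refl) (auto simp: moment_2[OF I a] e_in e_eq)
  also have "\<dots> = (\<Sum>k<m. A k k) / dof I a" unfolding sum_diag_if sum_divide_distrib ..
  finally show "integral\<^sup>L (ball_law I a) qform = (\<Sum>k<m. A k k) / dof I a" .
qed

lemma qform_sq:
  "integrable (ball_law I a) (\<lambda>v. (qform v)\<^sup>2)"
  "integral\<^sup>L (ball_law I a) (\<lambda>v. (qform v)\<^sup>2) =
    ((\<Sum>k<m. A k k)\<^sup>2 + 2 * (\<Sum>k<m. \<Sum>l<m. (A k l)\<^sup>2)) / (dof I a * (dof I a + 2))"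
proof -
  let ?D = "dof I a * (dof I a + 2)"
  let ?X = "\<lambda>k l p q v. A k l * A p q * (v (e k) * v (e l) * v (e p) * v (e q))"
  have eq: "(\<lambda>v. (qform v)\<^sup>2) = (\<lambda>v. \<Sum>k<m. \<Sum>l<m. \<Sum>p<m. \<Sum>q<m. ?X k l p q v)"
  proof
    fix v
    have "(qform v)\<^sup>2 = (\<Sum>k<m. \<Sum>l<m. v (e k) * A k l * v (e l) * qform v)"
      unfolding power2_eq_square qform_def[of v] sum_distrib_right ..
    also have "\<dots> = (\<Sum>k<m. \<Sum>l<m. \<Sum>p<m. \<Sum>q<m. ?X k l p q v)"
      unfolding qform_def by (simp add: sum_distrib_left mult_ac)
    finally show "(qform v)\<^sup>2 = (\<Sum>k<m. \<Sum>l<m. \<Sum>p<m. \<Sum>q<m. ?X k l p q v)" .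
  qed
  have int: "integrable (ball_law I a) (\<lambda>v. v (e k) * v (e l) * v (e p) * v (e q))" if "k < m" "l < m" "p < m" "q < m" for k l p q
    using integrable_monomials(2)[OF e_in e_in e_in e_in, OF that] .
  show "integrable (ball_law I a) (\<lambda>v. (qform v)\<^sup>2)"
    unfolding eq by (intro Bochner_Integration.integrable_sum integrable_mult_right int) auto
  have "integral\<^sup>L (ball_law I a) (\<lambda>v. (qform v)\<^sup>2) = (\<Sum>k<m. \<Sum>l<m. \<Sum>p<m. \<Sum>q<m. A k l * A p q * integral\<^sup>L (ball_law I a) (\<lambda>v. v (e k) * v (e l) * v (e p) * v (e q)))"
    unfolding eq
    by (subst integral_sum_lessThan, (intro Bochner_Integration.integrable_sum integrable_mult_right int; simp), intro sum.cong refl,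
        subst integral_sum_lessThan, (intro Bochner_Integration.integrable_sum integrable_mult_right int; simp), intro sum.cong refl,
        subst integral_sum_lessThan, (intro Bochner_Integration.integrable_sum integrable_mult_right int; simp), intro sum.cong refl,
        subst integral_sum_lessThan, (intro integrable_mult_right int; simp), simp)
  \<comment> \<open>One summand per pairing. The conditionals are nested so that in the last two
    summands the inner sums collapse one after the other; the first one is treated separately with
    \<open>sum_diag_if\<close>.\<close>
  also have "\<dots> = (\<Sum>k<m. \<Sum>l<m. \<Sum>p<m. \<Sum>q<m.
       (if k = l then (if p = q then A k l * A p q / ?D else 0) else 0) + (if q = l then (if p = k then A k l * A p q / ?D else 0) else 0)
     + (if q = k then (if p = l then A k l * A p q / ?D else 0) else 0))"
    by (intro sum.cong refl) (auto simp: moment_1111[OF I a] e_in e_eq)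
  also have "\<dots> = (\<Sum>k<m. \<Sum>l<m. \<Sum>p<m. \<Sum>q<m. if k = l then (if p = q then A k l * A p q / ?D else 0) else 0)
     + (\<Sum>k<m. \<Sum>l<m. A k l * A k l / ?D) + (\<Sum>k<m. \<Sum>l<m. A k l * A l k / ?D)"
    by (simp add: sum.distrib)
  also have "(\<Sum>k<m. \<Sum>l<m. \<Sum>p<m. \<Sum>q<m. if k = l then (if p = q then A k l * A p q / ?D else 0) else 0)
     = (\<Sum>k<m. \<Sum>l<m. if k = l then (\<Sum>p<m. A k l * A p p / ?D) else 0)"
    by (intro sum.cong refl) (simp add: sum_diag_if)
  also have "\<dots> = (\<Sum>k<m. A k k)\<^sup>2 / ?D"
    unfolding sum_diag_if by (simp add: power2_eq_square sum_product sum_divide_distrib)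
  also have "(\<Sum>k<m. \<Sum>l<m. A k l * A l k / ?D) = (\<Sum>k<m. \<Sum>l<m. A k l * A k l / ?D)"
    by (intro sum.cong refl) (use sym in auto)
  also have "(\<Sum>k<m. A k k)\<^sup>2 / ?D + (\<Sum>k<m. \<Sum>l<m. A k l * A k l / ?D) + (\<Sum>k<m. \<Sum>l<m. A k l * A k l / ?D)
     = ((\<Sum>k<m. A k k)\<^sup>2 + 2 * (\<Sum>k<m. \<Sum>l<m. (A k l)\<^sup>2)) / ?D"
    by (simp add: power2_eq_square add_divide_distrib sum_divide_distrib[symmetric])
  finally show "integral\<^sup>L (ball_law I a) (\<lambda>v. (qform v)\<^sup>2) =
    ((\<Sum>k<m. A k k)\<^sup>2 + 2 * (\<Sum>k<m. \<Sum>l<m. (A k l)\<^sup>2)) / ?D" .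
qed

text \<open>By \<open>qform_sq\<close> the second moment is ((tr A)^2 + 2 |A|^2) / (d (d + 2)) with
  |A| the Frobenius norm. Lowering the denominator to d^2 makes the trace term cancel exactly with
  the square of the mean.\<close>

lemma qform_variance:
  "integrable (ball_law I a) (\<lambda>v. (qform v - (\<Sum>k<m. A k k) / dof I a)\<^sup>2)"
  "integral\<^sup>L (ball_law I a) (\<lambda>v. (qform v - (\<Sum>k<m. A k k) / dof I a)\<^sup>2) \<le> 2 * (\<Sum>k<m. \<Sum>l<m. (A k l)\<^sup>2) / (dof I a)\<^sup>2"
proof -
  let ?t = "\<Sum>k<m. A k k" and ?F = "\<Sum>k<m. \<Sum>l<m. (A k l)\<^sup>2" and ?d = "dof I a"
  have d: "?d > 0" by (rule dof_pos[OF I a])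
  have F: "?F \<ge> 0" by (intro sum_nonneg) auto
  have eq: "(\<lambda>v. (qform v - ?t / ?d)\<^sup>2) = (\<lambda>v. (qform v)\<^sup>2 - 2 * (?t / ?d) * qform v + (?t / ?d)\<^sup>2)"
    by (simp add: power2_eq_square algebra_simps)
  show "integrable (ball_law I a) (\<lambda>v. (qform v - ?t / ?d)\<^sup>2)"
    unfolding eq using qform_mean(1) qform_sq(1) by simp
  have "integral\<^sup>L (ball_law I a) (\<lambda>v. (qform v - ?t / ?d)\<^sup>2) = (?t\<^sup>2 + 2 * ?F) / (?d * (?d + 2)) - 2 * (?t / ?d) * (?t / ?d) + (?t / ?d)\<^sup>2"
    unfolding eq using qform_mean qform_sq by (simp add: prob_space)
  also have "\<dots> \<le> (?t\<^sup>2 + 2 * ?F) / ?d\<^sup>2 - (?t / ?d)\<^sup>2"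
  proof -
    have "(?t\<^sup>2 + 2 * ?F) / (?d * (?d + 2)) \<le> (?t\<^sup>2 + 2 * ?F) / ?d\<^sup>2"
      using d F by (intro divide_left_mono mult_pos_pos) (auto simp: power2_eq_square)
    then show ?thesis by (simp add: power2_eq_square)
  qed
  also have "\<dots> = 2 * ?F / ?d\<^sup>2" by (simp add: power_divide add_divide_distrib)
  finally show "integral\<^sup>L (ball_law I a) (\<lambda>v. (qform v - ?t / ?d)\<^sup>2) \<le> 2 * ?F / ?d\<^sup>2" .
qed

end

subsection \<open>Cholesky coordinates\<close>

definition colidx :: "nat \<Rightarrow> (nat \<times> nat) set" where "colidx j = (\<lambda>i. (i, j)) ` {..<j}"

definition corr_fun :: "(nat \<times> nat \<Rightarrow> real) \<Rightarrow> nat \<Rightarrow> nat \<Rightarrow> real" where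
  "corr_fun x i j = (if i = j then 1 else if i < j then x (i, j) else x (j, i))"

text \<open>Row \<open>i\<close> of the Cholesky factor is kept in the coordinates \<open>(k, i)\<close>, \<open>k < i\<close>, as it depends
  only on the first \<open>i + 1\<close> columns of the correlation matrix; its diagonal entry makes it a unit vector.\<close>

definition chol :: "(nat \<times> nat \<Rightarrow> real) \<Rightarrow> nat \<Rightarrow> nat \<Rightarrow> real" where
  "chol w i k = (if k < i then w (k, i) else if k = i then sqrt (1 - sqn (colidx i) w) else 0)"

text \<open>For \<open>i < j\<close> row i ends at its diagonal entry, so the sum can stop at i. It
  then involves only entries of row j to the left of the diagonal, hence column j of the product is
  linear in the free coordinates of row j.\<close>

definition chol_prod :: "(nat \<times> nat \<Rightarrow> real) \<Rightarrow> nat \<times> nat \<Rightarrow> real" where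
  "chol_prod w = (\<lambda>(i, j). \<Sum>k\<le>i. chol w i k * chol w j k)"

lemma corr_fun_sym: "corr_fun x i j = corr_fun x j i"
  by (auto simp: corr_fun_def)

lemma mat_of_offdiag_corr_fun: "mat_of_offdiag n x = Matrix.mat n n (\<lambda>(i, j). corr_fun x i j)"
  by (auto simp: mat_of_offdiag_def corr_fun_def intro!: cong_mat)

lemma mat_of_offdiag_carrier [simp]: "mat_of_offdiag n x \<in> carrier_mat n n"
  by (simp add: mat_of_offdiag_def)

lemma upper_idx_Suc: "upper_idx (Suc n) = upper_idx n \<union> colidx n" "upper_idx n \<inter> colidx n = {}"
  by (auto simp: upper_idx_def colidx_def)

lemma col_subset: "j < n \<Longrightarrow> colidx j \<subseteq> upper_idx n"
  by (auto simp: upper_idx_def colidx_def)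

lemma finite_colidx [simp]: "finite (colidx n)" by (simp add: colidx_def)

lemma card_colidx [simp]: "card (colidx n) = n"
  unfolding colidx_def by (subst card_image) (auto simp: inj_on_def)

lemma finite_upper_idx [simp]: "finite (upper_idx n)"
  by (rule finite_subset[of _ "{..<n} \<times> {..<n}"]) (auto simp: upper_idx_def)

lemma sqn_col: "sqn (colidx j) w = (\<Sum>i<j. (w (i, j))\<^sup>2)"
  unfolding sqn_def colidx_def by (subst sum.reindex) (auto simp: inj_on_def)

lemma corr_fun_cong: "(\<And>p. p \<in> upper_idx n \<Longrightarrow> x p = y p) \<Longrightarrow> i < n \<Longrightarrow> j < n \<Longrightarrow> corr_fun x i j = corr_fun y i j"
  by (auto simp: corr_fun_def upper_idx_def)

lemma chol_cong: "(\<And>p. p \<in> upper_idx n \<Longrightarrow> w p = w' p) \<Longrightarrow> i < n \<Longrightarrow> chol w i k = chol w' i k"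
  by (auto simp: chol_def upper_idx_def sqn_col)

lemma chol_prod_cong:
  assumes "\<And>p. p \<in> upper_idx n \<Longrightarrow> w p = w' p" and p: "p \<in> upper_idx n"
  shows "chol_prod w p = chol_prod w' p"
proof -
  obtain i j where ij: "p = (i, j)" "i < n" "j < n" using p by (auto simp: upper_idx_def)
  show ?thesis unfolding ij chol_prod_def using chol_cong[OF assms(1)] ij by simp
qed

lemma chol_eq_0: "k > i \<Longrightarrow> chol w i k = 0" by (simp add: chol_def)

lemma sum_chol_trunc:
  assumes "i < n" shows "(\<Sum>k<n. chol w i k * f k) = (\<Sum>k\<le>i. chol w i k * f k)"
  using assms by (intro sum.mono_neutral_right) (auto simp: chol_eq_0)

lemma chol_row_norm:
  assumes "sqn (colidx i) w \<le> 1" "i < n"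
  shows "(\<Sum>k<n. (chol w i k)\<^sup>2) = 1"
proof -
  have "(\<Sum>k<n. (chol w i k)\<^sup>2) = (\<Sum>k\<le>i. (chol w i k)\<^sup>2)"
    using sum_chol_trunc[OF assms(2), of w "chol w i"] by (simp add: power2_eq_square)
  also have "\<dots> = (\<Sum>k<i. (w (k, i))\<^sup>2) + (sqrt (1 - sqn (colidx i) w))\<^sup>2"
    unfolding lessThan_Suc_atMost[symmetric] by (simp add: chol_def)
  also have "\<dots> = 1" using assms(1) by (simp add: sqn_col)
  finally show ?thesis .
qed

lemma corr_fun_chol:
  assumes g: "\<And>j. j < n \<Longrightarrow> sqn (colidx j) w \<le> 1" and i: "i < n" and j: "j < n"
  shows "corr_fun (chol_prod w) i j = (\<Sum>k<n. chol w i k * chol w j k)"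
proof -
  have less: "chol_prod w (i, j) = (\<Sum>k<n. chol w i k * chol w j k)" if "i < n" for i j
    using sum_chol_trunc[OF that] by (simp add: chol_prod_def)
  show ?thesis
    using chol_row_norm[OF g i, OF i] less[OF i, of j] less[OF j, of i]
    by (auto simp: corr_fun_def power2_eq_square mult.commute)
qed

lemma det_chol:
  assumes g: "\<And>j. j < n \<Longrightarrow> sqn (colidx j) w \<le> 1"
  shows "Determinant.det (mat_of_offdiag n (chol_prod w)) = (\<Prod>j<n. 1 - sqn (colidx j) w)"
proof -
  let ?L = "Matrix.mat n n (\<lambda>(i, k). chol w i k)"
  have L: "?L \<in> carrier_mat n n" by simp
  have "mat_of_offdiag n (chol_prod w) = ?L * transpose_mat ?L"
    unfolding mat_of_offdiag_corr_fun
    by (intro eq_matI) (auto simp: scalar_prod_def atLeast0LessThan corr_fun_chol[OF g])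
  then have "Determinant.det (mat_of_offdiag n (chol_prod w)) = Determinant.det ?L * Determinant.det ?L"
    using det_mult[OF L, of "transpose_mat ?L"] det_transpose[OF L] by simp
  also have "Determinant.det ?L = prod_list (diag_mat ?L)"
    by (rule det_lower_triangular[OF _ L]) (auto simp: chol_def)
  also have "diag_mat ?L = map (\<lambda>i. sqrt (1 - sqn (colidx i) w)) [0..<n]"
    by (auto simp: diag_mat_def chol_def)
  also have "prod_list \<dots> = (\<Prod>i<n. sqrt (1 - sqn (colidx i) w))"
    by (simp add: prod.distinct_set_conv_list[symmetric] atLeast0LessThan)
  also have "\<dots> * \<dots> = (\<Prod>i<n. sqrt (1 - sqn (colidx i) w) * sqrt (1 - sqn (colidx i) w))"
    by (rule prod.distrib[symmetric])
  also have "\<dots> = (\<Prod>j<n. 1 - sqn (colidx j) w)"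
    using g by (intro prod.cong) auto
  finally show ?thesis .
qed

section \<open>Positive definiteness in Cholesky coordinates\<close>

definition posdef :: "nat \<Rightarrow> (nat \<Rightarrow> nat \<Rightarrow> real) \<Rightarrow> bool" where
  "posdef n c \<longleftrightarrow> (\<forall>u. (\<exists>i<n. u i \<noteq> 0) \<longrightarrow> 0 < (\<Sum>i<n. \<Sum>j<n. u i * c i j * u j))"

lemma posdef_Suc_D: assumes "posdef (Suc n) c" shows "posdef n c"
  unfolding posdef_def
proof (intro allI impI)
  fix u :: "nat \<Rightarrow> real" assume "\<exists>i<n. u i \<noteq> 0"
  then have "\<exists>i<Suc n. (u(n := 0)) i \<noteq> 0" by (metis fun_upd_other less_SucI less_irrefl_nat)
  then have "0 < (\<Sum>i<Suc n. \<Sum>j<Suc n. (u(n := 0)) i * c i j * (u(n := 0)) j)"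
    using assms unfolding posdef_def by blast
  also have "\<dots> = (\<Sum>i<n. \<Sum>j<n. u i * c i j * u j)"
    by simp
  finally show "0 < (\<Sum>i<n. \<Sum>j<n. u i * c i j * u j)" .
qed

lemma posdef_cong:
  assumes "\<And>i j. i < n \<Longrightarrow> j < n \<Longrightarrow> c i j = c' i j"
  shows "posdef n c \<longleftrightarrow> posdef n c'"
proof -
  have "(\<Sum>i<n. \<Sum>j<n. u i * c i j * u j) = (\<Sum>i<n. \<Sum>j<n. u i * c' i j * u j)" for u
    by (intro sum.cong refl) (simp add: assms)
  then show ?thesis unfolding posdef_def by simp
qed

lemma psd_fun_cong:
  assumes "\<And>i j. i < n \<Longrightarrow> j < n \<Longrightarrow> c i j = c' i j"
  shows "psd_fun n c \<longleftrightarrow> psd_fun n c'"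
proof -
  have "(\<Sum>i<n. \<Sum>j<n. u i * c i j * u j) = (\<Sum>i<n. \<Sum>j<n. u i * c' i j * u j)" for u
    by (intro sum.cong refl) (simp add: assms)
  then show ?thesis unfolding psd_fun_def by simp
qed

text \<open>A kernel vector contradicts strict positivity. Conversely, a vector at which a
  semidefinite form vanishes is a minimizer of the form, so its gradient is 0 there and the vector
  lies in the kernel.\<close>

lemma posdef_iff:
  assumes sym: "\<And>i j. c i j = c j i"
  shows "posdef n c \<longleftrightarrow> psd_fun n c \<and> Determinant.det (Matrix.mat n n (\<lambda>(i, j). c i j)) \<noteq> 0"
proof -
  let ?C = "Matrix.mat n n (\<lambda>(i, j). c i j)"
  have C: "?C \<in> carrier_mat n n" by simp
  have mv: "vec_index (?C *\<^sub>v v) i = (\<Sum>j<n. c i j * vec_index v j)" if "i < n" "v \<in> carrier_vec n" for v i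
    using that by (auto simp: scalar_prod_def atLeast0LessThan intro!: sum.cong)
  show ?thesis
  proof (intro iffI conjI)
    assume pd: "posdef n c"
    show "psd_fun n c" unfolding psd_fun_def
    proof
      fix u
      show "0 \<le> (\<Sum>i<n. \<Sum>j<n. u i * c i j * u j)"
        using pd unfolding posdef_def by (cases "\<exists>i<n. u i \<noteq> 0") (force intro: less_imp_le, simp)
    qed
    show "Determinant.det ?C \<noteq> 0"
    proof
      assume "Determinant.det ?C = 0"
      then obtain v where v: "v \<in> carrier_vec n" "v \<noteq> 0\<^sub>v n" "?C *\<^sub>v v = 0\<^sub>v n"
        using det_0_iff_vec_prod_zero[OF C] by blast
      from v(1,2) obtain k where k: "k < n" "vec_index v k \<noteq> 0"
        by (metis carrier_vecD eq_vecI index_zero_vec)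
      then have "0 < (\<Sum>i<n. \<Sum>j<n. vec_index v i * c i j * vec_index v j)"
        using pd[unfolded posdef_def, rule_format, of "vec_index v"] by blast
      also have "\<dots> = (\<Sum>i<n. vec_index v i * vec_index (?C *\<^sub>v v) i)"
        using v(1) by (intro sum.cong refl) (simp add: mv sum_distrib_left mult_ac del: index_mult_mat_vec)
      also have "\<dots> = 0" unfolding v(3) by simp
      finally show False by simp
    qed
  next
    assume *: "psd_fun n c \<and> Determinant.det ?C \<noteq> 0"
    show "posdef n c" unfolding posdef_def
    proof (intro allI impI, rule ccontr)
      fix u assume u: "\<exists>i<n. u i \<noteq> 0" and "\<not> 0 < (\<Sum>i<n. \<Sum>j<n. u i * c i j * u j)"
      then have z: "(\<Sum>i<n. \<Sum>j<n. u i * c i j * u j) = 0"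
        using *[THEN conjunct1, unfolded psd_fun_def, rule_format, of u] by simp
      have "(\<Sum>j<n. c i j * u j) = 0" if i: "i < n" for i
      proof (rule ccontr)
        define b where "b = (\<Sum>j<n. c i j * u j)"
        assume "(\<Sum>j<n. c i j * u j) \<noteq> 0"
        then have b: "b \<noteq> 0" by (simp add: b_def)
        \<comment> \<open>Moving from u by s in direction i changes the form by
          \<open>s * (2 * b + s * c i i)\<close>. This s makes the change negative; the added 1
          keeps the denominator positive.\<close>
        define s where "s = - b / (\<bar>c i i\<bar> + 1)"
        define y where "y k = u k + (if k = i then s else 0)" for k
        have e: "(\<Sum>k<n. (if k = i then s else 0) * f k) = s * f i" for f :: "nat \<Rightarrow> real"
          using i by (simp add: if_distrib if_distribR sum.delta cong: if_cong)
        have "0 \<le> (\<Sum>k<n. \<Sum>l<n. y k * c k l * y l)" using * unfolding psd_fun_def by blast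
        also have "\<dots> = (\<Sum>k<n. y k * (\<Sum>l<n. y l * c k l))" by (simp add: sum_distrib_left mult_ac)
        also have "\<dots> = (\<Sum>k<n. y k * ((\<Sum>l<n. u l * c k l) + s * c k i))"
          unfolding y_def distrib_right sum.distrib e ..
        also have "\<dots> = (\<Sum>k<n. u k * (\<Sum>l<n. u l * c k l)) + s * (\<Sum>k<n. u k * c k i) + s * ((\<Sum>l<n. u l * c i l) + s * c i i)"
          unfolding y_def distrib_right sum.distrib e by (simp add: distrib_left sum.distrib sum_distrib_left mult_ac)
        also have "(\<Sum>k<n. u k * (\<Sum>l<n. u l * c k l)) = 0"
          using z by (simp add: sum_distrib_left mult_ac)
        also have "(\<Sum>k<n. u k * c k i) = b" unfolding b_def by (intro sum.cong refl) (simp add: sym[of _ i])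
        also have "(\<Sum>l<n. u l * c i l) = b" unfolding b_def by (simp add: mult.commute)
        also have "0 + s * b + s * (b + s * c i i) = s * (2 * b + s * c i i)" by (simp add: algebra_simps)
        also have "\<dots> < 0"
        proof -
          let ?q = "\<bar>c i i\<bar> + 1"
          have q: "?q > 0" by simp
          have "s * (2 * b + s * c i i) = - (b\<^sup>2 / ?q\<^sup>2) * (2 * ?q - c i i)"
            using q unfolding s_def by (simp add: field_simps power2_eq_square)
          moreover have "2 * ?q - c i i > 0" by (auto simp: abs_if)
          ultimately show ?thesis using b q by (simp add: mult_pos_pos)
        qed
        finally show False by simp
      qed
      then have "?C *\<^sub>v vec n u = 0\<^sub>v n"
        by (intro eq_vecI) (auto simp: scalar_prod_def atLeast0LessThan)
      moreover have "vec n u \<noteq> 0\<^sub>v n" using u by (metis index_vec index_zero_vec(1))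
      ultimately have "Determinant.det ?C = 0"
        using det_0_iff_vec_prod_zero[OF C] by (metis vec_carrier)
      then show False using * by simp
    qed
  qed
qed

lemma corr_mats_iff: "mat_of_offdiag n x \<in> corr_mats n \<longleftrightarrow> psd_fun n (corr_fun x)"
proof -
  have "psd_mat (mat_of_offdiag n x) \<longleftrightarrow> psd_fun n (corr_fun x)"
    unfolding psd_mat_iff[OF mat_of_offdiag_carrier]
    by (rule psd_fun_cong) (simp add: mat_of_offdiag_corr_fun)
  moreover have "transpose_mat (mat_of_offdiag n x) = mat_of_offdiag n x"
    unfolding mat_of_offdiag_corr_fun by (intro eq_matI) (auto simp: corr_fun_sym)
  ultimately show ?thesis
    by (auto simp: corr_mats_def mat_of_offdiag_corr_fun corr_fun_def)
qed

lemma posdef_corr_fun_iff: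
  "posdef n (corr_fun x) \<longleftrightarrow> psd_fun n (corr_fun x) \<and> Determinant.det (mat_of_offdiag n x) \<noteq> 0"
  unfolding mat_of_offdiag_corr_fun by (rule posdef_iff) (rule corr_fun_sym)

lemma posdef_chol:
  assumes g: "\<And>j. j < n \<Longrightarrow> sqn (colidx j) w < 1"
  shows "posdef n (corr_fun (chol_prod w))"
proof -
  have le: "sqn (colidx j) w \<le> 1" if "j < n" for j using g[OF that] by simp
  have cf: "corr_fun (chol_prod w) i j = (\<Sum>k<n. chol w i k * chol w j k)" if "i < n" "j < n" for i j
    using le that by (rule corr_fun_chol)
  have "psd_fun n (corr_fun (chol_prod w))"
    by (rule psd_gram[where x = 1 and L = "chol w"]) (simp, rule corr_fun_sym, rule cf)
  moreover have "1 - sqn (colidx j) w \<noteq> 0" if "j < n" for j using g[OF that] by simp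
  then have "(\<Prod>j<n. 1 - sqn (colidx j) w) \<noteq> 0" by auto
  ultimately show ?thesis unfolding posdef_corr_fun_iff
    using det_chol[of n w] g by (auto simp: less_imp_le)
qed

definition chol_col :: "(nat \<times> nat \<Rightarrow> real) \<Rightarrow> nat \<Rightarrow> (nat \<times> nat \<Rightarrow> real) \<Rightarrow> nat \<times> nat \<Rightarrow> real" where
  "chol_col w n v = (\<lambda>(i, j)\<in>colidx n. \<Sum>k\<le>i. chol w i k * v (k, n))"

text \<open>Appending a row to the Cholesky factor appends a column to the matrix and leaves the
  leading block alone, which is the basis of all inductions on the dimension.\<close>

lemma chol_prod_merge:
  assumes p: "p \<in> upper_idx (Suc n)"
  shows "merge (upper_idx n) (colidx n) (chol_prod w, chol_col w n v) p = chol_prod (merge (upper_idx n) (colidx n) (w, v)) p"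
proof -
  let ?m = "merge (upper_idx n) (colidx n) (w, v)"
  have m: "?m q = w q" if "q \<in> upper_idx n" for q using that by (simp add: merge_def)
  show ?thesis
  proof (cases "p \<in> upper_idx n")
    case True
    then show ?thesis using chol_prod_cong[of n ?m w, OF m True] by (simp add: merge_def)
  next
    case False
    then have "p \<in> colidx n" using p by (auto simp: upper_idx_Suc)
    then obtain i where i: "p = (i, n)" "i < n" by (auto simp: colidx_def)
    have "chol ?m i k * chol ?m n k = chol w i k * v (k, n)" if "k \<le> i" for k
    proof -
      have "chol ?m i k = chol w i k" by (rule chol_cong[of n]) (use m i in auto)
      moreover have "chol ?m n k = v (k, n)"
        using that i upper_idx_Suc(2)[of n] by (auto simp: chol_def colidx_def merge_def upper_idx_def)
      ultimately show ?thesis by simp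
    qed
    then have "chol_prod ?m p = (\<Sum>k\<le>i. chol w i k * v (k, n))"
      unfolding i chol_prod_def by simp
    then show ?thesis using \<open>p \<in> colidx n\<close> False i by (simp add: chol_col_def merge_def)
  qed
qed

lemma sqn_merge:
  "j < n \<Longrightarrow> sqn (colidx j) (merge (upper_idx n) (colidx n) (w, v)) = sqn (colidx j) w"
  "sqn (colidx n) (merge (upper_idx n) (colidx n) (w, v)) = sqn (colidx n) v"
  using upper_idx_Suc(2)[of n] unfolding sqn_col
  by (auto intro!: sum.cong simp: merge_def upper_idx_def colidx_def)

text \<open>A triangular system whose diagonal is nonzero because all rows lie in the open ball. It
  supplies the test vector of \<open>posdef_merge_iff\<close>.\<close>

lemma chol_transpose_solve:
  assumes g: "\<And>j. j < n \<Longrightarrow> sqn (colidx j) w < 1"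
  obtains u where "\<And>k. k < n \<Longrightarrow> (\<Sum>i<n. chol w i k * u i) = b k"
proof -
  let ?L = "Matrix.mat n n (\<lambda>(k, i). chol w i k)"
  have L: "?L \<in> carrier_mat n n" by simp
  have "upper_triangular ?L" by (auto simp: chol_eq_0)
  then have "Determinant.det ?L = prod_list (diag_mat ?L)"
    by (rule det_upper_triangular[OF _ L])
  also have "\<dots> \<noteq> 0" using g by (force simp: prod_list_zero_iff diag_mat_def chol_def)
  finally have d: "Determinant.det ?L \<noteq> 0" .
  let ?B = "adj_mat ?L" and ?d = "Determinant.det ?L"
  define z where "z = vec n b"
  have B: "?B \<in> carrier_mat n n" "?L * ?B = ?d \<cdot>\<^sub>m 1\<^sub>m n" using adj_mat[OF L] by auto
  define v where "v = ?B *\<^sub>v z"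
  have v: "v \<in> carrier_vec n" using B by (simp add: v_def z_def)
  have "?L *\<^sub>v v = (?L * ?B) *\<^sub>v z" unfolding v_def
    using L B by (intro assoc_mult_mat_vec[symmetric]) (auto simp: z_def)
  also have "\<dots> = ?d \<cdot>\<^sub>v z" unfolding B(2) by (auto simp: z_def)
  finally have e: "?L *\<^sub>v v = ?d \<cdot>\<^sub>v z" .
  have "(\<Sum>i<n. chol w i k * vec_index v i) = ?d * b k" if k: "k < n" for k
    using arg_cong[OF e, of "\<lambda>x. vec_index x k"] k v
    by (simp add: z_def scalar_prod_def atLeast0LessThan)
  then show ?thesis using d
    by (intro that[of "\<lambda>i. vec_index v i / ?d"]) (simp add: sum_divide_distrib[symmetric])
qed

text \<open>The Schur complement of the new diagonal entry is 1 - |v|^2. The admissible new rows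
  thus fill the open unit ball whatever w is, and this is why the rows become independent.\<close>

lemma posdef_merge_iff:
  assumes g: "\<And>j. j < n \<Longrightarrow> sqn (colidx j) w < 1"
  shows "posdef (Suc n) (corr_fun (merge (upper_idx n) (colidx n) (chol_prod w, chol_col w n v))) \<longleftrightarrow> sqn (colidx n) v < 1"
proof
  let ?c = "corr_fun (merge (upper_idx n) (colidx n) (chol_prod w, chol_col w n v))"
  let ?c' = "corr_fun (chol_prod (merge (upper_idx n) (colidx n) (w, v)))"
  have eq: "posdef (Suc n) ?c = posdef (Suc n) ?c'"
    by (intro posdef_cong corr_fun_cong[of "Suc n"] chol_prod_merge)
  {
    assume "sqn (colidx n) v < 1"
    then show "posdef (Suc n) ?c" unfolding eq
      by (intro posdef_chol) (auto simp: less_Suc_eq sqn_merge g)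
  }
  assume pd: "posdef (Suc n) ?c"
  \<comment> \<open>With L' u0 = -v the form at (u0, 1) is |v|^2 - 2 |v|^2 + 1, the Schur
    complement.\<close>
  obtain u0 where u0: "\<And>k. k < n \<Longrightarrow> (\<Sum>i<n. chol w i k * u0 i) = - v (k, n)"
    using chol_transpose_solve[where b = "\<lambda>k. - v (k, n)", OF g] by blast
  define u where "u = u0(n := 1)"
  have un: "u n = 1" "\<And>i. i < n \<Longrightarrow> u i = u0 i" by (auto simp: u_def)
  have c: "?c i j = (\<Sum>k<n. chol w i k * chol w j k)" if "i < n" "j < n" for i j
  proof -
    have "?c i j = corr_fun (chol_prod w) i j"
      by (rule corr_fun_cong[of n]) (use that in \<open>auto simp: merge_def\<close>)
    then show ?thesis using corr_fun_chol[of n w i j] g that by (simp add: less_imp_le)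
  qed
  have cn: "?c i n = (\<Sum>k<n. chol w i k * v (k, n))" "?c n i = ?c i n" if "i < n" for i
  proof -
    have "(i, n) \<in> colidx n" "(i, n) \<notin> upper_idx n" using that by (auto simp: colidx_def upper_idx_def)
    then show "?c i n = (\<Sum>k<n. chol w i k * v (k, n))"
      using that sum_chol_trunc[OF that, of w "\<lambda>k. v (k, n)"] by (simp add: corr_fun_def chol_col_def merge_def)
  qed (rule corr_fun_sym)
  have cnn: "?c n n = 1" by (simp add: corr_fun_def)
  have a1: "(\<Sum>i<n. \<Sum>j<n. u0 i * ?c i j * u0 j) = sqn (colidx n) v"
  proof -
    have "(\<Sum>i<n. \<Sum>j<n. u0 i * ?c i j * u0 j) = (\<Sum>i<n. \<Sum>j<n. u0 i * u0 j * (\<Sum>k<n. chol w i k * chol w j k))"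
      by (intro sum.cong refl) (simp add: c)
    also have "\<dots> = (\<Sum>k<n. (\<Sum>i<n. u0 i * chol w i k) * (\<Sum>i<n. u0 i * chol w i k))"
      by (rule gram[symmetric])
    also have "\<dots> = (\<Sum>k<n. (- v (k, n)) * (- v (k, n)))"
      by (intro sum.cong refl) (simp add: u0 mult.commute[of "u0 _"])
    finally show ?thesis by (simp add: sqn_col power2_eq_square)
  qed
  have a2: "(\<Sum>i<n. u0 i * ?c i n) = - sqn (colidx n) v"
  proof -
    have "(\<Sum>i<n. u0 i * ?c i n) = (\<Sum>i<n. \<Sum>k<n. u0 i * (chol w i k * v (k, n)))"
      by (intro sum.cong refl) (simp add: cn sum_distrib_left)
    also have "\<dots> = (\<Sum>k<n. (\<Sum>i<n. chol w i k * u0 i) * v (k, n))"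
      by (subst sum.swap) (simp add: sum_distrib_right sum_distrib_left mult_ac)
    also have "\<dots> = (\<Sum>k<n. - v (k, n) * v (k, n))" by (simp add: u0)
    finally show ?thesis by (simp add: sqn_col power2_eq_square sum_negf)
  qed
  have "0 < (\<Sum>i<Suc n. \<Sum>j<Suc n. u i * ?c i j * u j)"
  proof -
    have "\<exists>i<Suc n. u i \<noteq> 0" using un(1) by (intro exI[of _ n]) simp
    with pd[unfolded posdef_def, rule_format, of u] show ?thesis .
  qed
  also have "\<dots> = (\<Sum>i<n. \<Sum>j<n. u0 i * ?c i j * u0 j) + (\<Sum>i<n. u0 i * ?c i n) + (\<Sum>j<n. ?c n j * u0 j) + 1"
    by (simp add: un sum.distrib cnn)
  also have "(\<Sum>j<n. ?c n j * u0 j) = (\<Sum>i<n. u0 i * ?c i n)"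
    by (intro sum.cong refl) (simp add: cn(2))
  finally show "sqn (colidx n) v < 1" unfolding a1 a2 by simp
qed

section \<open>Measurability in the off-diagonal coordinates\<close>

lemma sets_PiM_lborel [measurable_cong, simp]: "sets (Pi\<^sub>M I (\<lambda>_. lborel)) = sets (Pi\<^sub>M I (\<lambda>_. borel :: real measure))"
  by (intro sets_PiM_cong) auto

lemma floor_mult_div_tendsto: "(\<lambda>k. of_int \<lfloor>real k * x\<rfloor> / real k) \<longlonglongrightarrow> x"
proof (rule tendsto_sandwich)
  show "\<forall>\<^sub>F k in sequentially. x - 1 / real k \<le> of_int \<lfloor>real k * x\<rfloor> / real k"
    using eventually_gt_at_top[of 0]
  proof eventually_elim
    case (elim k)
    have "real k * x - 1 \<le> of_int \<lfloor>real k * x\<rfloor>" by linarith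
    then have "(real k * x - 1) / real k \<le> of_int \<lfloor>real k * x\<rfloor> / real k"
      by (rule divide_right_mono) simp
    then show ?case using elim by (simp add: diff_divide_distrib)
  qed
  show "\<forall>\<^sub>F k in sequentially. of_int \<lfloor>real k * x\<rfloor> / real k \<le> x"
    using eventually_gt_at_top[of 0]
  proof eventually_elim
    case (elim k)
    have "of_int \<lfloor>real k * x\<rfloor> / real k \<le> real k * x / real k"
      by (intro divide_right_mono) auto
    then show ?case using elim by simp
  qed
  show "(\<lambda>k. x - 1 / real k) \<longlonglongrightarrow> x"
    using tendsto_diff[OF tendsto_const lim_1_over_n] by simp
qed simp

text \<open>Testing on integer vectors makes the positive semidefinite cone a countable intersection,
  hence measurable.\<close>

lemma psd_fun_iff_int:
  "psd_fun n c \<longleftrightarrow> (\<forall>zs::int list. 0 \<le> (\<Sum>i<n. \<Sum>j<n. of_int (zs ! i) * c i j * of_int (zs ! j)))"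
proof
  assume R: "\<forall>zs::int list. 0 \<le> (\<Sum>i<n. \<Sum>j<n. of_int (zs ! i) * c i j * of_int (zs ! j))"
  show "psd_fun n c" unfolding psd_fun_def
  proof
    fix u :: "nat \<Rightarrow> real"
    let ?z = "\<lambda>k i. of_int \<lfloor>real k * u i\<rfloor> / real k :: real"
    have "(\<lambda>k. \<Sum>i<n. \<Sum>j<n. ?z k i * c i j * ?z k j) \<longlonglongrightarrow> (\<Sum>i<n. \<Sum>j<n. u i * c i j * u j)"
      by (intro tendsto_sum tendsto_mult floor_mult_div_tendsto tendsto_const)
    moreover have "0 \<le> (\<Sum>i<n. \<Sum>j<n. ?z k i * c i j * ?z k j)" for k
    proof -
      have "0 \<le> (\<Sum>i<n. \<Sum>j<n. of_int (map (\<lambda>i. \<lfloor>real k * u i\<rfloor>) [0..<n] ! i) * c i j * of_int (map (\<lambda>i. \<lfloor>real k * u i\<rfloor>) [0..<n] ! j))"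
        using R by blast
      also have "\<dots> = (\<Sum>i<n. \<Sum>j<n. of_int \<lfloor>real k * u i\<rfloor> * c i j * of_int \<lfloor>real k * u j\<rfloor>)"
        by (intro sum.cong refl) simp
      finally have "0 \<le> (\<Sum>i<n. \<Sum>j<n. of_int \<lfloor>real k * u i\<rfloor> * c i j * of_int \<lfloor>real k * u j\<rfloor>) / (real k * real k)"
        by (rule divide_nonneg_nonneg) simp
      also have "\<dots> = (\<Sum>i<n. \<Sum>j<n. ?z k i * c i j * ?z k j)"
        by (simp add: sum_divide_distrib)
      finally show ?thesis .
    qed
    ultimately show "0 \<le> (\<Sum>i<n. \<Sum>j<n. u i * c i j * u j)"
      by (intro LIMSEQ_le_const) auto
  qed
qed (auto simp: psd_fun_def)

lemma measurable_corr_fun: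
  assumes "i < n" "j < n"
  shows "(\<lambda>x. corr_fun x i j) \<in> borel_measurable (Pi\<^sub>M (upper_idx n) (\<lambda>_. borel))"
proof -
  consider "i = j" | "i < j" "(i, j) \<in> upper_idx n" | "i > j" "(j, i) \<in> upper_idx n"
    using assms by (cases i j rule: linorder_cases) (auto simp: upper_idx_def)
  then show ?thesis
    by cases (auto simp: corr_fun_def)
qed

lemma measurable_psd_fun [measurable]:
  "Measurable.pred (Pi\<^sub>M (upper_idx n) (\<lambda>_. borel)) (\<lambda>x. psd_fun n (corr_fun x))"
  unfolding psd_fun_iff_int
proof (intro pred_intros_countable)
  fix zs :: "int list"
  have "(\<lambda>x. \<Sum>i<n. \<Sum>j<n. real_of_int (zs ! i) * corr_fun x i j * real_of_int (zs ! j)) \<in> borel_measurable (Pi\<^sub>M (upper_idx n) (\<lambda>_. borel))"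
    by (intro borel_measurable_sum borel_measurable_times measurable_const measurable_corr_fun) auto
  then show "Measurable.pred (Pi\<^sub>M (upper_idx n) (\<lambda>_. borel)) (\<lambda>x. 0 \<le> (\<Sum>i<n. \<Sum>j<n. real_of_int (zs ! i) * corr_fun x i j * real_of_int (zs ! j)))"
    by measurable
qed

lemma permutes_less_n: "p permutes {0..<n} \<Longrightarrow> i < (n::nat) \<Longrightarrow> p i < n"
  using permutes_in_image[of p "{0..<n}" i] by simp

lemma measurable_det [measurable]:
  "(\<lambda>x. Determinant.det (mat_of_offdiag n x)) \<in> borel_measurable (Pi\<^sub>M (upper_idx n) (\<lambda>_. borel))"
proof -
  have "Determinant.det (mat_of_offdiag n x) = (\<Sum>p\<in>{p. p permutes {0..<n}}. signof p * (\<Prod>i = 0..<n. corr_fun x i (p i)))" for x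
    unfolding det_def'[OF mat_of_offdiag_carrier]
    by (intro sum.cong refl arg_cong2[of _ _ _ _ times] prod.cong)
       (auto simp: mat_of_offdiag_corr_fun permutes_less_n)
  moreover have "(\<lambda>x. \<Sum>p\<in>{p. p permutes {0..<n}}. signof p * (\<Prod>i = 0..<n. corr_fun x i (p i))) \<in> borel_measurable (Pi\<^sub>M (upper_idx n) (\<lambda>_. borel))"
    by (intro borel_measurable_sum borel_measurable_times measurable_const borel_measurable_prod measurable_corr_fun)
       (auto simp: permutes_less_n)
  ultimately show ?thesis by simp
qed

text \<open>The LKJ density in coordinates before normalization, for
  \<open>\<alpha> = \<eta> - 1\<close>.\<close>

definition pd_weight :: "nat \<Rightarrow> real \<Rightarrow> (nat \<times> nat \<Rightarrow> real) \<Rightarrow> real" where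
  "pd_weight n \<alpha> x = (if psd_fun n (corr_fun x) then Determinant.det (mat_of_offdiag n x) powr \<alpha> else 0)"

lemma measurable_pd_weight [measurable]: "pd_weight n \<alpha> \<in> borel_measurable (Pi\<^sub>M (upper_idx n) (\<lambda>_. borel))"
  unfolding pd_weight_def by measurable

text \<open>Singular matrices have weight 0 since \<open>0 powr \<alpha> = 0\<close> for every
  \<open>\<alpha>\<close>. This passes from semidefiniteness, which defines correlation matrices, to
  definiteness, which Cholesky coordinates describe.\<close>

lemma pd_weight_posdef:
  "pd_weight n \<alpha> x = (if posdef n (corr_fun x) then Determinant.det (mat_of_offdiag n x) powr \<alpha> else 0)"
  by (auto simp: pd_weight_def posdef_corr_fun_iff)

section \<open>Triangular changes of variables and the law of the Cholesky factor\<close>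

abbreviation (input) column :: "nat \<Rightarrow> nat \<Rightarrow> (nat \<times> nat) set" where
  "column N m \<equiv> (\<lambda>i. (i, N)) ` {..<m}"

definition tri :: "nat \<Rightarrow> nat \<Rightarrow> (nat \<Rightarrow> nat \<Rightarrow> real) \<Rightarrow> (nat \<times> nat \<Rightarrow> real) \<Rightarrow> nat \<times> nat \<Rightarrow> real" where
  "tri N m L v = (\<lambda>p\<in>column N m. \<Sum>k\<le>fst p. L (fst p) k * v (k, N))"

lemma measurable_tri [measurable]:
  "tri N m L \<in> measurable (Pi\<^sub>M (column N m) (\<lambda>_. borel)) (Pi\<^sub>M (column N m) (\<lambda>_. borel))"
  unfolding tri_def
proof (rule measurable_restrict)
  fix p assume "p \<in> column N m"
  then show "(\<lambda>v. \<Sum>k\<le>fst p. L (fst p) k * v (k, N)) \<in> borel_measurable (Pi\<^sub>M (column N m) (\<lambda>_. borel))"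
    by (intro borel_measurable_sum borel_measurable_times measurable_const measurable_component_singleton) auto
qed

lemma tri_upd:
  "tri N (Suc m) L (v((m, N) := t)) = (tri N m L v)((m, N) := (\<Sum>k<m. L m k * v (k, N)) + L m m * t)"
proof
  fix p
  show "tri N (Suc m) L (v((m, N) := t)) p = ((tri N m L v)((m, N) := (\<Sum>k<m. L m k * v (k, N)) + L m m * t)) p"
  proof (cases "p = (m, N)")
    case True
    then show ?thesis by (simp add: tri_def lessThan_Suc_atMost[symmetric])
  next
    case False
    show ?thesis
    proof (cases "p \<in> column N m")
      case True
      then obtain i where i: "p = (i, N)" "i < m" by auto
      have "(\<Sum>k\<le>i. L i k * (v((m, N) := t)) (k, N)) = (\<Sum>k\<le>i. L i k * v (k, N))"
        using i by (intro sum.cong) auto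
      then show ?thesis using i False True by (auto simp: tri_def)
    next
      case p: False
      then have "p \<notin> column N (Suc m)" using False by (auto simp: less_Suc_eq)
      then show ?thesis using p False by (simp add: tri_def)
    qed
  qed
qed

text \<open>Coordinate m of the image is affine in the new variable with slope \<open>L m m\<close>,
  and the earlier coordinates do not involve that variable. One affine substitution per step
  therefore builds up the Jacobian.\<close>

lemma nn_integral_triangular:
  assumes "\<And>i. i < m \<Longrightarrow> L i i > 0" and "f \<in> borel_measurable (Pi\<^sub>M (column N m) (\<lambda>_. borel))"
  shows "(\<integral>\<^sup>+r. f r \<partial>Pi\<^sub>M (column N m) (\<lambda>_. lborel)) =
    ennreal (\<Prod>i<m. L i i) * (\<integral>\<^sup>+v. f (tri N m L v) \<partial>Pi\<^sub>M (column N m) (\<lambda>_. lborel))"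
  using assms
proof (induction m arbitrary: f)
  case 0
  interpret product_sigma_finite "\<lambda>_::nat \<times> nat. lborel :: real measure" by standard
  have "column N 0 = {}" by simp
  then show ?case
    by (simp only: nn_integral_empty zero_le) (simp add: tri_def restrict_def)
next
  case (Suc m)
  interpret product_sigma_finite "\<lambda>_::nat \<times> nat. lborel :: real measure" by standard
  let ?p = "(m, N)" and ?B = "column N m"
  have B: "column N (Suc m) = insert ?p ?B" "?p \<notin> ?B" "finite ?B" by (auto simp: lessThan_Suc)
  have f: "f \<in> borel_measurable (Pi\<^sub>M (insert ?p ?B) (\<lambda>_. borel))" using Suc.prems(2) unfolding B(1) .
  have f': "f \<in> borel_measurable (Pi\<^sub>M (insert ?p ?B) (\<lambda>_. lborel))" using f by (simp cong: measurable_cong_sets)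
  have ft: "(\<lambda>v. f (tri N (Suc m) L v)) \<in> borel_measurable (Pi\<^sub>M (insert ?p ?B) (\<lambda>_. lborel))"
    using measurable_compose[OF measurable_tri Suc.prems(2), of L] unfolding B(1) by (simp cong: measurable_cong_sets)
  define g where "g r = (\<integral>\<^sup>+y. f (r(?p := y)) \<partial>lborel)" for r
  have "(\<lambda>z. f ((\<lambda>(r, y). r(?p := y)) z)) \<in> borel_measurable (Pi\<^sub>M ?B (\<lambda>_. borel) \<Otimes>\<^sub>M borel)"
    by (rule measurable_compose[OF measurable_add_dim f])
  then have "(\<lambda>z. f ((\<lambda>(r, y). r(?p := y)) z)) \<in> borel_measurable (Pi\<^sub>M ?B (\<lambda>_. borel) \<Otimes>\<^sub>M lborel)"
    by (simp cong: measurable_cong_sets sets_pair_measure_cong)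
  then have g: "g \<in> borel_measurable (Pi\<^sub>M ?B (\<lambda>_. borel))"
    unfolding g_def by (intro lborel.borel_measurable_nn_integral) (simp add: case_prod_beta)
  have fu: "(\<lambda>y. f (r(?p := y))) \<in> borel_measurable borel" if r: "r \<in> space (Pi\<^sub>M ?B (\<lambda>_. borel))" for r
    using measurable_comp[OF measurable_component_update f, OF r B(2)] unfolding comp_def .
  have "(\<integral>\<^sup>+r. f r \<partial>Pi\<^sub>M (column N (Suc m)) (\<lambda>_. lborel)) = (\<integral>\<^sup>+r. g r \<partial>Pi\<^sub>M ?B (\<lambda>_. lborel))"
    unfolding B(1) g_def by (rule product_nn_integral_insert[OF B(3,2) f'])
  also have "\<dots> = ennreal (\<Prod>i<m. L i i) * (\<integral>\<^sup>+v. g (tri N m L v) \<partial>Pi\<^sub>M ?B (\<lambda>_. lborel))"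
    by (rule Suc.IH[OF _ g]) (use Suc.prems in auto)
  also have "(\<integral>\<^sup>+v. g (tri N m L v) \<partial>Pi\<^sub>M ?B (\<lambda>_. lborel)) =
    (\<integral>\<^sup>+v. ennreal (L m m) * (\<integral>\<^sup>+t. f (tri N (Suc m) L (v(?p := t))) \<partial>lborel) \<partial>Pi\<^sub>M ?B (\<lambda>_. lborel))"
  proof (rule nn_integral_cong)
    fix v :: "nat \<times> nat \<Rightarrow> real"
    have "tri N m L v \<in> space (Pi\<^sub>M ?B (\<lambda>_. borel))" by (auto simp: tri_def space_PiM PiE_def)
    from fu[OF this] Suc.prems(1)[of m]
    show "g (tri N m L v) = ennreal (L m m) * (\<integral>\<^sup>+t. f (tri N (Suc m) L (v(?p := t))) \<partial>lborel)"
      unfolding g_def tri_upd by (subst nn_integral_real_affine[of _ "L m m" "\<Sum>k<m. L m k * v (k, N)"]) auto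
  qed
  also have "\<dots> = ennreal (L m m) * (\<integral>\<^sup>+v. \<integral>\<^sup>+t. f (tri N (Suc m) L (v(?p := t))) \<partial>lborel \<partial>Pi\<^sub>M ?B (\<lambda>_. lborel))"
  proof (rule nn_integral_cmult)
    have "(\<lambda>z. f (tri N (Suc m) L ((\<lambda>(r, y). r(?p := y)) z))) \<in> borel_measurable (Pi\<^sub>M ?B (\<lambda>_. lborel) \<Otimes>\<^sub>M lborel)"
      using measurable_compose[OF measurable_add_dim ft] by simp
    then show "(\<lambda>v. \<integral>\<^sup>+t. f (tri N (Suc m) L (v(?p := t))) \<partial>lborel) \<in> borel_measurable (Pi\<^sub>M ?B (\<lambda>_. lborel))"
      by (intro lborel.borel_measurable_nn_integral) (simp add: case_prod_beta)
  qed
  also have "(\<integral>\<^sup>+v. \<integral>\<^sup>+t. f (tri N (Suc m) L (v(?p := t))) \<partial>lborel \<partial>Pi\<^sub>M ?B (\<lambda>_. lborel)) =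
     (\<integral>\<^sup>+v. f (tri N (Suc m) L v) \<partial>Pi\<^sub>M (insert ?p ?B) (\<lambda>_. lborel))"
    by (rule product_nn_integral_insert[OF B(3,2) ft, symmetric])
  finally show ?case
    unfolding B(1) using Suc.prems(1)
    by (simp add: mult.assoc[symmetric] ennreal_mult''[symmetric] less_imp_le)
qed

text \<open>In terms of \<open>\<nu>\<close> the law of a row does not depend on the final dimension, so these laws
  are nested; this is what makes induction on the dimension possible.\<close>

primrec chol_law :: "real \<Rightarrow> nat \<Rightarrow> (nat \<times> nat \<Rightarrow> real) measure" where
  "chol_law \<nu> 0 = Pi\<^sub>M {} (\<lambda>_. borel)"
| "chol_law \<nu> (Suc n) = distr (chol_law \<nu> n \<Otimes>\<^sub>M ball_law (colidx n) ((\<nu> - n) / 2))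
     (Pi\<^sub>M (upper_idx (Suc n)) (\<lambda>_. borel)) (merge (upper_idx n) (colidx n))"

lemma upper_idx_0: "upper_idx 0 = {}" by (auto simp: upper_idx_def)

lemma sets_chol_law [measurable_cong, simp]: "sets (chol_law \<nu> n) = sets (Pi\<^sub>M (upper_idx n) (\<lambda>_. borel))"
  by (cases n) (simp_all add: upper_idx_0)

lemma measurable_merge_chol [measurable]:
  "merge (upper_idx n) (colidx n) \<in> measurable (Pi\<^sub>M (upper_idx n) (\<lambda>_. borel) \<Otimes>\<^sub>M Pi\<^sub>M (colidx n) (\<lambda>_. borel)) (Pi\<^sub>M (upper_idx (Suc n)) (\<lambda>_. borel :: real measure))"
  unfolding upper_idx_Suc by (rule measurable_merge)

lemma prob_space_chol_law: "\<nu> > real n - 1 \<Longrightarrow> prob_space (chol_law \<nu> n)"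
proof (induction n)
  case 0
  show ?case by (rule prob_spaceI) (simp add: PiM_empty)
next
  case (Suc n)
  interpret A: prob_space "chol_law \<nu> n" using Suc by simp
  interpret B: prob_space "ball_law (colidx n) ((\<nu> - n) / 2)" using Suc.prems by (intro prob_space_ball_law) auto
  interpret pair_prob_space "chol_law \<nu> n" "ball_law (colidx n) ((\<nu> - n) / 2)" ..
  show ?case unfolding chol_law.simps by (rule prob_space_distr) measurable
qed

lemma measurable_sqn_col [measurable]:
  "j < n \<Longrightarrow> sqn (colidx j) \<in> borel_measurable (Pi\<^sub>M (upper_idx n) (\<lambda>_. borel))"
  unfolding sqn_def using col_subset[of j n]
  by (intro borel_measurable_sum borel_measurable_power measurable_component_singleton) auto

lemma AE_chol_law: "\<nu> > real n - 1 \<Longrightarrow> AE w in chol_law \<nu> n. \<forall>j<n. sqn (colidx j) w < 1"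
proof (induction n)
  case (Suc n)
  let ?B = "ball_law (colidx n) ((\<nu> - n) / 2)"
  have a: "(\<nu> - n) / 2 > 0" using Suc.prems by simp
  interpret A: prob_space "chol_law \<nu> n" using Suc by (intro prob_space_chol_law) simp
  interpret B: prob_space ?B using a by (intro prob_space_ball_law) auto
  interpret pair_prob_space "chol_law \<nu> n" ?B ..
  define P where "P w \<longleftrightarrow> (\<forall>j<Suc n. sqn (colidx j) w < 1)" for w
  have P[measurable]: "Measurable.pred (Pi\<^sub>M (upper_idx (Suc n)) (\<lambda>_. borel)) P"
    unfolding P_def
  proof (intro pred_intros_countable)
    fix j
    show "Measurable.pred (Pi\<^sub>M (upper_idx (Suc n)) (\<lambda>_. borel)) (\<lambda>w. j < Suc n \<longrightarrow> sqn (colidx j) w < 1)"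
      using measurable_sqn_col[of j "Suc n"] by (cases "j < Suc n") simp_all
  qed
  have m: "merge (upper_idx n) (colidx n) \<in> measurable (chol_law \<nu> n \<Otimes>\<^sub>M ?B) (Pi\<^sub>M (upper_idx (Suc n)) (\<lambda>_. borel))"
    by measurable
  have "AE w in chol_law \<nu> n. \<forall>j<n. sqn (colidx j) w < 1" using Suc by simp
  then have "AE w in chol_law \<nu> n. AE v in ?B. P (merge (upper_idx n) (colidx n) (w, v))"
  proof eventually_elim
    case (elim w)
    show ?case using AE_ball_law[OF finite_colidx a, of n]
      by eventually_elim (use elim in \<open>auto simp: P_def less_Suc_eq sqn_merge\<close>)
  qed
  then have "AE z in chol_law \<nu> n \<Otimes>\<^sub>M ?B. P (merge (upper_idx n) (colidx n) z)"
    using measurable_compose[OF m P] by (intro AE_pair_measure) (simp_all add: pred_def)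
  then have "AE w in chol_law \<nu> (Suc n). P w"
    unfolding chol_law.simps using P by (subst AE_distr_iff[OF m]) (simp_all add: pred_def)
  then show ?case by (simp add: P_def)
qed simp

definition chol_map :: "nat \<Rightarrow> (nat \<times> nat \<Rightarrow> real) \<Rightarrow> nat \<times> nat \<Rightarrow> real" where
  "chol_map n w = restrict (chol_prod w) (upper_idx n)"

lemma measurable_chol:
  assumes "i < n" shows "(\<lambda>w. chol w i k) \<in> borel_measurable (Pi\<^sub>M (upper_idx n) (\<lambda>_. borel))"
proof -
  consider "k < i" | "k = i" | "k > i" by linarith
  then show ?thesis
  proof cases
    case 1
    then have "(k, i) \<in> upper_idx n" using assms by (auto simp: upper_idx_def)
    then show ?thesis using 1 by (simp add: chol_def)
  next
    case 2
    note [measurable] = measurable_sqn_col[OF assms]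
    show ?thesis using 2 by (simp add: chol_def)
  next
    case 3
    then show ?thesis by (simp add: chol_def)
  qed
qed

lemma measurable_chol_map [measurable]:
  "chol_map n \<in> measurable (Pi\<^sub>M (upper_idx n) (\<lambda>_. borel)) (Pi\<^sub>M (upper_idx n) (\<lambda>_. borel))"
  unfolding chol_map_def
proof (rule measurable_restrict)
  fix p assume "p \<in> upper_idx n"
  then obtain i j where "p = (i, j)" "i < n" "j < n" by (auto simp: upper_idx_def)
  then show "(\<lambda>w. chol_prod w p) \<in> borel_measurable (Pi\<^sub>M (upper_idx n) (\<lambda>_. borel))"
    by (auto simp: chol_prod_def intro!: borel_measurable_sum borel_measurable_times measurable_chol)
qed

text \<open>The total mass of \<open>pd_weight\<close>. The shift by 1/2 is the Jacobian of the last
  column, which is the square root of the determinant of the leading block; the second factor is the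
  mass of the weight of the last row.\<close>

primrec lkj_norm :: "nat \<Rightarrow> real \<Rightarrow> real" where
  "lkj_norm 0 \<alpha> = 1"
| "lkj_norm (Suc n) \<alpha> = lkj_norm n (\<alpha> + 1 / 2) * ball_norm (colidx n) (\<alpha> + 1)"

lemma lkj_norm_pos: "\<alpha> > -1 \<Longrightarrow> lkj_norm n \<alpha> > 0"
  by (induction n arbitrary: \<alpha>) (auto intro!: mult_pos_pos ball_norm_pos)

lemma tri_chol_col: "chol_col w n v = tri n n (chol w) v"
  unfolding chol_col_def tri_def colidx_def by (auto simp: restrict_def fun_eq_iff)

lemma merge_chol_map:
  "merge (upper_idx n) (colidx n) (chol_map n w, chol_col w n v) = chol_map (Suc n) (merge (upper_idx n) (colidx n) (w, v))"
proof
  fix p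
  show "merge (upper_idx n) (colidx n) (chol_map n w, chol_col w n v) p = chol_map (Suc n) (merge (upper_idx n) (colidx n) (w, v)) p"
  proof (cases "p \<in> upper_idx (Suc n)")
    case True
    then show ?thesis using chol_prod_merge[OF True, of w v]
      by (auto simp: chol_map_def merge_def upper_idx_Suc)
  next
    case False
    then show ?thesis by (auto simp: chol_map_def merge_def upper_idx_Suc)
  qed
qed

text \<open>The new row multiplies the determinant by 1 - |v|^2, so the weight splits into a
  function of w and a ball weight in v.\<close>

lemma pd_weight_merge:
  assumes g: "\<And>j. j < n \<Longrightarrow> sqn (colidx j) w < 1"
  shows "pd_weight (Suc n) \<alpha> (merge (upper_idx n) (colidx n) (chol_map n w, chol_col w n v)) =
     (\<Prod>j<n. 1 - sqn (colidx j) w) powr \<alpha> * ball_weight (\<alpha> + 1) (sqn (colidx n) v)"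
proof -
  let ?m = "merge (upper_idx n) (colidx n) (w, v)"
  have pd: "posdef (Suc n) (corr_fun (merge (upper_idx n) (colidx n) (chol_map n w, chol_col w n v))) \<longleftrightarrow> sqn (colidx n) v < 1"
  proof -
    have "posdef (Suc n) (corr_fun (merge (upper_idx n) (colidx n) (chol_map n w, chol_col w n v))) =
      posdef (Suc n) (corr_fun (merge (upper_idx n) (colidx n) (chol_prod w, chol_col w n v)))"
      by (intro posdef_cong corr_fun_cong[of "Suc n"]) (auto simp: merge_def chol_map_def)
    then show ?thesis using posdef_merge_iff[OF g] by simp
  qed
  have det: "Determinant.det (mat_of_offdiag (Suc n) (merge (upper_idx n) (colidx n) (chol_map n w, chol_col w n v))) =
     (\<Prod>j<n. 1 - sqn (colidx j) w) * (1 - sqn (colidx n) v)" if "sqn (colidx n) v < 1"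
  proof -
    have "mat_of_offdiag (Suc n) (chol_map (Suc n) ?m) = mat_of_offdiag (Suc n) (chol_prod ?m)"
      unfolding mat_of_offdiag_corr_fun by (intro cong_mat refl) (auto intro!: corr_fun_cong[of "Suc n"] simp: chol_map_def)
    moreover have "sqn (colidx j) ?m \<le> 1" if "j < Suc n" for j
      using that g \<open>sqn (colidx n) v < 1\<close> by (auto simp: less_Suc_eq sqn_merge less_imp_le)
    ultimately show ?thesis unfolding merge_chol_map by (simp add: det_chol sqn_merge)
  qed
  show ?thesis
    unfolding pd_weight_posdef pd using det by (auto simp: ball_weight_def powr_mult)
qed

text \<open>Induction on n with \<open>\<alpha>\<close> raised by 1/2 in the smaller dimension. The
  number \<open>n + 2 * \<alpha> + 1\<close> does not change, so the induction hypothesis is about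
  the same nested family of laws.\<close>

lemma nn_integral_chol:
  assumes "\<alpha> > -1" and "f \<in> borel_measurable (Pi\<^sub>M (upper_idx n) (\<lambda>_. borel))"
  shows "(\<integral>\<^sup>+x. f x * ennreal (pd_weight n \<alpha> x) \<partial>Pi\<^sub>M (upper_idx n) (\<lambda>_. lborel)) =
    ennreal (lkj_norm n \<alpha>) * (\<integral>\<^sup>+w. f (chol_map n w) \<partial>chol_law (n + 2 * \<alpha> + 1) n)"
  using assms
proof (induction n arbitrary: \<alpha> f)
  case 0
  interpret product_sigma_finite "\<lambda>_::nat \<times> nat. lborel :: real measure" by standard
  have 1: "pd_weight 0 \<alpha> x = 1" for x by (simp add: pd_weight_def psd_fun_def)
  have 2: "chol_map 0 w = (\<lambda>_. undefined)" for w by (simp add: chol_map_def upper_idx_0 restrict_def)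
  have 3: "emeasure (Pi\<^sub>M {} (\<lambda>_. borel :: real measure)) (space (Pi\<^sub>M {} (\<lambda>_. borel))) = 1"
    by (simp add: PiM_empty)
  show ?case unfolding upper_idx_0 1 2 by (simp add: nn_integral_empty 3)
next
  case (Suc n)
  interpret product_sigma_finite "\<lambda>_::nat \<times> nat. lborel :: real measure" by standard
  let ?U = "upper_idx n" and ?K = "colidx n"
  let ?\<nu> = "real (Suc n) + 2 * \<alpha> + 1"
  let ?\<beta> = "\<alpha> + 1 / 2"
  let ?B = "ball_law ?K (\<alpha> + 1)"
  have a: "\<alpha> + 1 > 0" using Suc.prems by simp
  have \<nu>: "(?\<nu> - real n) / 2 = \<alpha> + 1" by simp
  have \<nu>': "real n + 2 * ?\<beta> + 1 = ?\<nu>" by simp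
  have f: "f \<in> borel_measurable (Pi\<^sub>M (upper_idx (Suc n)) (\<lambda>_. borel))" by (rule Suc.prems)
  note [measurable] = f
  define F where "F x = f x * ennreal (pd_weight (Suc n) \<alpha> x)" for x
  have [measurable]: "F \<in> borel_measurable (Pi\<^sub>M (upper_idx (Suc n)) (\<lambda>_. borel))" unfolding F_def by measurable
  have F': "F \<in> borel_measurable (Pi\<^sub>M (?U \<union> ?K) (\<lambda>_. lborel))"
    unfolding upper_idx_Suc[symmetric] by measurable
  define g where "g x = (\<integral>\<^sup>+r. F (merge ?U ?K (x, r)) \<partial>Pi\<^sub>M ?K (\<lambda>_. lborel))" for x
  interpret K: sigma_finite_measure "Pi\<^sub>M ?K (\<lambda>_. lborel :: real measure)" by (rule sigma_finite) simp
  have [measurable]: "g \<in> borel_measurable (Pi\<^sub>M ?U (\<lambda>_. borel))"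
    unfolding g_def by measurable
  \<comment> \<open>The induction hypothesis expects the weight with exponent
    \<open>?\<beta>\<close> as a factor, so it is split off from \<open>g\<close>. Where the leading
    block is not definite, \<open>g\<close> vanishes.\<close>
  define g' where "g' x = g x * ennreal (Determinant.det (mat_of_offdiag n x) powr - ?\<beta>)" for x
  have g': "g' \<in> borel_measurable (Pi\<^sub>M ?U (\<lambda>_. borel))" unfolding g'_def by measurable
  have gg': "g x = g' x * ennreal (pd_weight n ?\<beta> x)" for x
  proof (cases "posdef n (corr_fun x)")
    case True
    then have d: "Determinant.det (mat_of_offdiag n x) \<noteq> 0" by (simp add: posdef_corr_fun_iff)
    then have "Determinant.det (mat_of_offdiag n x) powr - ?\<beta> * Determinant.det (mat_of_offdiag n x) powr ?\<beta> = 1"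
      by (simp add: powr_add[symmetric])
    then show ?thesis using True unfolding g'_def pd_weight_posdef
      by (simp add: mult.assoc ennreal_mult'[symmetric])
  next
    case False
    have "F (merge ?U ?K (x, r)) = 0" for r
    proof -
      have "posdef n (corr_fun (merge ?U ?K (x, r))) = posdef n (corr_fun x)"
        by (intro posdef_cong corr_fun_cong[of n]) (auto simp: merge_def)
      then show ?thesis using False posdef_Suc_D unfolding F_def pd_weight_posdef by auto
    qed
    then have "g x = 0" unfolding g_def by simp
    then show ?thesis by (simp add: g'_def)
  qed
  have key: "g' (chol_map n w) = ennreal (ball_norm ?K (\<alpha> + 1)) * (\<integral>\<^sup>+v. f (chol_map (Suc n) (merge ?U ?K (w, v))) \<partial>?B)"
    if w: "w \<in> space (Pi\<^sub>M ?U (\<lambda>_. borel))" and good: "\<forall>j<n. sqn (colidx j) w < 1" for w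
  proof -
    define d where "d = (\<Prod>j<n. 1 - sqn (colidx j) w)"
    have d: "d > 0" unfolding d_def using good by (intro prod_pos) auto
    have sq: "(\<Prod>i<n. chol w i i) = d powr (1 / 2)"
    proof -
      have "(\<Prod>i<n. chol w i i) = (\<Prod>i<n. sqrt (1 - sqn (colidx i) w))" by (simp add: chol_def)
      also have "\<dots> = sqrt d" unfolding d_def by (induction n) (auto simp: real_sqrt_mult)
      finally show ?thesis using d by (simp add: powr_half_sqrt)
    qed
    have dd: "Determinant.det (mat_of_offdiag n (chol_map n w)) = d"
    proof -
      have "mat_of_offdiag n (chol_map n w) = mat_of_offdiag n (chol_prod w)"
        unfolding mat_of_offdiag_corr_fun by (intro cong_mat refl) (auto intro!: corr_fun_cong[of n] simp: chol_map_def)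
      then show ?thesis using det_chol[of n w] good by (simp add: d_def less_imp_le)
    qed
    have T: "chol_map n w \<in> space (Pi\<^sub>M ?U (\<lambda>_. borel))"
      using measurable_space[OF measurable_chol_map w] .
    have mF: "(\<lambda>r. F (merge ?U ?K (chol_map n w, r))) \<in> borel_measurable (Pi\<^sub>M (column n n) (\<lambda>_. borel))"
      using T unfolding colidx_def[symmetric] by measurable
    have mf: "(\<lambda>v. f (chol_map (Suc n) (merge ?U ?K (w, v)))) \<in> borel_measurable (Pi\<^sub>M ?K (\<lambda>_. borel))"
      using w by measurable
    have "g (chol_map n w) = ennreal (d powr (1 / 2)) * (\<integral>\<^sup>+v. F (merge ?U ?K (chol_map n w, chol_col w n v)) \<partial>Pi\<^sub>M ?K (\<lambda>_. lborel))"
      unfolding g_def tri_chol_col colidx_def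
      using nn_integral_triangular[of n "chol w", OF _ mF] good sq
      by (simp add: chol_def[of _ _ _] colidx_def)
    also have "(\<integral>\<^sup>+v. F (merge ?U ?K (chol_map n w, chol_col w n v)) \<partial>Pi\<^sub>M ?K (\<lambda>_. lborel)) =
       (\<integral>\<^sup>+v. ennreal (d powr \<alpha>) * (ennreal (ball_weight (\<alpha> + 1) (sqn ?K v)) * f (chol_map (Suc n) (merge ?U ?K (w, v)))) \<partial>Pi\<^sub>M ?K (\<lambda>_. lborel))"
      unfolding F_def using pd_weight_merge[of n w \<alpha>] good
      by (intro nn_integral_cong) (simp add: merge_chol_map[symmetric] d_def[symmetric] ennreal_mult' mult_ac)
    also have "\<dots> = ennreal (d powr \<alpha>) * (ennreal (ball_norm ?K (\<alpha> + 1)) * (\<integral>\<^sup>+v. f (chol_map (Suc n) (merge ?U ?K (w, v))) \<partial>?B))"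
      unfolding nn_integral_ball_law[OF finite_colidx a mf]
      by (rule nn_integral_cmult) (use mf in measurable)
    finally have "g' (chol_map n w) = ennreal (d powr (1 / 2)) * ennreal (d powr \<alpha>) * ennreal (d powr - ?\<beta>) * (ennreal (ball_norm ?K (\<alpha> + 1)) * (\<integral>\<^sup>+v. f (chol_map (Suc n) (merge ?U ?K (w, v))) \<partial>?B))"
      unfolding g'_def dd by (simp only: mult_ac)
    \<comment> \<open>The exponents 1/2 from the Jacobian, \<open>\<alpha>\<close> from the weight
      and \<open>- ?\<beta>\<close> from the factor split off add up to 0.\<close>
    also have "ennreal (d powr (1 / 2)) * ennreal (d powr \<alpha>) * ennreal (d powr - ?\<beta>) = 1"
      using d by (simp add: ennreal_mult'[symmetric] powr_add[symmetric])
    finally show ?thesis by simp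
  qed
  interpret A: prob_space "chol_law ?\<nu> n" using Suc.prems by (intro prob_space_chol_law) simp
  interpret Bp: prob_space ?B using a by (intro prob_space_ball_law) auto
  interpret pair_prob_space "chol_law ?\<nu> n" ?B ..
  have "(\<integral>\<^sup>+x. F x \<partial>Pi\<^sub>M (upper_idx (Suc n)) (\<lambda>_. lborel)) = (\<integral>\<^sup>+x. g x \<partial>Pi\<^sub>M ?U (\<lambda>_. lborel))"
    unfolding upper_idx_Suc(1) g_def by (rule product_nn_integral_fold[OF upper_idx_Suc(2) _ _ F']) auto
  also have "\<dots> = ennreal (lkj_norm n ?\<beta>) * (\<integral>\<^sup>+w. g' (chol_map n w) \<partial>chol_law ?\<nu> n)"
    unfolding gg' using Suc.IH[OF _ g', of ?\<beta>] Suc.prems(1) unfolding \<nu>' by simp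
  also have "(\<integral>\<^sup>+w. g' (chol_map n w) \<partial>chol_law ?\<nu> n) =
     (\<integral>\<^sup>+w. ennreal (ball_norm ?K (\<alpha> + 1)) * (\<integral>\<^sup>+v. f (chol_map (Suc n) (merge ?U ?K (w, v))) \<partial>?B) \<partial>chol_law ?\<nu> n)"
  proof (rule nn_integral_cong_AE)
    have "AE w in chol_law ?\<nu> n. \<forall>j<n. sqn (colidx j) w < 1"
      using Suc.prems by (intro AE_chol_law) simp
    moreover have "AE w in chol_law ?\<nu> n. w \<in> space (Pi\<^sub>M ?U (\<lambda>_. borel))"
      using AE_space[of "chol_law ?\<nu> n"] sets_eq_imp_space_eq[OF sets_chol_law] by simp
    ultimately show "AE w in chol_law ?\<nu> n. g' (chol_map n w) = ennreal (ball_norm ?K (\<alpha> + 1)) * (\<integral>\<^sup>+v. f (chol_map (Suc n) (merge ?U ?K (w, v))) \<partial>?B)"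
      by eventually_elim (rule key)
  qed
  also have "\<dots> = ennreal (ball_norm ?K (\<alpha> + 1)) * (\<integral>\<^sup>+w. \<integral>\<^sup>+v. f (chol_map (Suc n) (merge ?U ?K (w, v))) \<partial>?B \<partial>chol_law ?\<nu> n)"
    by (rule nn_integral_cmult) measurable
  also have "(\<integral>\<^sup>+w. \<integral>\<^sup>+v. f (chol_map (Suc n) (merge ?U ?K (w, v))) \<partial>?B \<partial>chol_law ?\<nu> n) =
     (\<integral>\<^sup>+z. f (chol_map (Suc n) (merge ?U ?K z)) \<partial>(chol_law ?\<nu> n \<Otimes>\<^sub>M ?B))"
    by (subst Bp.nn_integral_fst) auto
  also have "\<dots> = (\<integral>\<^sup>+w. f (chol_map (Suc n) w) \<partial>chol_law ?\<nu> (Suc n))"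
    unfolding chol_law.simps \<nu> by (subst nn_integral_distr) auto
  finally show ?case
    unfolding F_def using lkj_norm_pos[of ?\<beta> n] Suc.prems
    by (simp add: ennreal_mult' mult.assoc)
qed

definition corr_law :: "real \<Rightarrow> nat \<Rightarrow> (nat \<times> nat \<Rightarrow> real) measure" where
  "corr_law \<nu> n = distr (chol_law \<nu> n) (Pi\<^sub>M (upper_idx n) (\<lambda>_. borel)) (chol_map n)"

lemma sets_corr_law [measurable_cong, simp]: "sets (corr_law \<nu> n) = sets (Pi\<^sub>M (upper_idx n) (\<lambda>_. borel))"
  by (simp add: corr_law_def)

lemma measurable_chol_map_law: "chol_map n \<in> measurable (chol_law \<nu> n) (Pi\<^sub>M (upper_idx n) (\<lambda>_. borel))"
  by measurable

lemma prob_space_corr_law: "\<nu> > real n - 1 \<Longrightarrow> prob_space (corr_law \<nu> n)"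
  unfolding corr_law_def by (intro prob_space.prob_space_distr prob_space_chol_law measurable_chol_map_law)

lemma nn_integral_corr_law:
  assumes \<alpha>: "\<alpha> > -1" and f[measurable]: "f \<in> borel_measurable (Pi\<^sub>M (upper_idx n) (\<lambda>_. borel))"
  shows "(\<integral>\<^sup>+x. f x * ennreal (pd_weight n \<alpha> x) \<partial>Pi\<^sub>M (upper_idx n) (\<lambda>_. lborel)) =
    ennreal (lkj_norm n \<alpha>) * (\<integral>\<^sup>+x. f x \<partial>corr_law (n + 2 * \<alpha> + 1) n)"
  unfolding nn_integral_chol[OF assms] corr_law_def by (subst nn_integral_distr) auto

lemma corr_fun_chol_map: "i < n \<Longrightarrow> j < n \<Longrightarrow> corr_fun (chol_map n w) i j = corr_fun (chol_prod w) i j"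
  by (rule corr_fun_cong[of n]) (auto simp: chol_map_def)

lemma psd_chol_map:
  assumes "\<forall>j<n. sqn (colidx j) w < 1" shows "psd_fun n (corr_fun (chol_map n w))"
proof -
  have "posdef n (corr_fun (chol_prod w))" using assms by (intro posdef_chol) auto
  then have "psd_fun n (corr_fun (chol_prod w))" by (simp add: posdef_corr_fun_iff)
  then show ?thesis using psd_fun_cong[of n "corr_fun (chol_map n w)" "corr_fun (chol_prod w)"] corr_fun_chol_map by blast
qed

lemma AE_corr_law_psd: 
  assumes "\<nu> > real n - 1" shows "AE x in corr_law \<nu> n. psd_fun n (corr_fun x)"
  unfolding corr_law_def
proof (subst AE_distr_iff[OF measurable_chol_map_law])
  show "{x \<in> space (Pi\<^sub>M (upper_idx n) (\<lambda>_. borel)). psd_fun n (corr_fun x)} \<in> sets (Pi\<^sub>M (upper_idx n) (\<lambda>_. borel))"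
    using measurable_psd_fun[of n] by (simp add: pred_def)
  show "AE x in chol_law \<nu> n. psd_fun n (corr_fun (chol_map n x))"
    using AE_chol_law[OF assms] by eventually_elim (rule psd_chol_map)
qed

subsection \<open>From the LKJ distribution to Cholesky coordinates\<close>

lemma offdiag_mat_of_offdiag: "x \<in> space (Pi\<^sub>M (upper_idx n) (\<lambda>_. borel)) \<Longrightarrow> offdiag n (mat_of_offdiag n x) = x"
  by (auto simp: offdiag_def mat_of_offdiag_def upper_idx_def space_PiM PiE_def extensional_def fun_eq_iff)

lemma space_corr_lborel: "space (corr_lborel n) = corr_mats n"
  by (simp add: corr_lborel_def)

lemma sets_corr_lborel: "sets (corr_lborel n) = sets (vimage_algebra (corr_mats n) (offdiag n) (Pi\<^sub>M (upper_idx n) (\<lambda>_. borel)))"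
  unfolding corr_lborel_def sets_distr by (intro sets_vimage_algebra_cong) simp

lemma offdiag_space: "offdiag n C \<in> space (Pi\<^sub>M (upper_idx n) (\<lambda>_. borel :: real measure))"
  by (auto simp: offdiag_def space_PiM)

lemma measurable_offdiag: "offdiag n \<in> measurable (corr_lborel n) (Pi\<^sub>M (upper_idx n) (\<lambda>_. borel))"
proof -
  have "offdiag n \<in> measurable (vimage_algebra (corr_mats n) (offdiag n) (Pi\<^sub>M (upper_idx n) (\<lambda>_. borel))) (Pi\<^sub>M (upper_idx n) (\<lambda>_. borel))"
    by (intro measurable_vimage_algebra1) (auto simp: offdiag_space)
  then show ?thesis by (simp cong: measurable_cong_sets add: sets_corr_lborel)
qed

text \<open>It suffices that the integrands agree at coordinates of correlation matrices, because
  \<open>corr_lborel\<close> is carried by these; on them \<open>offdiag\<close> inverts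
  \<open>mat_of_offdiag\<close>.\<close>

lemma nn_integral_corr_lborel:
  assumes f: "f \<in> borel_measurable (Pi\<^sub>M (upper_idx n) (\<lambda>_. borel))"
    and h: "h \<in> borel_measurable (corr_lborel n)"
    and hf: "\<And>x. x \<in> space (Pi\<^sub>M (upper_idx n) (\<lambda>_. borel)) \<Longrightarrow> psd_fun n (corr_fun x) \<Longrightarrow> h (mat_of_offdiag n x) = f x"
  shows "(\<integral>\<^sup>+C. h C \<partial>corr_lborel n) = (\<integral>\<^sup>+x. f x * indicator {x. psd_fun n (corr_fun x)} x \<partial>Pi\<^sub>M (upper_idx n) (\<lambda>_. lborel))"
proof -
  let ?P = "Pi\<^sub>M (upper_idx n) (\<lambda>_. lborel :: real measure)"
  let ?\<Omega> = "{x. mat_of_offdiag n x \<in> corr_mats n}"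
  let ?N = "vimage_algebra (corr_mats n) (offdiag n) ?P"
  have sp: "space ?P = space (Pi\<^sub>M (upper_idx n) (\<lambda>_. borel :: real measure))" by (rule sets_eq_imp_space_eq) simp
  have \<Omega>: "?\<Omega> \<inter> space ?P \<in> sets ?P"
    using measurable_psd_fun[of n] by (simp add: pred_def corr_mats_iff sp Int_def conj_commute)
  have m: "mat_of_offdiag n \<in> measurable (restrict_space ?P ?\<Omega>) ?N"
  proof (rule measurable_vimage_algebra2)
    show "mat_of_offdiag n \<in> space (restrict_space ?P ?\<Omega>) \<rightarrow> corr_mats n" by (auto simp: space_restrict_space)
    have "(\<lambda>x. x) \<in> measurable (restrict_space ?P ?\<Omega>) ?P" by (rule measurable_restrict_space1) simp
    then show "(\<lambda>x. offdiag n (mat_of_offdiag n x)) \<in> measurable (restrict_space ?P ?\<Omega>) ?P"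
      by (subst measurable_cong[of _ _ "\<lambda>x. x"]) (auto simp: space_restrict_space sp offdiag_mat_of_offdiag)
  qed
  have "(\<integral>\<^sup>+C. h C \<partial>corr_lborel n) = (\<integral>\<^sup>+x. h (mat_of_offdiag n x) \<partial>restrict_space ?P ?\<Omega>)"
    unfolding corr_lborel_def by (rule nn_integral_distr[OF m h[unfolded corr_lborel_def]])
  also have "\<dots> = (\<integral>\<^sup>+x. h (mat_of_offdiag n x) * indicator ?\<Omega> x \<partial>?P)"
    by (rule nn_integral_restrict_space[OF \<Omega>])
  also have "\<dots> = (\<integral>\<^sup>+x. f x * indicator {x. psd_fun n (corr_fun x)} x \<partial>?P)"
    by (intro nn_integral_cong) (auto simp: indicator_def corr_mats_iff sp hf)
  finally show ?thesis .
qed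

lemma mat_of_offdiag_offdiag:
  assumes "C \<in> corr_mats n" shows "mat_of_offdiag n (offdiag n C) = C"
proof (intro eq_matI)
  have C: "C \<in> carrier_mat n n" "transpose_mat C = C" "\<forall>i<n. C $$ (i, i) = 1" using assms by (auto simp: corr_mats_def)
  fix i j assume "i < dim_row C" "j < dim_col C"
  then have ij: "i < n" "j < n" using C by auto
  have "C $$ (i, j) = C $$ (j, i)" using arg_cong[OF C(2), of "\<lambda>M. M $$ (i, j)"] ij C(1) by simp
  then show "mat_of_offdiag n (offdiag n C) $$ (i, j) = C $$ (i, j)"
    using ij C(3) by (auto simp: mat_of_offdiag_def offdiag_def upper_idx_def)
qed (use assms in \<open>auto simp: mat_of_offdiag_def corr_mats_def\<close>)

lemma entry_corr_fun:
  assumes "C \<in> corr_mats n" "i < n" "j < n" shows "C $$ (i, j) = corr_fun (offdiag n C) i j"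
  using assms(2,3) by (subst mat_of_offdiag_offdiag[OF assms(1), symmetric]) (simp add: mat_of_offdiag_corr_fun)

lemma measurable_det_corr: "(\<lambda>C. Determinant.det C) \<in> borel_measurable (corr_lborel n)"
proof -
  have "(\<lambda>C. Determinant.det (mat_of_offdiag n (offdiag n C))) \<in> borel_measurable (corr_lborel n)"
    by (rule measurable_compose[OF measurable_offdiag measurable_det])
  then show ?thesis
    by (subst (asm) measurable_cong[of _ _ Determinant.det]) (auto simp: space_corr_lborel mat_of_offdiag_offdiag)
qed

lemma sets_lkj: "sets (lkj n \<eta>) = sets (corr_lborel n)" by (simp add: lkj_def)

lemma space_lkj: "space (lkj n \<eta>) = corr_mats n" by (simp add: lkj_def space_corr_lborel)

text \<open>Here \<open>\<alpha>\<close> is \<open>\<eta> - 1\<close>. Working with the coordinates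
  loses nothing: \<open>offdiag\<close> determines a correlation matrix and generates the sigma
  algebra of \<open>lkj\<close>.\<close>

lemma distr_offdiag_lkj:
  assumes \<eta>: "\<eta> > 0"
  shows "distr (lkj n \<eta>) (Pi\<^sub>M (upper_idx n) (\<lambda>_. borel)) (offdiag n) = corr_law (n + 2 * \<eta> - 1) n"
proof (rule measure_eqI)
  show "sets (distr (lkj n \<eta>) (Pi\<^sub>M (upper_idx n) (\<lambda>_. borel)) (offdiag n)) = sets (corr_law (n + 2 * \<eta> - 1) n)" by simp
  let ?P = "Pi\<^sub>M (upper_idx n) (\<lambda>_. lborel :: real measure)"
  let ?d = "\<lambda>C. ennreal (Determinant.det C powr (\<eta> - 1))"
  have \<alpha>: "\<eta> - 1 > -1" and \<nu>: "real n + 2 * (\<eta> - 1) + 1 = n + 2 * \<eta> - 1" using \<eta> by auto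
  interpret prob_space "corr_law (n + 2 * \<eta> - 1) n" using \<eta> by (intro prob_space_corr_law) auto
  have md[measurable]: "?d \<in> borel_measurable (corr_lborel n)" using measurable_det_corr by measurable
  have w: "ennreal (Determinant.det (mat_of_offdiag n x) powr (\<eta> - 1)) * indicator {x. psd_fun n (corr_fun x)} x = ennreal (pd_weight n (\<eta> - 1) x)" for x
    by (simp add: pd_weight_def indicator_def)
  \<comment> \<open>The integral of the constant 1 in Cholesky coordinates identifies the
    normalizing integral in \<open>lkj\<close>; in particular it is finite and positive.\<close>
  have Z: "(\<integral>\<^sup>+B. ?d B \<partial>corr_lborel n) = ennreal (lkj_norm n (\<eta> - 1))"
  proof -
    have "(\<integral>\<^sup>+B. ?d B \<partial>corr_lborel n) = (\<integral>\<^sup>+x. ennreal (Determinant.det (mat_of_offdiag n x) powr (\<eta> - 1)) * indicator {x. psd_fun n (corr_fun x)} x \<partial>?P)"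
      by (rule nn_integral_corr_lborel) (use md in measurable)
    also have "\<dots> = (\<integral>\<^sup>+x. 1 * ennreal (pd_weight n (\<eta> - 1) x) \<partial>?P)" unfolding w by simp
    also have "\<dots> = ennreal (lkj_norm n (\<eta> - 1))"
      by (subst nn_integral_corr_law[OF \<alpha>]) (auto simp: \<nu> emeasure_space_1)
    finally show ?thesis .
  qed
  have Zpos: "lkj_norm n (\<eta> - 1) > 0" using lkj_norm_pos[OF \<alpha>] .
  fix A assume "A \<in> sets (distr (lkj n \<eta>) (Pi\<^sub>M (upper_idx n) (\<lambda>_. borel)) (offdiag n))"
  then have A[measurable]: "A \<in> sets (Pi\<^sub>M (upper_idx n) (\<lambda>_. borel))" by simp
  note [measurable] = measurable_offdiag
  have mo: "offdiag n \<in> measurable (lkj n \<eta>) (Pi\<^sub>M (upper_idx n) (\<lambda>_. borel))"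
    using measurable_offdiag by (simp cong: measurable_cong_sets add: sets_lkj)
  have mA: "(\<lambda>C. indicator A (offdiag n C) :: ennreal) \<in> borel_measurable (corr_lborel n)" by measurable
  have "emeasure (distr (lkj n \<eta>) (Pi\<^sub>M (upper_idx n) (\<lambda>_. borel)) (offdiag n)) A = (\<integral>\<^sup>+C. indicator A (offdiag n C) \<partial>lkj n \<eta>)"
    using mo by (subst nn_integral_indicator[symmetric], simp, subst nn_integral_distr) auto
  also have "\<dots> = (\<integral>\<^sup>+C. ?d C / ennreal (lkj_norm n (\<eta> - 1)) * indicator A (offdiag n C) \<partial>corr_lborel n)"
    unfolding lkj_def Z by (rule nn_integral_density) (use mA in measurable)
  also have "\<dots> = (\<integral>\<^sup>+x. (ennreal (Determinant.det (mat_of_offdiag n x) powr (\<eta> - 1)) / ennreal (lkj_norm n (\<eta> - 1)) * indicator A x) * indicator {x. psd_fun n (corr_fun x)} x \<partial>?P)"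
    by (rule nn_integral_corr_lborel) (use mA in \<open>measurable, simp add: offdiag_mat_of_offdiag\<close>)
  also have "\<dots> = (\<integral>\<^sup>+x. ennreal (1 / lkj_norm n (\<eta> - 1)) * (indicator A x * ennreal (pd_weight n (\<eta> - 1) x)) \<partial>?P)"
    unfolding w[symmetric] using Zpos
    by (intro nn_integral_cong) (simp add: divide_ennreal ennreal_mult''[symmetric] indicator_def divide_inverse mult_ac)
  also have "\<dots> = ennreal (1 / lkj_norm n (\<eta> - 1)) * (ennreal (lkj_norm n (\<eta> - 1)) * emeasure (corr_law (n + 2 * \<eta> - 1) n) A)"
  proof -
    have "(\<integral>\<^sup>+x. ennreal (1 / lkj_norm n (\<eta> - 1)) * (indicator A x * ennreal (pd_weight n (\<eta> - 1) x)) \<partial>?P) =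
      ennreal (1 / lkj_norm n (\<eta> - 1)) * (\<integral>\<^sup>+x. indicator A x * ennreal (pd_weight n (\<eta> - 1) x) \<partial>?P)"
      by (rule nn_integral_cmult) measurable
    also have "(\<integral>\<^sup>+x. indicator A x * ennreal (pd_weight n (\<eta> - 1) x) \<partial>?P) =
      ennreal (lkj_norm n (\<eta> - 1)) * (\<integral>\<^sup>+x. indicator A x \<partial>corr_law (n + 2 * \<eta> - 1) n)"
      using nn_integral_corr_law[OF \<alpha> borel_measurable_indicator[OF A]] unfolding \<nu> .
    finally show ?thesis using A by simp
  qed
  also have "\<dots> = emeasure (corr_law (n + 2 * \<eta> - 1) n) A"
    using Zpos by (simp add: mult.assoc[symmetric] ennreal_mult'[symmetric])
  finally show "emeasure (distr (lkj n \<eta>) (Pi\<^sub>M (upper_idx n) (\<lambda>_. borel)) (offdiag n)) A = emeasure (corr_law (n + 2 * \<eta> - 1) n) A" .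
qed

subsection \<open>Exchangeability\<close>

text \<open>It is enough to compare the two measures on boxes, where relabelling only reorders the
  factors of a product.\<close>

lemma distr_PiM_lborel_reindex:
  fixes \<tau> :: "'i \<Rightarrow> 'i"
  assumes I: "finite I" and \<tau>: "bij_betw \<tau> I I"
  shows "distr (Pi\<^sub>M I (\<lambda>_. lborel)) (Pi\<^sub>M I (\<lambda>_. lborel)) (\<lambda>x. \<lambda>i\<in>I. x (\<tau> i)) = Pi\<^sub>M I (\<lambda>_. lborel :: real measure)"
proof -
  interpret product_sigma_finite "\<lambda>_::'i. lborel :: real measure" by standard
  let ?P = "Pi\<^sub>M I (\<lambda>_. lborel :: real measure)" and ?t = "\<lambda>x. \<lambda>i\<in>I. x (\<tau> i)"
  have in_I: "\<tau> i \<in> I" if "i \<in> I" for i using \<tau> that by (auto simp: bij_betw_def)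
  have t: "?t \<in> measurable ?P ?P"
    by (rule measurable_restrict) (use in_I in auto)
  show ?thesis
  proof (rule PiM_eqI[OF I])
    fix A :: "'i \<Rightarrow> real set" assume A: "\<And>i. i \<in> I \<Longrightarrow> A i \<in> sets lborel"
    define \<sigma> where "\<sigma> = the_inv_into I \<tau>"
    have \<sigma>: "\<sigma> (\<tau> i) = i" "\<sigma> i \<in> I" "\<tau> (\<sigma> i) = i" if "i \<in> I" for i
      using \<tau> that by (auto simp: \<sigma>_def bij_betw_def the_inv_into_f_f f_the_inv_into_f the_inv_into_into)
    have "emeasure (distr ?P ?P ?t) (Pi\<^sub>E I A) = emeasure ?P (?t -` Pi\<^sub>E I A \<inter> space ?P)"
      using A I by (intro emeasure_distr t sets_PiM_I_finite) auto
    also have "?t -` Pi\<^sub>E I A \<inter> space ?P = Pi\<^sub>E I (\<lambda>i. A (\<sigma> i))"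
    proof (intro equalityI subsetI)
      fix x assume x: "x \<in> ?t -` Pi\<^sub>E I A \<inter> space ?P"
      have "x i \<in> A (\<sigma> i)" if i: "i \<in> I" for i
      proof -
        have "?t x (\<sigma> i) \<in> A (\<sigma> i)" using x \<sigma>(2)[OF i] by (auto simp: PiE_iff)
        then show ?thesis using \<sigma>[OF i] by simp
      qed
      then show "x \<in> Pi\<^sub>E I (\<lambda>i. A (\<sigma> i))" using x by (auto simp: space_PiM PiE_iff)
    next
      fix x assume x: "x \<in> Pi\<^sub>E I (\<lambda>i. A (\<sigma> i))"
      then show "x \<in> ?t -` Pi\<^sub>E I A \<inter> space ?P"
        using in_I \<sigma>(1) by (fastforce simp: space_PiM PiE_iff)
    qed
    also have "emeasure ?P (Pi\<^sub>E I (\<lambda>i. A (\<sigma> i))) = (\<Prod>i\<in>I. emeasure lborel (A (\<sigma> i)))"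
      using A \<sigma>(2) I by (intro emeasure_PiM) auto
    also have "\<dots> = (\<Prod>i\<in>I. emeasure lborel (A i))"
      by (rule prod.reindex_bij_witness[of _ \<tau> \<sigma>]) (use \<sigma> in_I in auto)
    finally show "emeasure (distr ?P ?P ?t) (Pi\<^sub>E I A) = (\<Prod>i\<in>I. emeasure lborel (A i))" .
  qed simp
qed

definition perm_offdiag :: "nat \<Rightarrow> (nat \<Rightarrow> nat) \<Rightarrow> (nat \<times> nat \<Rightarrow> real) \<Rightarrow> nat \<times> nat \<Rightarrow> real" where
  "perm_offdiag n p x = (\<lambda>(i, j)\<in>upper_idx n. corr_fun x (p i) (p j))"

context
  fixes n :: nat and p :: "nat \<Rightarrow> nat"
  assumes p: "p permutes {..<n}"
begin

lemma p_less: "p i < n \<longleftrightarrow> i < n" using permutes_in_image[OF p, of i] by simp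

lemma p_inj: "p i = p j \<longleftrightarrow> i = j" using permutes_inj[OF p] by (auto simp: inj_eq)

lemma corr_fun_perm: "i < n \<Longrightarrow> j < n \<Longrightarrow> corr_fun (perm_offdiag n p x) i j = corr_fun x (p i) (p j)"
  by (auto simp: corr_fun_def[of "perm_offdiag n p x"] perm_offdiag_def upper_idx_def)
     (auto simp: corr_fun_def)

text \<open>Coordinates exist for increasing pairs only, so the permuted pair has to be sorted. In
  this form the map is a relabelling of coordinates and thus preserves Lebesgue measure.\<close>

lemma perm_offdiag_reindex:
  "perm_offdiag n p x = (\<lambda>q\<in>upper_idx n. x (min (p (fst q)) (p (snd q)), max (p (fst q)) (p (snd q))))"
  by (auto simp: perm_offdiag_def restrict_def fun_eq_iff corr_fun_def p_inj upper_idx_def min_def max_def)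

lemma bij_perm_idx: "bij_betw (\<lambda>q. (min (p (fst q)) (p (snd q)), max (p (fst q)) (p (snd q)))) (upper_idx n) (upper_idx n)"
proof (rule bij_betw_byWitness[where f' = "\<lambda>q. (min (Hilbert_Choice.inv p (fst q)) (Hilbert_Choice.inv p (snd q)), max (Hilbert_Choice.inv p (fst q)) (Hilbert_Choice.inv p (snd q)))"])
  let ?q = "Hilbert_Choice.inv p"
  have q1: "?q (p i) = i" "p (?q i) = i" for i using permutes_inverses[OF p] by auto
  have q2: "?q i < n \<longleftrightarrow> i < n" for i using permutes_in_image[OF permutes_inv[OF p], of i] by simp
  have q3: "?q i = ?q j \<longleftrightarrow> i = j" for i j using permutes_inj[OF permutes_inv[OF p]] by (simp add: inj_eq)
  show "\<forall>a\<in>upper_idx n. (min (?q (fst (min (p (fst a)) (p (snd a)), max (p (fst a)) (p (snd a))))) (?q (snd (min (p (fst a)) (p (snd a)), max (p (fst a)) (p (snd a))))),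
     max (?q (fst (min (p (fst a)) (p (snd a)), max (p (fst a)) (p (snd a))))) (?q (snd (min (p (fst a)) (p (snd a)), max (p (fst a)) (p (snd a)))))) = a"
    by (auto simp: upper_idx_def min_def max_def q1)
  show "\<forall>a\<in>upper_idx n. (min (p (fst (min (?q (fst a)) (?q (snd a)), max (?q (fst a)) (?q (snd a))))) (p (snd (min (?q (fst a)) (?q (snd a)), max (?q (fst a)) (?q (snd a))))),
     max (p (fst (min (?q (fst a)) (?q (snd a)), max (?q (fst a)) (?q (snd a))))) (p (snd (min (?q (fst a)) (?q (snd a)), max (?q (fst a)) (?q (snd a)))))) = a"
    by (auto simp: upper_idx_def min_def max_def q1)
  show "(\<lambda>q. (min (p (fst q)) (p (snd q)), max (p (fst q)) (p (snd q)))) ` upper_idx n \<subseteq> upper_idx n"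
  proof (rule image_subsetI)
    fix a assume "a \<in> upper_idx n"
    then obtain i j where "a = (i, j)" "i < j" "j < n" by (auto simp: upper_idx_def)
    then show "(min (p (fst a)) (p (snd a)), max (p (fst a)) (p (snd a))) \<in> upper_idx n"
      using p_inj[of i j] p_less[of i] p_less[of j] by (auto simp: upper_idx_def min_def max_def)
  qed
  show "(\<lambda>q. (min (?q (fst q)) (?q (snd q)), max (?q (fst q)) (?q (snd q)))) ` upper_idx n \<subseteq> upper_idx n"
  proof (rule image_subsetI)
    fix a assume "a \<in> upper_idx n"
    then obtain i j where "a = (i, j)" "i < j" "j < n" by (auto simp: upper_idx_def)
    then show "(min (?q (fst a)) (?q (snd a)), max (?q (fst a)) (?q (snd a))) \<in> upper_idx n"
      using q3[of i j] q2[of i] q2[of j] by (auto simp: upper_idx_def min_def max_def)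
  qed
qed

lemma psd_fun_perm_iff: "psd_fun n (\<lambda>i j. c (p i) (p j)) \<longleftrightarrow> psd_fun n c"
proof
  assume "psd_fun n (\<lambda>i j. c (p i) (p j))"
  from psd_fun_permute[OF permutes_inv[OF p] this] show "psd_fun n c"
    using permutes_inverses(1)[OF p] by simp
qed (rule psd_fun_permute[OF p])

text \<open>Permuting the rows and permuting the columns each contribute the sign of
  \<open>p\<close>, and the two signs cancel.\<close>

lemma det_perm: "Determinant.det (Matrix.mat n n (\<lambda>(i, j). c (p i) (p j))) = Determinant.det (Matrix.mat n n (\<lambda>(i, j). c i j :: real))"
proof -
  have p': "p permutes {0..<n}" using p by (simp add: atLeast0LessThan)
  let ?A = "Matrix.mat n n (\<lambda>(i, j). c i j)"
  let ?B = "Matrix.mat n n (\<lambda>(i, j). ?A $$ (p i, j))"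
  let ?B' = "Matrix.mat n n (\<lambda>(i, j). transpose_mat ?B $$ (p i, j))"
  have s: "signof p * signof p = (1 :: real)" by (auto simp: sign_def)
  have "Matrix.mat n n (\<lambda>(i, j). c (p i) (p j)) = transpose_mat ?B'"
    by (intro eq_matI) (auto simp: p_less)
  then have "Determinant.det (Matrix.mat n n (\<lambda>(i, j). c (p i) (p j))) = Determinant.det ?B'"
    by (simp add: det_transpose[of _ n])
  also have "\<dots> = signof p * Determinant.det (transpose_mat ?B)"
    by (rule det_permute_rows[OF _ p']) simp
  also have "Determinant.det (transpose_mat ?B) = Determinant.det ?B" by (rule det_transpose[of _ n]) simp
  also have "Determinant.det ?B = signof p * Determinant.det ?A" by (rule det_permute_rows[OF _ p']) simp
  finally show ?thesis using s by (simp add: mult.assoc[symmetric])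
qed

lemma pd_weight_perm: "pd_weight n \<alpha> (perm_offdiag n p x) = pd_weight n \<alpha> x"
proof -
  have "psd_fun n (corr_fun (perm_offdiag n p x)) \<longleftrightarrow> psd_fun n (\<lambda>i j. corr_fun x (p i) (p j))"
    by (intro psd_fun_cong corr_fun_perm)
  moreover have "mat_of_offdiag n (perm_offdiag n p x) = Matrix.mat n n (\<lambda>(i, j). corr_fun x (p i) (p j))"
    unfolding mat_of_offdiag_corr_fun by (intro cong_mat) (auto simp: corr_fun_perm)
  ultimately show ?thesis
    unfolding pd_weight_def by (simp add: psd_fun_perm_iff det_perm) (simp add: mat_of_offdiag_corr_fun)
qed

lemma measurable_perm_offdiag [measurable]:
  "perm_offdiag n p \<in> measurable (Pi\<^sub>M (upper_idx n) (\<lambda>_. borel)) (Pi\<^sub>M (upper_idx n) (\<lambda>_. borel))"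
  unfolding perm_offdiag_def
proof (rule measurable_restrict)
  fix q assume "q \<in> upper_idx n"
  then obtain i j where q: "q = (i, j)" "i < n" "j < n" by (auto simp: upper_idx_def)
  then show "(\<lambda>x. case q of (i, j) \<Rightarrow> corr_fun x (p i) (p j)) \<in> borel_measurable (Pi\<^sub>M (upper_idx n) (\<lambda>_. borel))"
    by (simp add: measurable_corr_fun p_less)
qed

text \<open>The Cholesky description depends on the order of the indices, so the invariance is
  proved for the density: both the weight and Lebesgue measure are unchanged by relabelling.\<close>

lemma nn_integral_corr_law_perm:
  assumes \<nu>: "\<nu> > real n - 1" and f[measurable]: "f \<in> borel_measurable (Pi\<^sub>M (upper_idx n) (\<lambda>_. borel))"
  shows "(\<integral>\<^sup>+x. f (perm_offdiag n p x) \<partial>corr_law \<nu> n) = (\<integral>\<^sup>+x. f x \<partial>corr_law \<nu> n)"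
proof -
  define \<alpha> where "\<alpha> = (\<nu> - n - 1) / 2"
  have \<alpha>: "\<alpha> > -1" "n + 2 * \<alpha> + 1 = \<nu>" using \<nu> by (auto simp: \<alpha>_def field_simps)
  let ?P = "Pi\<^sub>M (upper_idx n) (\<lambda>_. lborel :: real measure)"
  let ?g = "\<lambda>x. f x * ennreal (pd_weight n \<alpha> x)"
  have t: "perm_offdiag n p \<in> measurable ?P ?P" using measurable_perm_offdiag by (simp cong: measurable_cong_sets)
  have "(\<integral>\<^sup>+x. ?g (perm_offdiag n p x) \<partial>?P) = (\<integral>\<^sup>+x. ?g x \<partial>distr ?P ?P (perm_offdiag n p))"
    by (rule nn_integral_distr[OF t, symmetric]) measurable
  also have "distr ?P ?P (perm_offdiag n p) = ?P"
    unfolding perm_offdiag_reindex[abs_def] by (rule distr_PiM_lborel_reindex[OF finite_upper_idx bij_perm_idx])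
  finally have "(\<integral>\<^sup>+x. f (perm_offdiag n p x) * ennreal (pd_weight n \<alpha> x) \<partial>?P) = (\<integral>\<^sup>+x. ?g x \<partial>?P)"
    unfolding pd_weight_perm .
  then have "ennreal (lkj_norm n \<alpha>) * (\<integral>\<^sup>+x. f (perm_offdiag n p x) \<partial>corr_law \<nu> n) = ennreal (lkj_norm n \<alpha>) * (\<integral>\<^sup>+x. f x \<partial>corr_law \<nu> n)"
    by (subst (asm) nn_integral_corr_law[OF \<alpha>(1)], measurable, subst (asm) nn_integral_corr_law[OF \<alpha>(1)]) (simp_all only: \<alpha>(2), measurable)
  then show ?thesis using lkj_norm_pos[OF \<alpha>(1), of n] by (simp add: ennreal_mult_cancel_left)
qed

lemma distr_corr_law_perm:
  assumes "\<nu> > real n - 1"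
  shows "distr (corr_law \<nu> n) (Pi\<^sub>M (upper_idx n) (\<lambda>_. borel)) (perm_offdiag n p) = corr_law \<nu> n"
proof (rule measure_eqI)
  fix A assume "A \<in> sets (distr (corr_law \<nu> n) (Pi\<^sub>M (upper_idx n) (\<lambda>_. borel)) (perm_offdiag n p))"
  then have A: "A \<in> sets (Pi\<^sub>M (upper_idx n) (\<lambda>_. borel))" by simp
  have m: "perm_offdiag n p \<in> measurable (corr_law \<nu> n) (Pi\<^sub>M (upper_idx n) (\<lambda>_. borel))" by measurable
  have "emeasure (distr (corr_law \<nu> n) (Pi\<^sub>M (upper_idx n) (\<lambda>_. borel)) (perm_offdiag n p)) A = (\<integral>\<^sup>+x. indicator A (perm_offdiag n p x) \<partial>corr_law \<nu> n)"
    using m A by (subst nn_integral_indicator[symmetric], simp, subst nn_integral_distr) auto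
  also have "\<dots> = emeasure (corr_law \<nu> n) A"
    using A by (subst nn_integral_corr_law_perm[OF assms]) auto
  finally show "emeasure (distr (corr_law \<nu> n) (Pi\<^sub>M (upper_idx n) (\<lambda>_. borel)) (perm_offdiag n p)) A = emeasure (corr_law \<nu> n) A" .
qed simp

lemma integral_corr_law_perm:
  fixes f :: "(nat \<times> nat \<Rightarrow> real) \<Rightarrow> real"
  assumes "\<nu> > real n - 1" and f: "f \<in> borel_measurable (Pi\<^sub>M (upper_idx n) (\<lambda>_. borel))"
  shows "integral\<^sup>L (corr_law \<nu> n) (\<lambda>x. f (perm_offdiag n p x)) = integral\<^sup>L (corr_law \<nu> n) f"
proof -
  have "perm_offdiag n p \<in> measurable (corr_law \<nu> n) (Pi\<^sub>M (upper_idx n) (\<lambda>_. borel))" by measurable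
  from integral_distr[OF this f] show ?thesis unfolding distr_corr_law_perm[OF assms(1)] by simp
qed

end

subsection \<open>Moments of the Frobenius norm\<close>

lemma psd_fun_abs_le:
  assumes psd: "psd_fun n c" and sym: "\<And>i j. c i j = c j i" and diag: "\<And>i. c i i = 1"
    and ij: "i < n" "j < n"
  shows "\<bar>c i j\<bar> \<le> 1"
proof (cases "i = j")
  case False
  have "0 \<le> 2 + 2 * s * c i j" if s: "s * s = 1" for s
  proof -
    \<comment> \<open>The entries are 1 at i and s at j; the signs s = 1 and s = -1 give the lower
      and the upper bound.\<close>
    define u where "u k = (if k = i then 1 else 0) + (if k = j then s else 0)" for k
    have e: "(\<Sum>k<n. u k * g k) = g i + s * g j" for g :: "nat \<Rightarrow> real"
      using ij unfolding u_def distrib_right sum.distrib by (simp add: if_distrib if_distribR sum.delta cong: if_cong)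
    have "0 \<le> (\<Sum>k<n. \<Sum>l<n. u k * c k l * u l)" using psd unfolding psd_fun_def by blast
    also have "\<dots> = (\<Sum>k<n. u k * (\<Sum>l<n. u l * c k l))" by (simp add: sum_distrib_left mult_ac)
    also have "\<dots> = (c i i + s * c i j) + s * (c j i + s * c j j)" unfolding e ..
    also have "\<dots> = 2 + 2 * s * c i j" using s by (simp add: diag sym[of j i] algebra_simps)
    finally show ?thesis .
  qed
  from this[of 1] this[of "-1"] show ?thesis by (simp add: abs_le_iff)
qed (simp add: diag)

definition offsq :: "nat \<Rightarrow> (nat \<times> nat \<Rightarrow> real) \<Rightarrow> real" where
  "offsq n x = (\<Sum>p\<in>upper_idx n. (x p)\<^sup>2)"

lemma offsq_Suc: "offsq (Suc n) x = offsq n x + (\<Sum>i<n. (x (i, n))\<^sup>2)"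
  unfolding offsq_def upper_idx_Suc(1) using upper_idx_Suc(2)
  by (subst sum.union_disjoint) (auto simp: sqn_col[symmetric] sqn_def)

lemma offsq_0 [simp]: "offsq 0 x = 0" by (simp add: offsq_def upper_idx_0)

lemma offsq_nonneg: "offsq n x \<ge> 0" unfolding offsq_def by (intro sum_nonneg) auto

lemma sum_corr_fun_sq: "(\<Sum>i<n. \<Sum>j<n. (corr_fun x i j)\<^sup>2) = n + 2 * offsq n x"
proof (induction n)
  case (Suc n)
  have a: "(\<Sum>i<n. (corr_fun x i n)\<^sup>2) = (\<Sum>i<n. (x (i, n))\<^sup>2)" by (intro sum.cong refl) (simp add: corr_fun_def)
  have b: "(\<Sum>i<n. (corr_fun x n i)\<^sup>2) = (\<Sum>i<n. (x (i, n))\<^sup>2)" by (intro sum.cong refl) (simp add: corr_fun_def)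
  have d: "corr_fun x n n = 1" by (simp add: corr_fun_def)
  show ?case by (simp add: sum.distrib Suc a b d offsq_Suc)
qed simp

lemma psd_entry_le:
  assumes "psd_fun n (corr_fun x)" "p \<in> upper_idx n" shows "\<bar>x p\<bar> \<le> 1"
proof -
  obtain i j where p: "p = (i, j)" "i < j" "j < n" using assms(2) by (auto simp: upper_idx_def)
  have "\<bar>corr_fun x i j\<bar> \<le> 1"
    by (rule psd_fun_abs_le[OF assms(1)]) (use p corr_fun_sym in \<open>auto simp: corr_fun_def\<close>)
  then show ?thesis using p by (simp add: corr_fun_def)
qed

lemma offsq_le:
  assumes "psd_fun n (corr_fun x)" shows "offsq n x \<le> card (upper_idx n)"
proof -
  have "(x p)\<^sup>2 \<le> 1" if "p \<in> upper_idx n" for p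
    using psd_entry_le[OF assms that] by (simp add: abs_square_le_1)
  then have "offsq n x \<le> (\<Sum>p\<in>upper_idx n. 1)" unfolding offsq_def by (intro sum_mono)
  then show ?thesis by simp
qed

lemma measurable_offsq [measurable]: "offsq n \<in> borel_measurable (Pi\<^sub>M (upper_idx n) (\<lambda>_. borel))"
  unfolding offsq_def by measurable

lemma integrable_corr_law:
  fixes F :: "(nat \<times> nat \<Rightarrow> real) \<Rightarrow> real"
  assumes "\<nu> > real n - 1" and F: "F \<in> borel_measurable (Pi\<^sub>M (upper_idx n) (\<lambda>_. borel))"
    and B: "\<And>x. psd_fun n (corr_fun x) \<Longrightarrow> \<bar>F x\<bar> \<le> B"
  shows "integrable (corr_law \<nu> n) F"
proof -
  interpret prob_space "corr_law \<nu> n" using assms by (intro prob_space_corr_law)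
  show ?thesis
  proof (rule integrable_const_bound[where B = B])
    show "AE x in corr_law \<nu> n. norm (F x) \<le> B"
      using AE_corr_law_psd[OF assms(1)] by eventually_elim (use B in auto)
  qed (use F in simp)
qed

lemma integral_corr_law:
  fixes F :: "(nat \<times> nat \<Rightarrow> real) \<Rightarrow> real"
  assumes "F \<in> borel_measurable (Pi\<^sub>M (upper_idx n) (\<lambda>_. borel))"
  shows "integral\<^sup>L (corr_law \<nu> n) F = (\<integral>w. F (chol_map n w) \<partial>chol_law \<nu> n)"
    and "integrable (corr_law \<nu> n) F \<longleftrightarrow> integrable (chol_law \<nu> n) (\<lambda>w. F (chol_map n w))"
  unfolding corr_law_def
  using integral_distr[OF measurable_chol_map_law assms] integrable_distr_eq[OF measurable_chol_map_law assms] by auto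

definition next_col :: "(nat \<times> nat \<Rightarrow> real) \<Rightarrow> nat \<Rightarrow> (nat \<times> nat \<Rightarrow> real) \<Rightarrow> nat \<times> nat \<Rightarrow> real" where
  "next_col w n v = merge (upper_idx n) (colidx n) (chol_map n w, chol_col w n v)"

text \<open>Conditioning on the leading block, by Fubini: \<open>w\<close> carries the leading block
  and \<open>v\<close> is the independent new row. The bound on F is what makes Fubini
  applicable.\<close>

lemma integral_corr_law_Suc:
  fixes F :: "(nat \<times> nat \<Rightarrow> real) \<Rightarrow> real"
  assumes \<nu>: "\<nu> > real n" and F[measurable]: "F \<in> borel_measurable (Pi\<^sub>M (upper_idx (Suc n)) (\<lambda>_. borel))"
    and B: "\<And>x. psd_fun (Suc n) (corr_fun x) \<Longrightarrow> \<bar>F x\<bar> \<le> B"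
  shows "integral\<^sup>L (corr_law \<nu> (Suc n)) F =
      (\<integral>w. \<integral>v. F (next_col w n v) \<partial>ball_law (colidx n) ((\<nu> - n) / 2) \<partial>chol_law \<nu> n)"
    and "integrable (chol_law \<nu> n) (\<lambda>w. \<integral>v. F (next_col w n v) \<partial>ball_law (colidx n) ((\<nu> - n) / 2))"
proof -
  let ?B = "ball_law (colidx n) ((\<nu> - n) / 2)"
  let ?G = "\<lambda>w. F (chol_map (Suc n) w)"
  interpret A: prob_space "chol_law \<nu> n" using \<nu> by (intro prob_space_chol_law) simp
  interpret Bp: prob_space ?B using \<nu> by (intro prob_space_ball_law) auto
  interpret pair_prob_space "chol_law \<nu> n" ?B ..
  have int: "integrable (chol_law \<nu> (Suc n)) ?G"
    using integrable_corr_law[OF _ F B, of \<nu>] \<nu> integral_corr_law(2)[OF F] by simp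
  have m: "merge (upper_idx n) (colidx n) \<in> measurable (chol_law \<nu> n \<Otimes>\<^sub>M ?B) (Pi\<^sub>M (upper_idx (Suc n)) (\<lambda>_. borel))"
    by measurable
  have G: "?G \<in> borel_measurable (Pi\<^sub>M (upper_idx (Suc n)) (\<lambda>_. borel))" by measurable
  have int': "integrable (chol_law \<nu> n \<Otimes>\<^sub>M ?B) (\<lambda>(w, v). F (next_col w n v))"
    using int unfolding chol_law.simps integrable_distr_eq[OF m G] next_col_def merge_chol_map
    by (simp add: case_prod_beta')
  have "integral\<^sup>L (corr_law \<nu> (Suc n)) F = integral\<^sup>L (chol_law \<nu> (Suc n)) ?G"
    by (rule integral_corr_law(1)[OF F])
  also have "\<dots> = (\<integral>z. ?G (merge (upper_idx n) (colidx n) z) \<partial>(chol_law \<nu> n \<Otimes>\<^sub>M ?B))"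
    unfolding chol_law.simps by (rule integral_distr[OF m G])
  also have "\<dots> = (\<integral>z. (case z of (w, v) \<Rightarrow> F (next_col w n v)) \<partial>(chol_law \<nu> n \<Otimes>\<^sub>M ?B))"
    unfolding next_col_def merge_chol_map by (simp add: case_prod_beta')
  also have "\<dots> = (\<integral>w. \<integral>v. F (next_col w n v) \<partial>?B \<partial>chol_law \<nu> n)"
    by (rule integral_fst[OF int', symmetric])
  finally show "integral\<^sup>L (corr_law \<nu> (Suc n)) F = (\<integral>w. \<integral>v. F (next_col w n v) \<partial>?B \<partial>chol_law \<nu> n)" .
  show "integrable (chol_law \<nu> n) (\<lambda>w. \<integral>v. F (next_col w n v) \<partial>?B)"
    by (rule integrable_fst[OF int'])
qed

lemma next_col_eq:
  "p \<in> upper_idx n \<Longrightarrow> next_col w n v p = chol_map n w p"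
  "i < n \<Longrightarrow> next_col w n v (i, n) = (\<Sum>k<n. chol w i k * v (k, n))"
proof -
  show "p \<in> upper_idx n \<Longrightarrow> next_col w n v p = chol_map n w p" by (simp add: next_col_def merge_def)
  assume i: "i < n"
  then have "(i, n) \<in> colidx n" "(i, n) \<notin> upper_idx n" by (auto simp: colidx_def upper_idx_def)
  then show "next_col w n v (i, n) = (\<Sum>k<n. chol w i k * v (k, n))"
    using sum_chol_trunc[OF i, of w "\<lambda>k. v (k, n)"] by (simp add: next_col_def merge_def chol_col_def)
qed

context
  fixes n :: nat and \<nu> :: real
  assumes \<nu>: "\<nu> > real n"
begin

lemma a_pos: "(\<nu> - n) / 2 > 0" using \<nu> by simp

lemma dof_col: "dof (colidx n) ((\<nu> - n) / 2) = \<nu>" by (simp add: dof_def[OF finite_colidx a_pos] field_simps)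

lemma inj_col: "inj_on (\<lambda>i. (i, n)) {..<n}" "(\<lambda>i. (i, n)) ` {..<n} \<subseteq> colidx n"
  by (auto simp: inj_on_def colidx_def)

lemmas col_mean = qform_mean[OF finite_colidx a_pos inj_col, unfolded dof_col]
lemmas col_variance = qform_variance[OF finite_colidx a_pos inj_col, unfolded dof_col]
lemmas col_qform_def = qform_def[OF finite_colidx a_pos inj_col]

text \<open>The matrix L' L. The new column is L v, so its squared norm is the quadratic form of L'
  L at v (\<open>sum_next_col\<close>).\<close>

definition colgram where "colgram w k l = (\<Sum>i<n. chol w i k * chol w i l)"

lemma colgram_sym: "colgram w k l = colgram w l k" by (simp add: colgram_def mult.commute)

lemma colgram_mean:
  "integrable (ball_law (colidx n) ((\<nu> - n) / 2)) (qform (\<lambda>i. (i, n)) n (colgram w))"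
  "integral\<^sup>L (ball_law (colidx n) ((\<nu> - n) / 2)) (qform (\<lambda>i. (i, n)) n (colgram w)) = (\<Sum>k<n. colgram w k k) / \<nu>"
  by (rule col_mean, rule colgram_sym)+

lemma colgram_variance:
  "integrable (ball_law (colidx n) ((\<nu> - n) / 2)) (\<lambda>v. (qform (\<lambda>i. (i, n)) n (colgram w) v - (\<Sum>k<n. colgram w k k) / \<nu>)\<^sup>2)"
  "integral\<^sup>L (ball_law (colidx n) ((\<nu> - n) / 2)) (\<lambda>v. (qform (\<lambda>i. (i, n)) n (colgram w) v - (\<Sum>k<n. colgram w k k) / \<nu>)\<^sup>2)
    \<le> 2 * (\<Sum>k<n. \<Sum>l<n. (colgram w k l)\<^sup>2) / \<nu>\<^sup>2"
  by (rule col_variance, rule colgram_sym)+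

lemma sum_next_col: "(\<Sum>i<n. (next_col w n v (i, n))\<^sup>2) = qform (\<lambda>i. (i, n)) n (colgram w) v"
proof -
  have "(\<Sum>i<n. (next_col w n v (i, n))\<^sup>2) = (\<Sum>i<n. (\<Sum>k<n. v (k, n) * chol w i k) * (\<Sum>k<n. v (k, n) * chol w i k))"
    by (intro sum.cong refl) (simp add: next_col_eq power2_eq_square mult.commute)
  also have "\<dots> = (\<Sum>k<n. \<Sum>l<n. v (k, n) * v (l, n) * (\<Sum>i<n. chol w i k * chol w i l))"
    by (rule gram[where L = "\<lambda>i k. chol w k i"])
  finally show ?thesis
    unfolding col_qform_def[OF colgram_sym] by (simp add: colgram_def mult_ac)
qed

context
  fixes w assumes good: "\<forall>j<n. sqn (colidx j) w < 1"
begin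

lemma good_gram: "i < n \<Longrightarrow> j < n \<Longrightarrow> corr_fun (chol_map n w) i j = (\<Sum>k<n. chol w i k * chol w j k)"
  using corr_fun_chol[of n w i j] good by (simp add: corr_fun_chol_map less_imp_le)

text \<open>The trace of L' L is the sum of the squared norms of the rows of L, which are unit
  vectors.\<close>

lemma colgram_trace: "(\<Sum>k<n. colgram w k k) = n"
proof -
  have "(\<Sum>k<n. colgram w k k) = (\<Sum>i<n. \<Sum>k<n. (chol w i k)\<^sup>2)"
    unfolding colgram_def by (subst sum.swap) (simp add: power2_eq_square)
  also have "\<dots> = (\<Sum>i<n. 1)"
    by (intro sum.cong refl chol_row_norm) (use good in \<open>auto simp: less_imp_le\<close>)
  finally show ?thesis by simp
qed

lemma colgram_frob: "(\<Sum>k<n. \<Sum>l<n. (colgram w k l)\<^sup>2) = n + 2 * offsq n (chol_map n w)"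
proof -
  have "(\<Sum>k<n. \<Sum>l<n. (colgram w k l)\<^sup>2) = (\<Sum>i<n. \<Sum>j<n. (corr_fun (chol_map n w) i j)\<^sup>2)"
    unfolding colgram_def by (rule frob_gram[where x = 1]) (simp, rule corr_fun_sym, rule good_gram)
  then show ?thesis by (simp add: sum_corr_fun_sq)
qed

end

end

lemma offsq_next_col: "offsq (Suc n) (next_col w n v) = offsq n (chol_map n w) + (\<Sum>i<n. (next_col w n v (i, n))\<^sup>2)"
  unfolding offsq_Suc by (simp add: offsq_def next_col_eq)

lemma offsq_bound: "psd_fun n (corr_fun x) \<Longrightarrow> \<bar>offsq n x\<bar> \<le> card (upper_idx n)"
  using offsq_le[of n x] offsq_nonneg[of n x] by simp

text \<open>Since \<open>colgram\<close> almost surely has trace n, the squared norm of the new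
  column has conditional mean \<open>n / \<nu>\<close> for almost every leading block. These means
  are summed over the columns.\<close>

lemma offsq_mean: "\<nu> > real n - 1 \<Longrightarrow> integral\<^sup>L (corr_law \<nu> n) (offsq n) = real n * (real n - 1) / (2 * \<nu>)"
proof (induction n)
  case (Suc n)
  have \<nu>: "\<nu> > real n" and \<nu>': "\<nu> > real n - 1" using Suc.prems by auto
  let ?B = "ball_law (colidx n) ((\<nu> - n) / 2)"
  interpret A: prob_space "chol_law \<nu> n" using \<nu> by (intro prob_space_chol_law) simp
  interpret Bp: prob_space ?B using \<nu> by (intro prob_space_ball_law) auto
  have "integral\<^sup>L (corr_law \<nu> (Suc n)) (offsq (Suc n)) = (\<integral>w. \<integral>v. offsq (Suc n) (next_col w n v) \<partial>?B \<partial>chol_law \<nu> n)"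
    by (rule integral_corr_law_Suc(1)[OF \<nu> measurable_offsq offsq_bound])
  also have "\<dots> = (\<integral>w. offsq n (chol_map n w) + n / \<nu> \<partial>chol_law \<nu> n)"
  proof (rule integral_cong_AE)
    show "AE w in chol_law \<nu> n. (\<integral>v. offsq (Suc n) (next_col w n v) \<partial>?B) = offsq n (chol_map n w) + n / \<nu>"
      using AE_chol_law[OF \<nu>']
    proof eventually_elim
      fix w assume good: "\<forall>j<n. sqn (colidx j) w < 1"
      show "(\<integral>v. offsq (Suc n) (next_col w n v) \<partial>?B) = offsq n (chol_map n w) + n / \<nu>"
        unfolding offsq_next_col sum_next_col[OF \<nu>]
        using colgram_mean[OF \<nu>, of w] colgram_trace[OF \<nu> good] by (simp add: Bp.prob_space)
    qed
    show "(\<lambda>w. \<integral>v. offsq (Suc n) (next_col w n v) \<partial>?B) \<in> borel_measurable (chol_law \<nu> n)"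
      using integral_corr_law_Suc(2)[OF \<nu> measurable_offsq offsq_bound] by (rule borel_measurable_integrable)
  qed measurable
  also have "\<dots> = integral\<^sup>L (corr_law \<nu> n) (offsq n) + n / \<nu>"
    using integrable_corr_law[OF _ measurable_offsq offsq_bound, of n \<nu>] \<nu>
    unfolding integral_corr_law[OF measurable_offsq] by (simp add: A.prob_space)
  also have "\<dots> = real n * (real n - 1) / (2 * \<nu>) + n / \<nu>" using Suc by simp
  also have "\<dots> = real (Suc n) * (real (Suc n) - 1) / (2 * \<nu>)" using \<nu> by (simp add: field_simps)
  finally show ?case .
next
  case 0
  have "offsq 0 = (\<lambda>x. 0)" by (simp add: fun_eq_iff)
  then show ?case by simp
qed

text \<open>The squared norm of a new column, centred at \<open>n / \<nu>\<close>, has conditional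
  mean 0. The cross term therefore drops out and the variances add up as for a martingale.\<close>

lemma offsq_variance:
  "\<nu> > real n - 1 \<Longrightarrow> (\<integral>x. (offsq n x - real n * (real n - 1) / (2 * \<nu>))\<^sup>2 \<partial>corr_law \<nu> n) \<le> 2 * (real n)\<^sup>2 / \<nu>\<^sup>2"
proof (induction n)
  case (Suc n)
  have \<nu>: "\<nu> > real n" using Suc.prems by simp
  let ?B = "ball_law (colidx n) ((\<nu> - n) / 2)"
  interpret A: prob_space "chol_law \<nu> n" using \<nu> by (intro prob_space_chol_law) simp
  interpret Bp: prob_space ?B using \<nu> by (intro prob_space_ball_law) auto
  define \<mu> where "\<mu> = real n * (real n - 1) / (2 * \<nu>)"
  have \<mu>: "real (Suc n) * (real (Suc n) - 1) / (2 * \<nu>) = \<mu> + n / \<nu>" using \<nu> by (simp add: \<mu>_def field_simps)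
  let ?F = "\<lambda>x. (offsq (Suc n) x - (\<mu> + n / \<nu>))\<^sup>2"
  have mF: "?F \<in> borel_measurable (Pi\<^sub>M (upper_idx (Suc n)) (\<lambda>_. borel))" by measurable
  have sqb: "\<bar>(y - m)\<^sup>2\<bar> \<le> (N + \<bar>m\<bar>)\<^sup>2" if "\<bar>y\<bar> \<le> N" for y m N :: real
  proof -
    have "\<bar>y - m\<bar> \<le> N + \<bar>m\<bar>" using that by linarith
    then show ?thesis by (metis abs_ge_zero abs_power2 power2_abs power_mono)
  qed
  have bF: "\<bar>?F x\<bar> \<le> (card (upper_idx (Suc n)) + \<bar>\<mu> + n / \<nu>\<bar>)\<^sup>2" if "psd_fun (Suc n) (corr_fun x)" for x
    by (rule sqb[OF offsq_bound[OF that]])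
  let ?G = "\<lambda>x. (offsq n x - \<mu>)\<^sup>2"
  have mG: "?G \<in> borel_measurable (Pi\<^sub>M (upper_idx n) (\<lambda>_. borel))" by measurable
  have bG: "\<bar>?G x\<bar> \<le> (card (upper_idx n) + \<bar>\<mu>\<bar>)\<^sup>2" if "psd_fun n (corr_fun x)" for x
    by (rule sqb[OF offsq_bound[OF that]])
  have \<nu>': "\<nu> > real n - 1" using \<nu> by simp
  have iG: "integrable (chol_law \<nu> n) (\<lambda>w. ?G (chol_map n w))"
    using integrable_corr_law[OF \<nu>' mG bG] unfolding integral_corr_law(2)[OF mG] .
  have iQ: "integrable (chol_law \<nu> n) (\<lambda>w. offsq n (chol_map n w))"
    using integrable_corr_law[OF \<nu>' measurable_offsq offsq_bound] unfolding integral_corr_law(2)[OF measurable_offsq] .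
  have "integral\<^sup>L (corr_law \<nu> (Suc n)) ?F = (\<integral>w. \<integral>v. ?F (next_col w n v) \<partial>?B \<partial>chol_law \<nu> n)"
    by (rule integral_corr_law_Suc(1)[OF \<nu> mF bF])
  also have "\<dots> \<le> (\<integral>w. ?G (chol_map n w) + 2 * (n + 2 * offsq n (chol_map n w)) / \<nu>\<^sup>2 \<partial>chol_law \<nu> n)"
  proof (rule integral_mono_AE)
    show "integrable (chol_law \<nu> n) (\<lambda>w. \<integral>v. ?F (next_col w n v) \<partial>?B)"
      by (rule integral_corr_law_Suc(2)[OF \<nu> mF bF])
    show "integrable (chol_law \<nu> n) (\<lambda>w. ?G (chol_map n w) + 2 * (n + 2 * offsq n (chol_map n w)) / \<nu>\<^sup>2)"
      using iG iQ by simp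
    show "AE w in chol_law \<nu> n. (\<integral>v. ?F (next_col w n v) \<partial>?B) \<le> ?G (chol_map n w) + 2 * (n + 2 * offsq n (chol_map n w)) / \<nu>\<^sup>2"
      using AE_chol_law[OF \<nu>']
    proof eventually_elim
      fix w assume good: "\<forall>j<n. sqn (colidx j) w < 1"
      let ?q = "qform (\<lambda>i. (i, n)) n (colgram n w)"
      let ?\<alpha> = "offsq n (chol_map n w) - \<mu>"
      note q = colgram_mean[OF \<nu>, of w, unfolded colgram_trace[OF \<nu> good]]
      note q2 = colgram_variance[OF \<nu>, of w, unfolded colgram_trace[OF \<nu> good] colgram_frob[OF \<nu> good]]
      have eq: "?F (next_col w n v) = ?\<alpha>\<^sup>2 + 2 * ?\<alpha> * (?q v - n / \<nu>) + (?q v - n / \<nu>)\<^sup>2" for v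
        unfolding offsq_next_col sum_next_col[OF \<nu>] by (simp add: power2_eq_square algebra_simps)
      have "(\<integral>v. ?F (next_col w n v) \<partial>?B) = ?\<alpha>\<^sup>2 + (\<integral>v. (?q v - n / \<nu>)\<^sup>2 \<partial>?B)"
        unfolding eq using q q2(1) by (simp add: Bp.prob_space)
      then show "(\<integral>v. ?F (next_col w n v) \<partial>?B) \<le> ?G (chol_map n w) + 2 * (n + 2 * offsq n (chol_map n w)) / \<nu>\<^sup>2"
        using q2(2) by simp
    qed
  qed
  also have "\<dots> = (\<integral>x. ?G x \<partial>corr_law \<nu> n) + 2 * (real n + 2 * integral\<^sup>L (corr_law \<nu> n) (offsq n)) / \<nu>\<^sup>2"
    unfolding integral_corr_law(1)[OF mG] integral_corr_law(1)[OF measurable_offsq] using iG iQ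
    by (simp add: A.prob_space)
  also have "integral\<^sup>L (corr_law \<nu> n) (offsq n) = \<mu>" using offsq_mean[OF \<nu>'] unfolding \<mu>_def .
  also have "(\<integral>x. ?G x \<partial>corr_law \<nu> n) + 2 * (real n + 2 * \<mu>) / \<nu>\<^sup>2 \<le> 2 * (real n)\<^sup>2 / \<nu>\<^sup>2 + 2 * (real n + 2 * \<mu>) / \<nu>\<^sup>2"
    using Suc.IH[OF \<nu>'] unfolding \<mu>_def by simp
  also have "2 * (real n)\<^sup>2 / \<nu>\<^sup>2 + 2 * (real n + 2 * \<mu>) / \<nu>\<^sup>2 \<le> 2 * (real n)\<^sup>2 / \<nu>\<^sup>2 + 2 * (2 * real n) / \<nu>\<^sup>2"
  proof -
    \<comment> \<open>This follows from \<open>n - 1 < \<nu>\<close>. The variance then grows by at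
      most \<open>4 * n / \<nu>^2\<close>, and \<open>2 * n^2 + 4 * n \<le> 2 * (n + 1)^2\<close>
      closes the induction.\<close>
    have "\<mu> \<le> n / 2"
    proof -
      have "n * (real n - 1) \<le> n * \<nu>" using \<nu> by (intro mult_left_mono) auto
      then show ?thesis unfolding \<mu>_def using \<nu> by (simp add: field_simps)
    qed
    then show ?thesis by (intro add_left_mono divide_right_mono mult_left_mono) auto
  qed
  also have "\<dots> = (2 * (real n)\<^sup>2 + 4 * real n) / \<nu>\<^sup>2" by (simp add: add_divide_distrib)
  also have "\<dots> \<le> 2 * (real (Suc n))\<^sup>2 / \<nu>\<^sup>2"
    by (intro divide_right_mono) (auto simp: power2_eq_square algebra_simps)
  finally show ?case unfolding \<mu> by simp
qed simp

subsection \<open>The Stieltjes transform\<close>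

lemma res_cong:
  assumes "\<And>i j. i < n \<Longrightarrow> j < n \<Longrightarrow> c i j = c' i j"
  shows "res t c n i j = res t c' n i j"
  using assms
proof (induction n arbitrary: i j)
  case (Suc n)
  have IH: "res t c n i j = res t c' n i j" for i j using Suc by simp
  have y: "(\<Sum>k<n. res t c' n i k * c k n) = (\<Sum>k<n. res t c' n i k * c' k n)" for i
    using Suc.prems by (intro sum.cong refl) (simp add: IH)
  have q: "(\<Sum>k<n. c k n * f k) = (\<Sum>k<n. c' k n * f k)" for f
    using Suc.prems by (intro sum.cong refl) simp
  show ?case using Suc.prems[of n n] by (simp only: res.simps Let_def IH y q lessI)
qed simp

declare res.simps(2) [simp del]

context
  fixes t :: real
  assumes t: "t > 0"
begin

text \<open>The form of the resolvent of the leading block at column n. Subtracted from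
  \<open>1 + t\<close> it gives the Schur complement (\<open>rden_cquad\<close>).\<close>

definition cquad where "cquad n x = (\<Sum>k<n. corr_fun x k n * rcol t (corr_fun x) n k)"
definition ctres where "ctres n x = tres t (corr_fun x) n"

lemmas rcol_def' = rcol_def[OF t corr_fun_sym]

lemma rden_cquad: "rden t (corr_fun x) n = 1 + t - cquad n x"
proof -
  have "corr_fun x n n = 1" by (simp add: corr_fun_def)
  then show ?thesis by (simp add: rden_def[OF t corr_fun_sym] cquad_def)
qed

lemma ctres_def': "ctres n x = (\<Sum>i<n. res t (corr_fun x) n i i)"
  by (simp add: ctres_def tres_def[OF t corr_fun_sym])

lemma measurable_res:
  "n \<le> N \<Longrightarrow> (\<lambda>x. res t (corr_fun x) n i j) \<in> borel_measurable (Pi\<^sub>M (upper_idx N) (\<lambda>_. borel))"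
proof (induction n arbitrary: i j)
  case (Suc n)
  have IH: "(\<lambda>x. res t (corr_fun x) n i j) \<in> borel_measurable (Pi\<^sub>M (upper_idx N) (\<lambda>_. borel))" for i j
    using Suc by simp
  have c: "(\<lambda>x. corr_fun x k n) \<in> borel_measurable (Pi\<^sub>M (upper_idx N) (\<lambda>_. borel))" if "k \<le> n" for k
    using Suc.prems that by (intro measurable_corr_fun) auto
  define Y where "Y i x = (\<Sum>k<n. res t (corr_fun x) n i k * corr_fun x k n)" for i x
  have y[measurable]: "Y i \<in> borel_measurable (Pi\<^sub>M (upper_idx N) (\<lambda>_. borel))" for i
    unfolding Y_def[abs_def] by (intro borel_measurable_sum borel_measurable_times IH c) auto
  define B where "B x = 1 / (corr_fun x n n + t - (\<Sum>k<n. corr_fun x k n * Y k x))" for x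
  have b[measurable]: "B \<in> borel_measurable (Pi\<^sub>M (upper_idx N) (\<lambda>_. borel))"
    unfolding B_def[abs_def]
    by (intro borel_measurable_divide borel_measurable_diff borel_measurable_add borel_measurable_sum borel_measurable_times y c measurable_const) auto
  have eq: "res t (corr_fun x) (Suc n) i j =
     (if i < n \<and> j < n then res t (corr_fun x) n i j + B x * Y i x * Y j x
      else if i < n \<and> j = n then - (B x * Y i x)
      else if i = n \<and> j < n then - (B x * Y j x)
      else if i = n \<and> j = n then B x else 0)" for x i j
    by (simp only: res.simps Let_def Y_def B_def)
  note IH[measurable]
  show ?case unfolding eq by measurable
qed simp

lemma measurable_ctres [measurable]: "n \<le> N \<Longrightarrow> ctres n \<in> borel_measurable (Pi\<^sub>M (upper_idx N) (\<lambda>_. borel))"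
  unfolding ctres_def'[abs_def] by (intro borel_measurable_sum measurable_res)

lemma measurable_cquad [measurable]: "n < N \<Longrightarrow> cquad n \<in> borel_measurable (Pi\<^sub>M (upper_idx N) (\<lambda>_. borel))"
  unfolding cquad_def[abs_def] rcol_def'
  by (intro borel_measurable_sum borel_measurable_times measurable_res measurable_corr_fun) auto

lemma ctres_bounds: "psd_fun n (corr_fun x) \<Longrightarrow> 0 \<le> t * ctres n x" "psd_fun n (corr_fun x) \<Longrightarrow> t * ctres n x \<le> n"
  using tres_bounds[OF t corr_fun_sym, of n x] t unfolding ctres_def by (auto simp: field_simps)

lemma ctres_incr:
  assumes "psd_fun (Suc n) (corr_fun x)"
  shows "0 \<le> t * (ctres (Suc n) x - ctres n x)" "t * (ctres (Suc n) x - ctres n x) \<le> 1"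
  using tres_incr[OF t corr_fun_sym assms] t unfolding ctres_def by (auto simp: field_simps)

text \<open>With y the resolvent applied to the column, the form equals y' c y + t |y|^2 and is
  nonnegative. The upper bound expresses that the Schur complement \<open>1 + t - cquad n x\<close>
  is at least t.\<close>

lemma cquad_bounds:
  assumes psd: "psd_fun (Suc n) (corr_fun x)" shows "0 \<le> cquad n x" "cquad n x \<le> 1"
proof -
  show "cquad n x \<le> 1" using rden_ge_x[OF t corr_fun_sym psd] unfolding rden_cquad by simp
  let ?y = "rcol t (corr_fun x) n"
  have p: "psd_fun n (corr_fun x)" using psd by (rule psd_fun_Suc_D)
  have "cquad n x = (\<Sum>i<n. ((\<Sum>k<n. corr_fun x i k * ?y k) + t * ?y i) * ?y i)"
    unfolding cquad_def by (intro sum.cong refl) (simp add: rcol_eqn[OF t corr_fun_sym p])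
  also have "\<dots> = (\<Sum>i<n. (\<Sum>k<n. ?y i * corr_fun x i k * ?y k) + t * (?y i)\<^sup>2)"
    by (intro sum.cong refl) (simp add: algebra_simps sum_distrib_left power2_eq_square)
  also have "\<dots> = (\<Sum>i<n. \<Sum>k<n. ?y i * corr_fun x i k * ?y k) + t * (\<Sum>i<n. (?y i)\<^sup>2)"
    by (simp add: sum.distrib sum_distrib_left)
  finally have e: "cquad n x = (\<Sum>i<n. \<Sum>k<n. ?y i * corr_fun x i k * ?y k) + t * (\<Sum>i<n. (?y i)\<^sup>2)" .
  have "0 \<le> (\<Sum>i<n. \<Sum>k<n. ?y i * corr_fun x i k * ?y k)" using p unfolding psd_fun_def by blast
  moreover have "0 \<le> t * (\<Sum>i<n. (?y i)\<^sup>2)" using t by (intro mult_nonneg_nonneg sum_nonneg) auto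
  ultimately show "0 \<le> cquad n x" unfolding e by (rule add_nonneg_nonneg)
qed

lemma res_last_eq: "res t (corr_fun x) (Suc n) n n = 1 / (1 + t - cquad n x)"
proof -
  have "res t (corr_fun x) (Suc n) n n = 1 / rden t (corr_fun x) n"
    by (rule res_last) (rule t, rule corr_fun_sym)
  then show ?thesis by (simp only: rden_cquad)
qed

lemma ctres_next_col: "ctres n (next_col w n v) = ctres n (chol_map n w)"
  unfolding ctres_def' by (intro sum.cong refl res_cong corr_fun_cong[of n]) (auto simp: next_col_eq)

context
  fixes n :: nat and \<nu> :: real and w :: "nat \<times> nat \<Rightarrow> real"
  assumes \<nu>: "\<nu> > real n" and good: "\<forall>j<n. sqn (colidx j) w < 1"
begin

abbreviation (input) "SW \<equiv> sandwich t (corr_fun (chol_map n w)) (chol w) n"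

lemma sandwich_sym: "SW k l = SW l k"
proof -
  have d: "SW k l = (\<Sum>i<n. chol w i k * (\<Sum>j<n. res t (corr_fun (chol_map n w)) n i j * chol w j l))" for k l
    by (rule sandwich_def) (rule t, rule corr_fun_sym, rule good_gram[OF \<nu> good])
  show ?thesis unfolding d sum_distrib_left
    by (subst sum.swap) (intro sum.cong refl, subst res_sym, simp add: mult_ac)
qed

text \<open>The new column is L v for the leading Cholesky factor L, and the resolvent involved does
  not see the new column, so \<open>quad_sandwich\<close> applies.\<close>

lemma cquad_next_col: "cquad n (next_col w n v) = qform (\<lambda>i. (i, n)) n SW v"
proof -
  let ?c = "corr_fun (chol_map n w)" and ?x = "next_col w n v"
  have r: "corr_fun ?x i n = (\<Sum>k<n. chol w i k * v (k, n))" if "i < n" for i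
    using that by (simp add: corr_fun_def next_col_eq)
  have res: "res t (corr_fun ?x) n i j = res t ?c n i j" for i j
    by (intro res_cong corr_fun_cong[of n]) (auto simp: next_col_eq)
  have "cquad n ?x = (\<Sum>i<n. corr_fun ?x i n * (\<Sum>j<n. res t ?c n i j * corr_fun ?x j n))"
    unfolding cquad_def rcol_def' res ..
  also have "\<dots> = (\<Sum>k<n. \<Sum>l<n. v (k, n) * SW k l * v (l, n))"
    by (rule quad_sandwich[where v = "\<lambda>k. v (k, n)"]) (rule t, rule corr_fun_sym, rule good_gram[OF \<nu> good], assumption+, rule r)
  finally show ?thesis
    by (subst col_qform_def[OF \<nu>]) (rule sandwich_sym)
qed

lemma SW_trace: "(\<Sum>k<n. SW k k) = n - t * ctres n (chol_map n w)"
  unfolding ctres_def by (rule trace_sandwich) (rule t, rule corr_fun_sym, rule good_gram[OF \<nu> good])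

lemma SW_frob: "(\<Sum>k<n. \<Sum>l<n. (SW k l)\<^sup>2) \<le> n"
  by (rule frob_sandwich) (rule t, rule corr_fun_sym, rule good_gram[OF \<nu> good])

lemma cquad_inner:
  "(\<integral>v. (cquad n (next_col w n v) - (n - t * ctres n (next_col w n v)) / \<nu>)\<^sup>2 \<partial>ball_law (colidx n) ((\<nu> - n) / 2)) \<le> 2 * real n / \<nu>\<^sup>2"
proof -
  have "(\<integral>v. (cquad n (next_col w n v) - (n - t * ctres n (next_col w n v)) / \<nu>)\<^sup>2 \<partial>ball_law (colidx n) ((\<nu> - n) / 2))
     \<le> 2 * (\<Sum>k<n. \<Sum>l<n. (SW k l)\<^sup>2) / \<nu>\<^sup>2"
    unfolding cquad_next_col ctres_next_col SW_trace[symmetric]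
    by (rule col_variance(2)[OF \<nu>]) (rule sandwich_sym)
  also have "\<dots> \<le> 2 * real n / \<nu>\<^sup>2" using SW_frob by (intro divide_right_mono) auto
  finally show ?thesis .
qed

end

text \<open>Given the leading block, the inner integral is the variance of a quadratic form whose
  matrix has squared Frobenius norm at most n. This bound is the same for almost all blocks, so it
  survives averaging.\<close>

lemma cquad_concentration:
  assumes \<nu>: "\<nu> > real n"
  shows "(\<integral>x. (cquad n x - (n - t * ctres n x) / \<nu>)\<^sup>2 \<partial>corr_law \<nu> (Suc n)) \<le> 2 * real n / \<nu>\<^sup>2"
    and "integrable (corr_law \<nu> (Suc n)) (\<lambda>x. (cquad n x - (n - t * ctres n x) / \<nu>)\<^sup>2)"
proof -
  let ?F = "\<lambda>x. (cquad n x - (n - t * ctres n x) / \<nu>)\<^sup>2"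
  have mF: "?F \<in> borel_measurable (Pi\<^sub>M (upper_idx (Suc n)) (\<lambda>_. borel))" by measurable
  have bF: "\<bar>?F x\<bar> \<le> (1 + n / \<nu>)\<^sup>2" if psd: "psd_fun (Suc n) (corr_fun x)" for x
  proof -
    have "0 \<le> (n - t * ctres n x) / \<nu>" "(n - t * ctres n x) / \<nu> \<le> n / \<nu>"
      using ctres_bounds[OF psd_fun_Suc_D[OF psd]] \<nu> by (auto intro!: divide_right_mono divide_nonneg_nonneg)
    then have "\<bar>cquad n x - (n - t * ctres n x) / \<nu>\<bar> \<le> 1 + n / \<nu>"
      using cquad_bounds[OF psd] by linarith
    then have "\<bar>cquad n x - (n - t * ctres n x) / \<nu>\<bar>\<^sup>2 \<le> (1 + n / \<nu>)\<^sup>2" by (intro power_mono) auto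
    then show ?thesis by simp
  qed
  have \<nu>': "\<nu> > real n - 1" using \<nu> by simp
  interpret A: prob_space "chol_law \<nu> n" using \<nu>' by (rule prob_space_chol_law)
  show "integrable (corr_law \<nu> (Suc n)) ?F"
    by (rule integrable_corr_law[OF _ mF bF]) (use \<nu> in auto)
  have "integral\<^sup>L (corr_law \<nu> (Suc n)) ?F = (\<integral>w. \<integral>v. ?F (next_col w n v) \<partial>ball_law (colidx n) ((\<nu> - n) / 2) \<partial>chol_law \<nu> n)"
    by (rule integral_corr_law_Suc(1)[OF \<nu> mF bF])
  also have "\<dots> \<le> (\<integral>w. 2 * real n / \<nu>\<^sup>2 \<partial>chol_law \<nu> n)"
  proof (rule integral_mono_AE)
    show "integrable (chol_law \<nu> n) (\<lambda>w. \<integral>v. ?F (next_col w n v) \<partial>ball_law (colidx n) ((\<nu> - n) / 2))"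
      by (rule integral_corr_law_Suc(2)[OF \<nu> mF bF])
    show "AE w in chol_law \<nu> n. (\<integral>v. ?F (next_col w n v) \<partial>ball_law (colidx n) ((\<nu> - n) / 2)) \<le> 2 * real n / \<nu>\<^sup>2"
      using AE_chol_law[OF \<nu>'] by eventually_elim (rule cquad_inner[OF \<nu>])
  qed simp
  also have "\<dots> = 2 * real n / \<nu>\<^sup>2" by (simp add: A.prob_space)
  finally show "(\<integral>x. ?F x \<partial>corr_law \<nu> (Suc n)) \<le> 2 * real n / \<nu>\<^sup>2" .
qed

text \<open>The fixed point equation of the Marchenko--Pastur law is \<open>s = mp_map c s\<close>.\<close>

definition mp_map :: "real \<Rightarrow> real \<Rightarrow> real" where
  "mp_map c s = 1 / (1 + t - c * (1 - t * s))"

definition stj :: "nat \<Rightarrow> (nat \<times> nat \<Rightarrow> real) \<Rightarrow> real" where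
  "stj n x = ctres n x / n"

lemma measurable_stj [measurable]: "stj n \<in> borel_measurable (Pi\<^sub>M (upper_idx n) (\<lambda>_. borel))"
  unfolding stj_def[abs_def] by measurable

lemma measurable_mp_map [measurable]: "mp_map c \<in> borel_measurable borel"
  unfolding mp_map_def[abs_def] by measurable

lemma stj_bounds:
  assumes "psd_fun n (corr_fun x)" shows "0 \<le> t * stj n x" "t * stj n x \<le> 1"
  using ctres_bounds[OF assms] by (cases "n = 0"; auto simp: stj_def field_simps)+

lemma mp_map_bounds:
  assumes c: "0 < c" "c \<le> 1" and s: "0 \<le> t * s" "t * s \<le> 1"
  shows "0 \<le> t * mp_map c s" "t * mp_map c s \<le> 1" "1 + t - c * (1 - t * s) \<ge> t"
proof -
  have "c * (1 - t * s) \<le> 1 * 1" using c s by (intro mult_mono) auto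
  then show 1: "1 + t - c * (1 - t * s) \<ge> t" by simp
  show "0 \<le> t * mp_map c s" "t * mp_map c s \<le> 1"
    using 1 t unfolding mp_map_def by (auto simp: field_simps)
qed

lemma inverse_diff_le:
  fixes a b :: real assumes "a \<ge> t" "b \<ge> t" shows "\<bar>1 / a - 1 / b\<bar> \<le> \<bar>a - b\<bar> / t\<^sup>2"
proof -
  have "1 / a - 1 / b = (b - a) / (a * b)" using assms t by (simp add: field_simps)
  then have "\<bar>1 / a - 1 / b\<bar> = \<bar>a - b\<bar> / (a * b)" using assms t by (simp add: abs_mult abs_minus_commute)
  also have "\<dots> \<le> \<bar>a - b\<bar> / t\<^sup>2"
    using assms t by (intro divide_left_mono) (auto simp: power2_eq_square intro!: mult_mono mult_pos_pos)
  finally show ?thesis .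
qed

text \<open>Three errors are collected: the fluctuation of the quadratic form, at most
  \<open>1 / \<nu>\<close> for replacing size and trace of the leading block by those of the full
  matrix, and the distance of \<open>Suc n / \<nu>\<close> from c. The factor \<open>1 / t^2\<close>
  comes from inverting denominators that are at least t.\<close>

lemma res_last_approx:
  assumes psd: "psd_fun (Suc n) (corr_fun x)" and \<nu>: "\<nu> > real n" and c: "0 < c" "c \<le> 1"
  shows "\<bar>res t (corr_fun x) (Suc n) n n - mp_map c (stj (Suc n) x)\<bar> \<le>
     (\<bar>cquad n x - (n - t * ctres n x) / \<nu>\<bar> + 1 / \<nu> + \<bar>Suc n / \<nu> - c\<bar>) / t\<^sup>2"
proof -
  let ?s = "stj (Suc n) x"
  note s = stj_bounds[OF psd]
  have "\<bar>res t (corr_fun x) (Suc n) n n - mp_map c ?s\<bar> \<le> \<bar>(1 + t - cquad n x) - (1 + t - c * (1 - t * ?s))\<bar> / t\<^sup>2"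
    unfolding res_last_eq mp_map_def
    by (rule inverse_diff_le) (use cquad_bounds[OF psd] mp_map_bounds(3)[OF c s] in auto)
  also have "\<bar>(1 + t - cquad n x) - (1 + t - c * (1 - t * ?s))\<bar> = \<bar>cquad n x - c * (1 - t * ?s)\<bar>" by simp
  also have "\<dots> \<le> \<bar>cquad n x - (n - t * ctres n x) / \<nu>\<bar> + \<bar>(n - t * ctres n x) / \<nu> - c * (1 - t * ?s)\<bar>"
    by (rule order_trans[OF eq_refl abs_triangle_ineq]) simp
  also have "\<bar>(n - t * ctres n x) / \<nu> - c * (1 - t * ?s)\<bar> \<le> 1 / \<nu> + \<bar>Suc n / \<nu> - c\<bar>"
  proof -
    define d where "d = t * (ctres (Suc n) x - ctres n x)"
    have d: "0 \<le> d" "d \<le> 1" using ctres_incr[OF psd] by (auto simp: d_def)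
    have e: "Suc n * (1 - t * ?s) = Suc n - t * ctres (Suc n) x"
      by (simp add: stj_def field_simps)
    \<comment> \<open>The size grows by 1 and t times the trace by d, so the numerators differ by
      \<open>d - 1\<close>, of absolute value at most 1.\<close>
    have "n - t * ctres n x = Suc n * (1 - t * ?s) + (d - 1)" unfolding e by (simp add: d_def algebra_simps)
    then have "(n - t * ctres n x) / \<nu> - c * (1 - t * ?s) = (Suc n * (1 - t * ?s) + (d - 1)) / \<nu> - c * (1 - t * ?s)"
      by simp
    also have "\<dots> = (d - 1) / \<nu> + (Suc n / \<nu> - c) * (1 - t * ?s)"
      by (simp only: add_divide_distrib left_diff_distrib times_divide_eq_left)
    also have "\<bar>\<dots>\<bar> \<le> \<bar>(d - 1) / \<nu>\<bar> + \<bar>Suc n / \<nu> - c\<bar> * \<bar>1 - t * ?s\<bar>"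
      by (metis abs_mult abs_triangle_ineq)
    also have "\<dots> \<le> 1 / \<nu> + \<bar>Suc n / \<nu> - c\<bar> * 1"
      using d \<nu> s by (intro add_mono mult_left_mono) (auto simp: abs_if divide_simps)
    finally show ?thesis by simp
  qed
  finally show ?thesis using t by (simp add: divide_right_mono add.assoc)
qed

lemma stj_perm:
  assumes p: "p permutes {..<n}" and psd: "psd_fun n (corr_fun x)"
  shows "stj n (perm_offdiag n p x) = stj n x"
    and "i < n \<Longrightarrow> res t (corr_fun (perm_offdiag n p x)) n i i = res t (corr_fun x) n (p i) (p i)"
proof -
  have r: "res t (corr_fun (perm_offdiag n p x)) n i i = res t (corr_fun x) n (p i) (p i)" if "i < n" for i
  proof -
    have "res t (corr_fun (perm_offdiag n p x)) n i i = res t (\<lambda>i j. corr_fun x (p i) (p j)) n i i"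
      by (intro res_cong corr_fun_perm[OF p])
    also have "\<dots> = res t (corr_fun x) n (p i) (p i)"
      by (rule res_permute[OF t corr_fun_sym psd p that that])
    finally show ?thesis .
  qed
  then show "i < n \<Longrightarrow> res t (corr_fun (perm_offdiag n p x)) n i i = res t (corr_fun x) n (p i) (p i)" .
  have "ctres n (perm_offdiag n p x) = (\<Sum>i<n. res t (corr_fun x) n (p i) (p i))"
    unfolding ctres_def' by (intro sum.cong refl) (simp add: r)
  also have "\<dots> = ctres n x"
    unfolding ctres_def' by (rule sum_permutes[OF p, of "\<lambda>i. res t (corr_fun x) n i i"])
  finally show "stj n (perm_offdiag n p x) = stj n x" by (simp add: stj_def)
qed

text \<open>A transposition moves index i to the last place, where the entry is the inverse of a
  Schur complement.\<close>

lemma res_diag_bounds: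
  assumes psd: "psd_fun n (corr_fun x)" and i: "i < n"
  shows "\<bar>res t (corr_fun x) n i i\<bar> \<le> 1 / t"
proof -
  obtain m where m: "n = Suc m" using i by (cases n) auto
  define p where "p = Transposition.transpose i m"
  have p: "p permutes {..<n}" unfolding p_def using i m by (intro permutes_swap_id) auto
  have "res t (corr_fun x) n i i = res t (corr_fun (perm_offdiag n p x)) n m m"
    using stj_perm(2)[OF p psd, of m] m by (simp add: p_def)
  also have "\<dots> = 1 / (1 + t - cquad m (perm_offdiag n p x))" unfolding m by (rule res_last_eq)
  finally have e: "res t (corr_fun x) n i i = 1 / (1 + t - cquad m (perm_offdiag n p x))" .
  have psd': "psd_fun (Suc m) (corr_fun (perm_offdiag n p x))"
    unfolding m[symmetric] using psd_fun_cong[of n "corr_fun (perm_offdiag n p x)" "\<lambda>i j. corr_fun x (p i) (p j)"] corr_fun_perm[OF p] psd_fun_permute[OF p psd] by blast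
  show ?thesis unfolding e using cquad_bounds[OF psd'] t by (auto simp: field_simps)
qed

text \<open>By exchangeability every diagonal entry of the resolvent, hence also the normalized trace,
  may be replaced by the last diagonal entry when tested against a function of the trace. Testing
  against \<open>s - mp_map c s\<close> itself gives the mean square convergence without a separate
  concentration argument for the trace.\<close>

lemma stj_fixed_point_L2:
  assumes \<nu>: "\<nu> > real n" and c: "0 < c" "c \<le> 1"
  shows "(\<integral>x. (stj (Suc n) x - mp_map c (stj (Suc n) x))\<^sup>2 \<partial>corr_law \<nu> (Suc n)) \<le>
     (sqrt (2 * real n) / \<nu> + 1 / \<nu> + \<bar>Suc n / \<nu> - c\<bar>) / t ^ 3"
proof -
  let ?N = "Suc n"
  let ?M = "corr_law \<nu> ?N"
  let ?PM = "Pi\<^sub>M (upper_idx ?N) (\<lambda>_. borel :: real measure)"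
  have \<nu>': "\<nu> > real ?N - 1" using \<nu> by simp
  interpret prob_space ?M using \<nu>' by (rule prob_space_corr_law)
  define h where "h x = stj ?N x - mp_map c (stj ?N x)" for x
  define \<Phi> where "\<Phi> i x = (res t (corr_fun x) ?N i i - mp_map c (stj ?N x)) * h x" for i x
  have mres[measurable]: "(\<lambda>x. res t (corr_fun x) ?N i j) \<in> borel_measurable ?PM" for i j
    by (rule measurable_res) simp
  have mh[measurable]: "h \<in> borel_measurable ?PM" unfolding h_def[abs_def] by measurable
  have m\<Phi>[measurable]: "\<Phi> i \<in> borel_measurable ?PM" for i unfolding \<Phi>_def[abs_def] by measurable
  have mpb: "0 \<le> mp_map c (stj ?N x)" "mp_map c (stj ?N x) \<le> 1 / t" if "psd_fun ?N (corr_fun x)" for x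
    using mp_map_bounds[OF c stj_bounds[OF that]] t by (auto simp: field_simps zero_le_mult_iff)
  have bh: "\<bar>h x\<bar> \<le> 1 / t" if psd: "psd_fun ?N (corr_fun x)" for x
  proof -
    have "0 \<le> stj ?N x" "stj ?N x \<le> 1 / t" using stj_bounds[OF psd] t by (auto simp: field_simps zero_le_mult_iff)
    then show ?thesis using mpb[OF psd] unfolding h_def by linarith
  qed
  have b\<Phi>: "\<bar>\<Phi> i x\<bar> \<le> (2 / t) * (1 / t)" if psd: "psd_fun ?N (corr_fun x)" and i: "i < ?N" for i x
  proof -
    have "\<bar>res t (corr_fun x) ?N i i - mp_map c (stj ?N x)\<bar> \<le> 1 / t + 1 / t"
      using res_diag_bounds[OF psd i] mpb[OF psd] by linarith
    then show ?thesis unfolding \<Phi>_def abs_mult using bh[OF psd] t by (intro mult_mono) auto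
  qed
  have i\<Phi>: "integrable ?M (\<Phi> i)" if "i < ?N" for i
    by (rule integrable_corr_law[OF \<nu>' m\<Phi> b\<Phi>]) (use that in auto)
  \<comment> \<open>The transposition of i and n preserves the law and almost surely the trace, and
    it carries one diagonal entry to the other.\<close>
  have exch: "integral\<^sup>L ?M (\<Phi> i) = integral\<^sup>L ?M (\<Phi> n)" if i: "i < ?N" for i
  proof -
    define p where "p = Transposition.transpose i n"
    have p: "p permutes {..<?N}" unfolding p_def using i by (intro permutes_swap_id) auto
    have "integral\<^sup>L ?M (\<Phi> n) = (\<integral>x. \<Phi> n (perm_offdiag ?N p x) \<partial>?M)"
      by (rule integral_corr_law_perm[OF p \<nu>' m\<Phi>, symmetric])
    also have "\<dots> = integral\<^sup>L ?M (\<Phi> i)"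
    proof (rule integral_cong_AE)
      show "AE x in ?M. \<Phi> n (perm_offdiag ?N p x) = \<Phi> i x"
        using AE_corr_law_psd[OF \<nu>']
      proof eventually_elim
        case (elim x)
        show ?case
          unfolding \<Phi>_def h_def stj_perm(1)[OF p elim] stj_perm(2)[OF p elim lessI] by (simp add: p_def)
      qed
      show "(\<lambda>x. \<Phi> n (perm_offdiag ?N p x)) \<in> borel_measurable ?M"
        using measurable_compose[OF measurable_perm_offdiag[OF p] m\<Phi>] by simp
    qed simp
    finally show ?thesis ..
  qed
  \<comment> \<open>The diagonal entries average to \<open>stj\<close>, so the functions
    \<open>\<Phi> i\<close> average to the square of \<open>h\<close>.\<close>
  have "(\<integral>x. (h x)\<^sup>2 \<partial>?M) = (\<integral>x. (\<Sum>i<?N. \<Phi> i x) / ?N \<partial>?M)"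
  proof (rule arg_cong[of _ _ "integral\<^sup>L ?M"], rule ext)
    fix x
    have "(\<Sum>i<?N. \<Phi> i x) = (ctres ?N x - ?N * mp_map c (stj ?N x)) * h x"
      unfolding \<Phi>_def sum_distrib_right[symmetric] ctres_def' by (simp add: sum_subtractf)
    also have "\<dots> = ?N * (h x)\<^sup>2" by (simp add: h_def stj_def power2_eq_square field_simps del: of_nat_Suc)
    finally show "(h x)\<^sup>2 = (\<Sum>i<?N. \<Phi> i x) / ?N" by simp
  qed
  also have "\<dots> = (\<Sum>i<?N. integral\<^sup>L ?M (\<Phi> i)) / ?N"
    using integral_sum_lessThan[of ?N ?M \<Phi>] i\<Phi> by simp
  also have "\<dots> = (\<Sum>i<?N. integral\<^sup>L ?M (\<Phi> n)) / ?N"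
    by (intro arg_cong2[of _ _ _ _ divide] sum.cong refl exch) simp
  also have "\<dots> = integral\<^sup>L ?M (\<Phi> n)" by simp
  finally have L: "(\<integral>x. (h x)\<^sup>2 \<partial>?M) = integral\<^sup>L ?M (\<Phi> n)" .
  define Y where "Y x = cquad n x - (n - t * ctres n x) / \<nu>" for x
  have mY[measurable]: "Y \<in> borel_measurable ?PM" unfolding Y_def[abs_def] by measurable
  note Y2 = cquad_concentration[OF \<nu>, folded Y_def]
  have iY: "integrable ?M (\<lambda>x. \<bar>Y x\<bar>)"
    by (rule integrable_abs, rule square_integrable_imp_integrable) (use Y2(2) in auto)
  have EY: "(\<integral>x. \<bar>Y x\<bar> \<partial>?M) \<le> sqrt (2 * real n) / \<nu>"
  proof -
    \<comment> \<open>Nonnegativity of the variance of |Y| bounds the square of the first absolute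
      moment by the second moment.\<close>
    have "(\<integral>x. \<bar>Y x\<bar> \<partial>?M)\<^sup>2 \<le> (\<integral>x. (Y x)\<^sup>2 \<partial>?M)"
      using variance_positive[of "\<lambda>x. \<bar>Y x\<bar>"] variance_eq[OF iY] Y2(2) by simp
    also have "\<dots> \<le> 2 * real n / \<nu>\<^sup>2" by (rule Y2(1))
    also have "\<dots> = (sqrt (2 * real n) / \<nu>)\<^sup>2" by (simp add: power_divide)
    finally show ?thesis by (rule power2_le_imp_le) (use \<nu> in simp)
  qed
  have "integral\<^sup>L ?M (\<Phi> n) \<le> (\<integral>x. (\<bar>Y x\<bar> + 1 / \<nu> + \<bar>?N / \<nu> - c\<bar>) / t\<^sup>2 * (1 / t) \<partial>?M)"
  proof (rule integral_mono_AE)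
    show "AE x in ?M. \<Phi> n x \<le> (\<bar>Y x\<bar> + 1 / \<nu> + \<bar>?N / \<nu> - c\<bar>) / t\<^sup>2 * (1 / t)"
      using AE_corr_law_psd[OF \<nu>']
    proof eventually_elim
      case (elim x)
      have "\<Phi> n x \<le> \<bar>res t (corr_fun x) ?N n n - mp_map c (stj ?N x)\<bar> * \<bar>h x\<bar>"
        unfolding \<Phi>_def by (rule order_trans[OF abs_ge_self]) (simp add: abs_mult)
      also have "\<dots> \<le> (\<bar>Y x\<bar> + 1 / \<nu> + \<bar>?N / \<nu> - c\<bar>) / t\<^sup>2 * (1 / t)"
        unfolding Y_def by (intro mult_mono res_last_approx[OF elim \<nu> c] bh[OF elim]) (use \<nu> t in auto)
      finally show ?case .
    qed
  qed (use iY i\<Phi> in auto)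
  also have "\<dots> = ((\<integral>x. \<bar>Y x\<bar> \<partial>?M) + 1 / \<nu> + \<bar>?N / \<nu> - c\<bar>) / t\<^sup>2 * (1 / t)"
    using iY by (simp add: prob_space)
  also have "\<dots> \<le> (sqrt (2 * real n) / \<nu> + 1 / \<nu> + \<bar>?N / \<nu> - c\<bar>) / t\<^sup>2 * (1 / t)"
    using EY t by (intro mult_right_mono divide_right_mono add_right_mono) auto
  also have "\<dots> = (sqrt (2 * real n) / \<nu> + 1 / \<nu> + \<bar>?N / \<nu> - c\<bar>) / t ^ 3"
    by (simp add: power2_eq_square power3_eq_cube)
  finally show ?thesis using L unfolding h_def by simp
qed

end

subsection \<open>The Stieltjes transform of the Marchenko--Pastur law\<close>

context
  fixes a b :: real
  assumes ab: "0 \<le> a" "a < b"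
begin

lemma has_derivative_arctan_sqrt:
  assumes x: "a < x" "x < b" and k: "k \<ge> 0"
  shows "((\<lambda>x. arctan (k * sqrt ((x - a) / (b - x)))) has_real_derivative
     k * (b - a) / (2 * sqrt ((b - x) * (x - a)) * ((b - x) + k\<^sup>2 * (x - a)))) (at x)"
proof -
  define u where "u = sqrt ((x - a) / (b - x))"
  have u: "u > 0" "u\<^sup>2 = (x - a) / (b - x)" using x by (auto simp: u_def)
  have R: "sqrt ((b - x) * (x - a)) = u * (b - x)"
  proof -
    have "(u * (b - x))\<^sup>2 = (b - x) * (x - a)"
      unfolding power_mult_distrib u(2) using x by (simp add: power2_eq_square[of "b - x"])
    then show ?thesis by (rule real_sqrt_unique) (use u(1) x in simp)
  qed
  have d: "((\<lambda>x. (x - a) / (b - x)) has_real_derivative (b - a) / (b - x)\<^sup>2) (at x)"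
    using x by (auto intro!: derivative_eq_intros simp: power2_eq_square field_simps)
  have pos: "(x - a) / (b - x) > 0" using x by simp
  have "((\<lambda>x. arctan (k * sqrt ((x - a) / (b - x)))) has_real_derivative
     inverse (1 + (k * u)\<^sup>2) * (k * ((inverse u / 2) * ((b - a) / (b - x)\<^sup>2)))) (at x)"
    unfolding u_def
    by (intro DERIV_chain2[OF DERIV_arctan] DERIV_cmult DERIV_chain2[OF DERIV_real_sqrt[OF pos] d])
  moreover have "inverse (1 + (k * u)\<^sup>2) * (k * ((inverse u / 2) * ((b - a) / (b - x)\<^sup>2))) =
      k * (b - a) / (2 * sqrt ((b - x) * (x - a)) * ((b - x) + k\<^sup>2 * (x - a)))"
  proof -
    have p: "1 + (k * u)\<^sup>2 = ((b - x) + k\<^sup>2 * (x - a)) / (b - x)"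
      using x by (simp add: power_mult_distrib u(2) field_simps)
    have q: "(b - x) + k\<^sup>2 * (x - a) > 0" using x by (intro add_pos_nonneg) auto
    have gen: "inverse (Q / X) * (k * ((inverse u / 2) * (D / X\<^sup>2))) = k * D / (2 * (u * X) * Q)" if "Q > 0" "X > 0" for Q X D :: real
      using that u(1) by (simp add: field_simps power2_eq_square)
    show ?thesis unfolding p R by (rule gen) (use q x in auto)
  qed
  ultimately show ?thesis by simp
qed

text \<open>The substitution \<open>u = sqrt ((x - a) / (b - x))\<close> makes the integrand rational. The factor
  \<open>1\<close> makes both arctangents instances of one derivative rule.\<close>

definition mp_prim :: "real \<Rightarrow> real \<Rightarrow> real" where
  "mp_prim y x = sqrt ((b - x) * (x - a)) + (a + b + 2 * y) * arctan (1 * sqrt ((x - a) / (b - x)))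
     - 2 * sqrt ((a + y) * (b + y)) * arctan (sqrt ((b + y) / (a + y)) * sqrt ((x - a) / (b - x)))"

lemma DERIV_mp_prim:
  assumes x: "a < x" "x < b" and y: "y \<ge> 0"
  shows "(mp_prim y has_real_derivative sqrt ((b - x) * (x - a)) / (x + y)) (at x)"
proof -
  define R where "R = sqrt ((b - x) * (x - a))"
  define k where "k = sqrt ((b + y) / (a + y))"
  define S where "S = sqrt ((a + y) * (b + y))"
  have k: "k \<ge> 0" using ab y by (auto simp: k_def)
  have pos: "(b - x) * (x - a) > 0" using x by simp
  have R: "R > 0" "R * R = (b - x) * (x - a)" using pos by (auto simp: R_def)
  have d: "((\<lambda>x. (b - x) * (x - a)) has_real_derivative (a + b - 2 * x)) (at x)"
    by (auto intro!: derivative_eq_intros)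
  have "(mp_prim y has_real_derivative (inverse R / 2) * (a + b - 2 * x)
     + (a + b + 2 * y) * (1 * (b - a) / (2 * R * ((b - x) + 1\<^sup>2 * (x - a))))
     - 2 * S * (k * (b - a) / (2 * R * ((b - x) + k\<^sup>2 * (x - a))))) (at x)"
    unfolding mp_prim_def[abs_def] R_def S_def k_def
    by (intro DERIV_diff DERIV_add DERIV_cmult has_derivative_arctan_sqrt DERIV_chain2[OF DERIV_real_sqrt[OF pos] d] x)
       (use ab y in auto)
  moreover have "(inverse R / 2) * (a + b - 2 * x)
     + (a + b + 2 * y) * (1 * (b - a) / (2 * R * ((b - x) + 1\<^sup>2 * (x - a))))
     - 2 * S * (k * (b - a) / (2 * R * ((b - x) + k\<^sup>2 * (x - a)))) = R / (x + y)"
  proof -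
    have xy: "x + y > 0" using x ab y by simp
    have 1: "(a + b + 2 * y) * (1 * (b - a) / (2 * R * ((b - x) + 1\<^sup>2 * (x - a)))) = (a + b + 2 * y) / (2 * R)"
      using ab R by simp
    have 2: "2 * S * (k * (b - a) / (2 * R * ((b - x) + k\<^sup>2 * (x - a)))) = (a + y) * (b + y) / (R * (x + y))"
    \<comment> \<open>This occurs for \<open>c = 1\<close> and \<open>y = 0\<close>, where the
      support reaches the pole at 0. The quotient in \<open>k\<close> then has denominator 0, and
      the term disappears because \<open>S = 0\<close>.\<close>
    proof (cases "a + y = 0")
      case True
      then show ?thesis by (simp add: S_def)
    next
      case False
      then have ay: "a + y > 0" using ab y by simp
      have k2: "k\<^sup>2 = (b + y) / (a + y)" using ay ab y by (simp add: k_def)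
      have Sk: "S * k = b + y"
        using ay ab y by (simp add: S_def k_def real_sqrt_mult[symmetric])
      have den: "(b - x) + k\<^sup>2 * (x - a) = (b - a) * (x + y) / (a + y)"
        unfolding k2 using ay by (simp add: field_simps)
      have gen: "2 * S * (k * D / (2 * R * (D * P / A))) = S * k * A / (R * P)" if "D > 0" "A > 0" "P > 0" for D P A :: real
        using that R(1) by (simp add: field_simps)
      show ?thesis unfolding den using gen[of "b - a" "a + y" "x + y"] ab ay xy unfolding Sk by (simp only: mult.commute)
    qed
    have gen: "(inverse R / 2) * p + q / (2 * R) - m / (R * P) = ((p + q) / 2 * P - m) / (R * P)" if "P > 0" for p q m P :: real
      using that R(1) by (simp add: field_simps)
    have "(inverse R / 2) * (a + b - 2 * x) + (a + b + 2 * y) / (2 * R) - (a + y) * (b + y) / (R * (x + y))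
       = ((a + b - 2 * x + (a + b + 2 * y)) / 2 * (x + y) - (a + y) * (b + y)) / (R * (x + y))"
      by (rule gen[OF xy])
    \<comment> \<open>The coefficients in \<open>mp_prim\<close> are chosen so that y cancels from
      this numerator and only (b - x) (x - a) remains.\<close>
    also have "(a + b - 2 * x + (a + b + 2 * y)) / 2 * (x + y) - (a + y) * (b + y) = R * R"
      unfolding R(2) by (simp add: field_simps)
    also have "R * R / (R * (x + y)) = R / (x + y)" using R(1) by simp
    finally show ?thesis unfolding 1 2 .
  qed
  ultimately show ?thesis unfolding R_def by simp
qed

lemma filterlim_mp_ratio: "filterlim (\<lambda>x. sqrt ((x - a) / (b - x))) at_top (at_left b)"
proof -
  have "filterlim (\<lambda>x. inverse (b - x)) at_top (at_left b)"
  proof (rule filterlim_inverse_at_top)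
    have "((\<lambda>x. b - x) \<longlongrightarrow> b - b) (at_left b)" by (intro tendsto_intros)
    then show "((\<lambda>x. b - x) \<longlongrightarrow> 0) (at_left b)" by simp
    show "\<forall>\<^sub>F x in at_left b. 0 < b - x"
      by (simp add: eventually_at_filter)
  qed
  moreover have "((\<lambda>x. x - a) \<longlongrightarrow> b - a) (at_left b)" by (intro tendsto_intros)
  ultimately have "filterlim (\<lambda>x. (x - a) * inverse (b - x)) at_top (at_left b)"
    using ab by (intro filterlim_tendsto_pos_mult_at_top[of _ "b - a"]) auto
  then have "filterlim (\<lambda>x. (x - a) / (b - x)) at_top (at_left b)" by (simp add: divide_inverse)
  then show ?thesis by (rule filterlim_compose[OF sqrt_at_top])
qed

text \<open>At a the square roots vanish. At b both arctangents tend to pi / 2, except that for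
  \<open>a + y = 0\<close> the second one is constantly 0; its coefficient is 0 in that
  case.\<close>

lemma mp_prim_limits:
  assumes y: "y \<ge> 0"
  shows "(mp_prim y \<longlongrightarrow> 0) (at_right a)"
    and "(mp_prim y \<longlongrightarrow> pi * ((a + b) / 2 + y - sqrt ((a + y) * (b + y)))) (at_left b)"
proof -
  have "((\<lambda>x. sqrt ((x - a) / (b - x))) \<longlongrightarrow> sqrt ((a - a) / (b - a))) (at_right a)"
    using ab by (intro tendsto_intros) auto
  then have u: "((\<lambda>x. sqrt ((x - a) / (b - x))) \<longlongrightarrow> 0) (at_right a)" by simp
  have "(mp_prim y \<longlongrightarrow> sqrt ((b - a) * (a - a)) + (a + b + 2 * y) * arctan (1 * 0) - 2 * sqrt ((a + y) * (b + y)) * arctan (sqrt ((b + y) / (a + y)) * 0)) (at_right a)"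
    unfolding mp_prim_def[abs_def] by (intro tendsto_intros u)
  then show "(mp_prim y \<longlongrightarrow> 0) (at_right a)" by simp
  have at: "((\<lambda>x. arctan (k * sqrt ((x - a) / (b - x)))) \<longlongrightarrow> pi / 2) (at_left b)" if "k > 0" for k
    by (rule filterlim_compose[OF tendsto_arctan_at_top]) (rule filterlim_tendsto_pos_mult_at_top[OF tendsto_const that filterlim_mp_ratio])
  have 2: "((\<lambda>x. 2 * sqrt ((a + y) * (b + y)) * arctan (sqrt ((b + y) / (a + y)) * sqrt ((x - a) / (b - x)))) \<longlongrightarrow> 2 * sqrt ((a + y) * (b + y)) * (pi / 2)) (at_left b)"
  proof (cases "a + y = 0")
    case False
    then have "sqrt ((b + y) / (a + y)) > 0" using ab y by simp
    then show ?thesis by (intro tendsto_mult tendsto_const at)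
  qed simp
  have eq: "sqrt ((b - b) * (b - a)) + (a + b + 2 * y) * (pi / 2) - 2 * S * (pi / 2) = pi * ((a + b) / 2 + y - S)" for S
    by (simp add: field_simps)
  have 1: "((\<lambda>x. arctan (1 * sqrt ((x - a) / (b - x)))) \<longlongrightarrow> pi / 2) (at_left b)" by (rule at) simp
  have "(mp_prim y \<longlongrightarrow> sqrt ((b - b) * (b - a)) + (a + b + 2 * y) * (pi / 2) - 2 * sqrt ((a + y) * (b + y)) * (pi / 2)) (at_left b)"
    unfolding mp_prim_def[abs_def] by (intro tendsto_diff tendsto_add 2 tendsto_mult[OF tendsto_const 1]) (intro tendsto_intros)
  then show "(mp_prim y \<longlongrightarrow> pi * ((a + b) / 2 + y - sqrt ((a + y) * (b + y)))) (at_left b)"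
    unfolding eq .
qed

text \<open>The value \<open>y = 0\<close> gives the total mass of the Marchenko--Pastur density;
  together with \<open>y = t\<close> it gives the Stieltjes transform by partial fractions.\<close>

lemma mp_integral:
  assumes y: "y \<ge> 0"
  shows "has_bochner_integral lborel (\<lambda>x. indicator {a<..<b} x * (sqrt ((b - x) * (x - a)) / (x + y)))
     (pi * ((a + b) / 2 + y - sqrt ((a + y) * (b + y))))"
proof -
  let ?f = "\<lambda>x. sqrt ((b - x) * (x - a)) / (x + y)"
  have "ereal a < ereal b" using ab by simp
  note FTC = interval_integral_FTC_nonneg[OF this, of "mp_prim y" ?f 0 "pi * ((a + b) / 2 + y - sqrt ((a + y) * (b + y)))"]
  have cont: "isCont ?f x" if "a < x" "x < b" for x
    using that ab y by (intro continuous_intros) auto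
  have nonneg: "AE x in lborel. ereal a < ereal x \<longrightarrow> ereal x < ereal b \<longrightarrow> 0 \<le> ?f x"
    using ab y by (intro AE_I2) (auto intro!: divide_nonneg_nonneg)
  have l: "((mp_prim y \<circ> real_of_ereal) \<longlongrightarrow> 0) (at_right (ereal a))"
    "((mp_prim y \<circ> real_of_ereal) \<longlongrightarrow> pi * ((a + b) / 2 + y - sqrt ((a + y) * (b + y)))) (at_left (ereal b))"
    using mp_prim_limits[OF y] by (simp_all add: ereal_tendsto_simps)
  have si: "set_integrable lborel (einterval (ereal a) (ereal b)) ?f"
    and v: "(LBINT x=ereal a..ereal b. ?f x) = pi * ((a + b) / 2 + y - sqrt ((a + y) * (b + y)))"
    using FTC DERIV_mp_prim[OF _ _ y] cont nonneg l by auto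
  have e: "einterval (ereal a) (ereal b) = {a<..<b}" by (auto simp: einterval_def)
  have "integrable lborel (\<lambda>x. indicator {a<..<b} x * ?f x)"
    using si unfolding e set_integrable_def by simp
  moreover have "integral\<^sup>L lborel (\<lambda>x. indicator {a<..<b} x * ?f x) = pi * ((a + b) / 2 + y - sqrt ((a + y) * (b + y)))"
    using v ab unfolding interval_lebesgue_integral_def e set_lebesgue_integral_def by simp
  ultimately show ?thesis by (simp add: has_bochner_integral_iff)
qed

end

context
  fixes c :: real
  assumes c: "0 < c" "c \<le> 1"
begin

definition mp_a where "mp_a = (1 - sqrt c)\<^sup>2"
definition mp_b where "mp_b = (1 + sqrt c)\<^sup>2"

lemma mp_ab: "0 \<le> mp_a" "mp_a < mp_b" "mp_a + mp_b = 2 + 2 * c" "mp_a * mp_b = (1 - c)\<^sup>2"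
proof -
  have s: "sqrt c > 0" "(sqrt c)\<^sup>2 = c" using c by auto
  show "0 \<le> mp_a" by (simp add: mp_a_def)
  show "mp_a < mp_b" using s by (simp add: mp_a_def mp_b_def power2_eq_square algebra_simps)
  show "mp_a + mp_b = 2 + 2 * c" using s(2) by (simp add: mp_a_def mp_b_def power2_eq_square algebra_simps)
  have "mp_a * mp_b = (1 - (sqrt c)\<^sup>2)\<^sup>2" by (simp add: mp_a_def mp_b_def power2_eq_square algebra_simps)
  then show "mp_a * mp_b = (1 - c)\<^sup>2" using s(2) by simp
qed

definition mp_dens :: "real \<Rightarrow> real" where
  "mp_dens x = indicator {mp_a<..<mp_b} x * (1 / (2 * pi * c * x) * sqrt ((mp_b - x) * (x - mp_a)))"

lemma mp_dens_nonneg: "0 \<le> mp_dens x"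
proof (cases "x \<in> {mp_a<..<mp_b}")
  case True
  then have "0 < x" using mp_ab(1) by (simp add: le_less_trans)
  then show ?thesis using True c by (simp add: mp_dens_def)
qed (simp add: mp_dens_def)

lemma measurable_mp_dens [measurable]: "mp_dens \<in> borel_measurable borel"
  unfolding mp_dens_def by measurable

lemma mp_law_density: "mp_law c = density lborel (\<lambda>x. ennreal (mp_dens x))"
  by (simp add: mp_law_def mp_dens_def mp_a_def mp_b_def Let_def)

lemma mp_dens_mass: "has_bochner_integral lborel mp_dens 1"
proof -
  have "has_bochner_integral lborel (\<lambda>x. 1 / (2 * pi * c) * (indicator {mp_a<..<mp_b} x * (sqrt ((mp_b - x) * (x - mp_a)) / (x + 0))))
     (1 / (2 * pi * c) * (pi * ((mp_a + mp_b) / 2 + 0 - sqrt ((mp_a + 0) * (mp_b + 0)))))"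
    by (intro has_bochner_integral_mult_right mp_integral mp_ab) auto
  \<comment> \<open>Here \<open>c \<le> 1\<close> enters: the square root of
    \<open>mp_a * mp_b\<close> is \<open>1 - c\<close> and not its negative.\<close>
  also have "1 / (2 * pi * c) * (pi * ((mp_a + mp_b) / 2 + 0 - sqrt ((mp_a + 0) * (mp_b + 0)))) = 1"
    using c mp_ab(3,4) by (simp add: field_simps)
  also have "(\<lambda>x. 1 / (2 * pi * c) * (indicator {mp_a<..<mp_b} x * (sqrt ((mp_b - x) * (x - mp_a)) / (x + 0)))) = mp_dens"
    by (simp add: fun_eq_iff mp_dens_def)
  finally show ?thesis .
qed

lemma prob_space_mp_law: "prob_space (mp_law c)"
proof
  have "emeasure (mp_law c) (space (mp_law c)) = (\<integral>\<^sup>+x. ennreal (mp_dens x) \<partial>lborel)"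
    unfolding mp_law_density by (subst emeasure_density) auto
  also have "\<dots> = ennreal (integral\<^sup>L lborel mp_dens)"
    using mp_dens_mass mp_dens_nonneg by (intro nn_integral_eq_integral) (auto simp: has_bochner_integral_iff)
  finally show "emeasure (mp_law c) (space (mp_law c)) = 1"
    using mp_dens_mass by (simp add: has_bochner_integral_iff)
qed

lemma sets_mp_law: "sets (mp_law c) = sets borel" by (simp add: mp_law_density)

lemma AE_mp_law: "AE x in mp_law c. 0 \<le> x"
  unfolding mp_law_density
proof (subst AE_density)
  have "0 < mp_dens x \<longrightarrow> 0 \<le> x" for x
    using mp_ab(1) by (auto simp: mp_dens_def indicator_def split: if_splits)
  then show "AE x in lborel. 0 < ennreal (mp_dens x) \<longrightarrow> 0 \<le> x" by simp
qed simp

text \<open>Partial fractions reduce the transform to two values of \<open>mp_integral\<close>. The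
  result is the positive root of \<open>c * t * s^2 + (1 + t - c) * s = 1\<close>, and
  \<open>\<Delta>\<close> is the discriminant of this equation.\<close>

lemma mp_stieltjes_fixed_point:
  assumes t: "t > 0"
  defines "s \<equiv> integral\<^sup>L (mp_law c) (\<lambda>x. 1 / (x + t))"
  shows "s \<ge> 0" and "s * (1 + t - c * (1 - t * s)) = 1"
proof -
  let ?J = "\<lambda>y. pi * ((mp_a + mp_b) / 2 + y - sqrt ((mp_a + y) * (mp_b + y)))"
  define \<Delta> where "\<Delta> = (1 + t - c)\<^sup>2 + 4 * c * t"
  have J0: "?J 0 = 2 * pi * c" using c mp_ab(3,4) by (simp add: field_simps)
  have "(mp_a + t) * (mp_b + t) = mp_a * mp_b + t * (mp_a + mp_b) + t\<^sup>2" by (simp add: algebra_simps power2_eq_square)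
  also have "\<dots> = \<Delta>" unfolding mp_ab(3,4) \<Delta>_def by (simp add: algebra_simps power2_eq_square)
  finally have Jt: "?J t = pi * (1 + c + t - sqrt \<Delta>)" using mp_ab(3) by simp
  have "s = integral\<^sup>L lborel (\<lambda>x. mp_dens x * (1 / (x + t)))"
    unfolding s_def mp_law_density using mp_dens_nonneg by (subst integral_density) auto
  also have "(\<lambda>x. mp_dens x * (1 / (x + t))) = (\<lambda>x. 1 / (2 * pi * c * t) *
      (indicator {mp_a<..<mp_b} x * (sqrt ((mp_b - x) * (x - mp_a)) / (x + 0)) - indicator {mp_a<..<mp_b} x * (sqrt ((mp_b - x) * (x - mp_a)) / (x + t))))"
  proof
    fix x
    show "mp_dens x * (1 / (x + t)) = 1 / (2 * pi * c * t) *
      (indicator {mp_a<..<mp_b} x * (sqrt ((mp_b - x) * (x - mp_a)) / (x + 0)) - indicator {mp_a<..<mp_b} x * (sqrt ((mp_b - x) * (x - mp_a)) / (x + t)))"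
    proof (cases "x \<in> {mp_a<..<mp_b}")
      case True
      then have "x > 0" using mp_ab(1) by simp
      then have "1 / (2 * pi * c * x) * r * (1 / (x + t)) = 1 / (2 * pi * c * t) * (r / x - r / (x + t))" for r
        using t c by (simp add: divide_simps) (simp add: algebra_simps)
      then show ?thesis using True by (simp add: mp_dens_def)
    qed (simp add: mp_dens_def)
  qed
  also have "integral\<^sup>L lborel \<dots> = 1 / (2 * pi * c * t) * (?J 0 - ?J t)"
    using mp_integral[OF mp_ab(1,2), of 0] mp_integral[OF mp_ab(1,2), of t] t
    by (intro has_bochner_integral_integral_eq has_bochner_integral_mult_right has_bochner_integral_diff) auto
  also have "\<dots> = (sqrt \<Delta> - (1 + t - c)) / (2 * c * t)"
    unfolding J0 Jt using c t by (simp add: field_simps)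
  finally have s: "s = (sqrt \<Delta> - (1 + t - c)) / (2 * c * t)" .
  show "s \<ge> 0" unfolding s_def
    using AE_mp_law t by (intro integral_nonneg_AE) auto
  have \<Delta>: "\<Delta> \<ge> 0" unfolding \<Delta>_def using c t by simp
  have "2 * c * t * s + (1 + t - c) = sqrt \<Delta>" unfolding s using c t by simp
  then have "(2 * c * t * s + (1 + t - c))\<^sup>2 = \<Delta>" using \<Delta> by simp
  then have "4 * c * t * (s * (1 + t - c * (1 - t * s))) = 4 * c * t"
    unfolding \<Delta>_def by (simp add: power2_eq_square algebra_simps)
  then show "s * (1 + t - c * (1 - t * s)) = 1" using c t by simp
qed

end

subsection \<open>The Stieltjes transform determines the distribution\<close>

definition avg :: "(real \<Rightarrow> real) \<Rightarrow> real list \<Rightarrow> real" where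
  "avg \<phi> ls = (\<Sum>l\<leftarrow>ls. \<phi> l) / length ls"

text \<open>A test function is determined by the Stieltjes transform if its average over an
  empirical measure on the half line is close to its integral against \<open>\<mu>\<close> as soon as finitely
  many values of the two Stieltjes transforms are close. Keeping this deterministic avoids
  all measurability questions about eigenvalues.\<close>

definition close_on :: "real measure \<Rightarrow> real set \<Rightarrow> real \<Rightarrow> real list \<Rightarrow> bool" where
  "close_on \<mu> T \<delta> ls \<longleftrightarrow> ls \<noteq> [] \<and> (\<forall>l\<in>set ls. 0 \<le> l) \<and>
     (\<forall>t\<in>T. \<bar>avg (\<lambda>l. 1 / (l + t)) ls - integral\<^sup>L \<mu> (\<lambda>l. 1 / (l + t))\<bar> < \<delta>)"

definition determined :: "real measure \<Rightarrow> (real \<Rightarrow> real) \<Rightarrow> bool" where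
  "determined \<mu> \<phi> \<longleftrightarrow> integrable \<mu> \<phi> \<and> (\<forall>\<epsilon>>0. \<exists>T \<delta>. finite T \<and> T \<subseteq> {0<..} \<and> \<delta> > 0 \<and>
     (\<forall>ls. close_on \<mu> T \<delta> ls \<longrightarrow> \<bar>avg \<phi> ls - integral\<^sup>L \<mu> \<phi>\<bar> < \<epsilon>))"

lemma close_on_mono: "close_on \<mu> T \<delta> ls \<Longrightarrow> T' \<subseteq> T \<Longrightarrow> \<delta> \<le> \<delta>' \<Longrightarrow> close_on \<mu> T' \<delta>' ls"
  unfolding close_on_def by force

lemma avg_add: "avg (\<lambda>l. \<phi> l + \<psi> l) ls = avg \<phi> ls + avg \<psi> ls"
  by (simp add: avg_def sum_list_addf add_divide_distrib)

lemma avg_cmult: "avg (\<lambda>l. k * \<phi> l) ls = k * avg \<phi> ls"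
  by (simp add: avg_def sum_list_const_mult)

lemma avg_mono: "(\<And>l. l \<in> set ls \<Longrightarrow> \<phi> l \<le> \<psi> l) \<Longrightarrow> avg \<phi> ls \<le> avg \<psi> ls"
  unfolding avg_def by (intro divide_right_mono sum_list_mono) auto

lemma avg_const: "ls \<noteq> [] \<Longrightarrow> avg (\<lambda>_. k) ls = k"
  by (simp add: avg_def sum_list_triv)

lemma avg_diff_le:
  assumes "ls \<noteq> []" "\<And>l. l \<in> set ls \<Longrightarrow> \<bar>\<phi> l - \<psi> l\<bar> \<le> e" shows "\<bar>avg \<phi> ls - avg \<psi> ls\<bar> \<le> e"
proof -
  have "avg \<phi> ls \<le> avg (\<lambda>l. \<psi> l + e) ls" "avg \<psi> ls \<le> avg (\<lambda>l. \<phi> l + e) ls"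
    using assms(2) by (intro avg_mono; force simp: abs_le_iff)+
  then show ?thesis using assms(1) by (simp add: avg_add avg_const abs_le_iff)
qed

context
  fixes \<mu> :: "real measure"
  assumes \<mu>: "prob_space \<mu>" and sets_\<mu>: "sets \<mu> = sets borel" and nonneg: "AE x in \<mu>. 0 \<le> x"
begin

interpretation prob_space \<mu> by (rule \<mu>)

declare sets_\<mu> [measurable_cong]

lemma integrable_bounded:
  fixes \<phi> :: "real \<Rightarrow> real"
  assumes "\<phi> \<in> borel_measurable borel" "\<And>l. l \<ge> 0 \<Longrightarrow> \<bar>\<phi> l\<bar> \<le> B"
  shows "integrable \<mu> \<phi>"
proof (rule integrable_const_bound[where B = B])
  show "AE x in \<mu>. norm (\<phi> x) \<le> B" using nonneg by eventually_elim (use assms(2) in auto)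
qed (use assms(1) in measurable)

lemma determined_const: "determined \<mu> (\<lambda>_. k)"
  unfolding determined_def
  by (auto simp: prob_space close_on_def avg_const intro!: exI[of _ "{}"] exI[of _ 1])

lemma determined_add: assumes "determined \<mu> \<phi>" "determined \<mu> \<psi>" shows "determined \<mu> (\<lambda>l. \<phi> l + \<psi> l)"
  unfolding determined_def
proof (intro conjI allI impI)
  show "integrable \<mu> (\<lambda>l. \<phi> l + \<psi> l)" using assms by (auto simp: determined_def)
  fix \<epsilon> :: real assume "\<epsilon> > 0"
  then have e: "\<epsilon> / 2 > 0" by simp
  obtain T \<delta> where 1: "finite T" "T \<subseteq> {0<..}" "\<delta> > 0" "\<And>ls. close_on \<mu> T \<delta> ls \<Longrightarrow> \<bar>avg \<phi> ls - integral\<^sup>L \<mu> \<phi>\<bar> < \<epsilon> / 2"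
    using assms(1) e unfolding determined_def by meson
  obtain T' \<delta>' where 2: "finite T'" "T' \<subseteq> {0<..}" "\<delta>' > 0" "\<And>ls. close_on \<mu> T' \<delta>' ls \<Longrightarrow> \<bar>avg \<psi> ls - integral\<^sup>L \<mu> \<psi>\<bar> < \<epsilon> / 2"
    using assms(2) e unfolding determined_def by meson
  have "\<bar>avg (\<lambda>l. \<phi> l + \<psi> l) ls - (\<integral>l. \<phi> l + \<psi> l \<partial>\<mu>)\<bar> < \<epsilon>" if "close_on \<mu> (T \<union> T') (min \<delta> \<delta>') ls" for ls
  proof -
    have "\<bar>avg \<phi> ls - integral\<^sup>L \<mu> \<phi>\<bar> < \<epsilon> / 2" by (rule 1(4), rule close_on_mono[OF that]) auto
    moreover have "\<bar>avg \<psi> ls - integral\<^sup>L \<mu> \<psi>\<bar> < \<epsilon> / 2" by (rule 2(4), rule close_on_mono[OF that]) auto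
    moreover have "(\<integral>l. \<phi> l + \<psi> l \<partial>\<mu>) = integral\<^sup>L \<mu> \<phi> + integral\<^sup>L \<mu> \<psi>" using assms by (simp add: determined_def)
    ultimately show ?thesis unfolding avg_add by linarith
  qed
  then show "\<exists>T \<delta>. finite T \<and> T \<subseteq> {0<..} \<and> \<delta> > 0 \<and> (\<forall>ls. close_on \<mu> T \<delta> ls \<longrightarrow> \<bar>avg (\<lambda>l. \<phi> l + \<psi> l) ls - (\<integral>l. \<phi> l + \<psi> l \<partial>\<mu>)\<bar> < \<epsilon>)"
    using 1 2 by (intro exI[of _ "T \<union> T'"] exI[of _ "min \<delta> \<delta>'"]) auto
qed

lemma determined_cmult: assumes "determined \<mu> \<phi>" shows "determined \<mu> (\<lambda>l. k * \<phi> l)"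
  unfolding determined_def
proof (intro conjI allI impI)
  show "integrable \<mu> (\<lambda>l. k * \<phi> l)" using assms by (auto simp: determined_def)
  fix \<epsilon> :: real assume "\<epsilon> > 0"
  then have e: "\<epsilon> / (\<bar>k\<bar> + 1) > 0" by simp
  obtain T \<delta> where 1: "finite T" "T \<subseteq> {0<..}" "\<delta> > 0" "\<And>ls. close_on \<mu> T \<delta> ls \<Longrightarrow> \<bar>avg \<phi> ls - integral\<^sup>L \<mu> \<phi>\<bar> < \<epsilon> / (\<bar>k\<bar> + 1)"
    using assms(1) e unfolding determined_def by meson
  have "\<bar>avg (\<lambda>l. k * \<phi> l) ls - (\<integral>l. k * \<phi> l \<partial>\<mu>)\<bar> < \<epsilon>" if "close_on \<mu> T \<delta> ls" for ls
  proof -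
    have "\<bar>avg (\<lambda>l. k * \<phi> l) ls - (\<integral>l. k * \<phi> l \<partial>\<mu>)\<bar> = \<bar>k\<bar> * \<bar>avg \<phi> ls - integral\<^sup>L \<mu> \<phi>\<bar>"
      unfolding avg_cmult by (simp add: abs_mult[symmetric] right_diff_distrib)
    also have "\<dots> \<le> \<bar>k\<bar> * (\<epsilon> / (\<bar>k\<bar> + 1))" using 1(4)[OF that] by (intro mult_left_mono) auto
    also have "\<dots> < \<epsilon>" using \<open>\<epsilon> > 0\<close> by (simp add: field_simps)
    finally show ?thesis .
  qed
  then show "\<exists>T \<delta>. finite T \<and> T \<subseteq> {0<..} \<and> \<delta> > 0 \<and> (\<forall>ls. close_on \<mu> T \<delta> ls \<longrightarrow> \<bar>avg (\<lambda>l. k * \<phi> l) ls - (\<integral>l. k * \<phi> l \<partial>\<mu>)\<bar> < \<epsilon>)"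
    using 1 by blast
qed

lemma determined_sum:
  assumes "finite A" "\<And>i. i \<in> A \<Longrightarrow> determined \<mu> (\<phi> i)" shows "determined \<mu> (\<lambda>l. \<Sum>i\<in>A. \<phi> i l)"
  using assms by (induction A rule: finite_induct) (auto simp: determined_const intro!: determined_add)

text \<open>An error that is uniform on the half line passes to both averages, because the lists in
  \<open>close_on\<close> are nonnegative and \<open>\<mu>\<close> is carried by the half
  line.\<close>

lemma determined_limit:
  assumes m: "\<phi> \<in> borel_measurable borel"
    and lim: "\<And>e. e > 0 \<Longrightarrow> \<exists>\<psi>. determined \<mu> \<psi> \<and> (\<forall>l\<ge>0. \<bar>\<phi> l - \<psi> l\<bar> \<le> e)"
  shows "determined \<mu> \<phi>"
  unfolding determined_def
proof (intro conjI allI impI)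
  have mm: "\<phi> \<in> borel_measurable \<mu>" using m by measurable
  obtain \<psi>1 where 1: "determined \<mu> \<psi>1" "\<And>l. l \<ge> 0 \<Longrightarrow> \<bar>\<phi> l - \<psi>1 l\<bar> \<le> 1" using lim[of 1] by auto
  have i1: "integrable \<mu> \<psi>1" using 1(1) by (simp add: determined_def)
  show i: "integrable \<mu> \<phi>"
  proof (rule Bochner_Integration.integrable_bound[of _ "\<lambda>l. \<bar>\<psi>1 l\<bar> + 1"])
    show "AE l in \<mu>. norm (\<phi> l) \<le> norm (\<bar>\<psi>1 l\<bar> + 1)" using nonneg
    proof eventually_elim
      case (elim l)
      then show ?case using 1(2)[of l] by simp
    qed
  qed (use i1 mm in auto)
  fix \<epsilon> :: real assume "\<epsilon> > 0"
  then have e: "\<epsilon> / 3 > 0" by simp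
  obtain \<psi> where \<psi>: "determined \<mu> \<psi>" "\<And>l. l \<ge> 0 \<Longrightarrow> \<bar>\<phi> l - \<psi> l\<bar> \<le> \<epsilon> / 3" using lim[OF e] by auto
  obtain T \<delta> where T: "finite T" "T \<subseteq> {0<..}" "\<delta> > 0" "\<And>ls. close_on \<mu> T \<delta> ls \<Longrightarrow> \<bar>avg \<psi> ls - integral\<^sup>L \<mu> \<psi>\<bar> < \<epsilon> / 3"
    using \<psi>(1) e unfolding determined_def by meson
  have i\<psi>: "integrable \<mu> \<psi>" using \<psi>(1) by (simp add: determined_def)
  have d: "\<bar>integral\<^sup>L \<mu> \<phi> - integral\<^sup>L \<mu> \<psi>\<bar> \<le> \<epsilon> / 3"
  proof -
    have "\<bar>integral\<^sup>L \<mu> \<phi> - integral\<^sup>L \<mu> \<psi>\<bar> = \<bar>\<integral>l. \<phi> l - \<psi> l \<partial>\<mu>\<bar>" using i i\<psi> by simp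
    also have "\<dots> \<le> (\<integral>l. \<bar>\<phi> l - \<psi> l\<bar> \<partial>\<mu>)" by (rule integral_abs_bound)
    also have "\<dots> \<le> (\<integral>l. \<epsilon> / 3 \<partial>\<mu>)"
    proof (rule integral_mono_AE)
      show "AE l in \<mu>. \<bar>\<phi> l - \<psi> l\<bar> \<le> \<epsilon> / 3" using nonneg by eventually_elim (rule \<psi>(2))
    qed (use i i\<psi> in auto)
    finally show ?thesis by (simp add: prob_space)
  qed
  have "\<bar>avg \<phi> ls - integral\<^sup>L \<mu> \<phi>\<bar> < \<epsilon>" if "close_on \<mu> T \<delta> ls" for ls
  proof -
    have "\<bar>avg \<phi> ls - avg \<psi> ls\<bar> \<le> \<epsilon> / 3"
      using that \<psi>(2) by (intro avg_diff_le) (auto simp: close_on_def)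
    then show ?thesis using T(4)[OF that] d by linarith
  qed
  then show "\<exists>T \<delta>. finite T \<and> T \<subseteq> {0<..} \<and> \<delta> > 0 \<and> (\<forall>ls. close_on \<mu> T \<delta> ls \<longrightarrow> \<bar>avg \<phi> ls - integral\<^sup>L \<mu> \<phi>\<bar> < \<epsilon>)"
    using T by blast
qed

lemma determined_stieltjes: "t > 0 \<Longrightarrow> determined \<mu> (\<lambda>l. 1 / (l + t))"
  unfolding determined_def
proof (intro conjI allI impI)
  assume t: "t > 0"
  show "integrable \<mu> (\<lambda>l. 1 / (l + t))"
    by (rule integrable_bounded[where B = "1 / t"]) (use t in \<open>auto simp: field_simps\<close>)
  fix \<epsilon> :: real assume "\<epsilon> > 0"
  then show "\<exists>T \<delta>. finite T \<and> T \<subseteq> {0<..} \<and> \<delta> > 0 \<and> (\<forall>ls. close_on \<mu> T \<delta> ls \<longrightarrow> \<bar>avg (\<lambda>l. 1 / (l + t)) ls - (\<integral>l. 1 / (l + t) \<partial>\<mu>)\<bar> < \<epsilon>)"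
    using t by (intro exI[of _ "{t}"] exI[of _ \<epsilon>]) (auto simp: close_on_def)
qed

text \<open>By partial fractions a product of resolvent functions with distinct parameters is a linear
  combination of such functions; powers are limits of such products.\<close>

lemma determined_prod:
  assumes "finite S" "S \<noteq> {}" "S \<subseteq> {0<..}"
  shows "\<exists>\<psi>. determined \<mu> \<psi> \<and> (\<forall>l\<ge>0. \<psi> l = (\<Prod>t\<in>S. 1 / (l + t)))"
  using assms
proof (induction "card S" arbitrary: S rule: less_induct)
  case less
  obtain p where p: "p \<in> S" using less.prems by blast
  show ?case
  proof (cases "S = {p}")
    case True
    then show ?thesis using less.prems determined_stieltjes[of p] by (intro exI[of _ "\<lambda>l. 1 / (l + p)"]) auto
  next
    case False
    then obtain q where q: "q \<in> S" "q \<noteq> p" using p by blast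
    let ?P = "S - {q}" and ?Q = "S - {p}"
    have cP: "card ?P < card S" "finite ?P" "?P \<noteq> {}" "?P \<subseteq> {0<..}"
      using p q less.prems by (auto intro: card_Diff1_less simp del: card_Diff_insert card_Diff_singleton)
    have cQ: "card ?Q < card S" "finite ?Q" "?Q \<noteq> {}" "?Q \<subseteq> {0<..}"
      using p q less.prems by (auto intro: card_Diff1_less simp del: card_Diff_insert card_Diff_singleton)
    obtain \<psi> where \<psi>1: "determined \<mu> \<psi>" "\<And>l. l \<ge> 0 \<Longrightarrow> \<psi> l = (\<Prod>t\<in>?P. 1 / (l + t))"
      using less.hyps[OF cP] by blast
    obtain \<psi>' where \<psi>2: "determined \<mu> \<psi>'" "\<And>l. l \<ge> 0 \<Longrightarrow> \<psi>' l = (\<Prod>t\<in>?Q. 1 / (l + t))"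
      using less.hyps[OF cQ] by blast
    note \<psi> = \<psi>1 \<psi>2
    have "determined \<mu> (\<lambda>l. 1 / (q - p) * (\<psi> l + (- 1) * \<psi>' l))"
      by (intro determined_cmult determined_add \<psi>)
    moreover have "1 / (q - p) * (\<psi> l + (- 1) * \<psi>' l) = (\<Prod>t\<in>S. 1 / (l + t))" if l: "l \<ge> 0" for l
    proof -
      have pq: "p > 0" "q > 0" using p q less.prems(3) by auto
      define R where "R = S - {p, q}"
      have R: "finite R" "p \<notin> R" "q \<notin> R" using less.prems(1) by (auto simp: R_def)
      have e: "?P = insert p R" "?Q = insert q R" "S = insert p (insert q R)" using p q by (auto simp: R_def)
      define G where "G = (\<Prod>t\<in>R. 1 / (l + t))"
      have 1: "\<psi> l = 1 / (l + p) * G" unfolding \<psi>(2)[OF l] e(1) prod.insert[OF R(1,2)] G_def ..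
      have 2: "\<psi>' l = 1 / (l + q) * G" unfolding \<psi>(4)[OF l] e(2) prod.insert[OF R(1,3)] G_def ..
      have R2: "finite (insert q R)" "p \<notin> insert q R" using R q(2) by auto
      have 3: "(\<Prod>t\<in>S. 1 / (l + t)) = 1 / (l + p) * (1 / (l + q) * G)"
        by (subst e(3)) (simp only: prod.insert[OF R2] prod.insert[OF R(1,3)] G_def)
      have gen: "1 / (q - p) * (1 / u * G + (- 1) * (1 / v * G)) = 1 / u * (1 / v * G)" if "u \<noteq> 0" "v \<noteq> 0" "v - u = q - p" for u v
      proof -
        have "1 / u - 1 / v = (v - u) / (u * v)" using that by (simp add: field_simps)
        then have "1 / u * G + (- 1) * (1 / v * G) = (q - p) / (u * v) * G"
          using that(3) by (simp add: left_diff_distrib[symmetric] del: times_divide_eq_left)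
        then show ?thesis using q(2) that by simp
      qed
      show ?thesis unfolding 1 2 3 by (rule gen) (use l pq in auto)
    qed
    ultimately show ?thesis by blast
  qed
qed

lemma determined_power: "determined \<mu> (\<lambda>l. (1 / (l + 1)) ^ k)"
proof (rule determined_limit)
  fix e :: real assume e: "e > 0"
  show "\<exists>\<psi>. determined \<mu> \<psi> \<and> (\<forall>l\<ge>0. \<bar>(1 / (l + 1)) ^ k - \<psi> l\<bar> \<le> e)"
  proof (cases "k = 0")
    case True
    then show ?thesis using determined_const[of 1] e by (intro exI[of _ "\<lambda>_. 1"]) auto
  next
    case False
    \<comment> \<open>The k parameters \<open>1 + i * h\<close> differ from 1 by at most
      \<open>k * h\<close> each, and k such errors add up to e. They are distinct, as
      \<open>determined_prod\<close> requires a set of parameters.\<close>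
    define h where "h = e / (real k * real k)"
    have h: "h > 0" using e False by (simp add: h_def)
    let ?t = "\<lambda>i. 1 + real i * h"
    have inj: "inj_on ?t {..<k}" using h by (auto simp: inj_on_def)
    have t0: "?t i > 0" for i using h by (simp add: add_pos_nonneg)
    then obtain \<psi> where \<psi>: "determined \<mu> \<psi>" "\<And>l. l \<ge> 0 \<Longrightarrow> \<psi> l = (\<Prod>t\<in>?t ` {..<k}. 1 / (l + t))"
      using determined_prod[of "?t ` {..<k}"] False by auto
    have "\<bar>(1 / (l + 1)) ^ k - \<psi> l\<bar> \<le> e" if l: "l \<ge> 0" for l
    proof -
      have "\<psi> l = (\<Prod>i<k. 1 / (l + ?t i))" unfolding \<psi>(2)[OF l] by (subst prod.reindex[OF inj]) simp
      then have "\<bar>(1 / (l + 1)) ^ k - \<psi> l\<bar> = norm ((\<Prod>i<k. 1 / (l + 1)) - (\<Prod>i<k. 1 / (l + ?t i)))" by simp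
      also have "\<dots> \<le> (\<Sum>i<k. norm (1 / (l + 1) - 1 / (l + ?t i)))"
        using l h by (intro norm_prod_diff) (auto simp: divide_simps)
      also have "\<dots> \<le> (\<Sum>i<k. real k * h)"
      proof (intro sum_mono)
        fix i assume i: "i \<in> {..<k}"
        have gen: "\<bar>1 / u - 1 / v\<bar> \<le> v - u" if "1 \<le> u" "u \<le> v" for u v :: real
        proof -
          have "u * v \<ge> 1" using that mult_mono[of 1 u 1 v] by simp
          moreover have "1 / u - 1 / v = (v - u) / (u * v)" using that by (simp add: field_simps)
          ultimately show ?thesis
            using that divide_left_mono[of 1 "u * v" "v - u"] by simp
        qed
        have ih: "0 \<le> real i * h" using h by simp
        have "norm (1 / (l + 1) - 1 / (l + ?t i)) \<le> (l + ?t i) - (l + 1)"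
          unfolding real_norm_def by (rule gen) (use l ih in linarith)+
        also have "\<dots> = real i * h" by simp
        also have "\<dots> \<le> real k * h" using i h by (auto intro!: mult_right_mono)
        finally show "norm (1 / (l + 1) - 1 / (l + ?t i)) \<le> real k * h" .
      qed
      also have "\<dots> = e" using False by (simp add: h_def)
      finally show ?thesis .
    qed
    then show ?thesis using \<psi>(1) by blast
  qed
qed measurable

text \<open>The half line is mapped into the compact interval [0, 1], where the function is
  uniformly close to a polynomial, and polynomials are combinations of the powers in
  \<open>determined_power\<close>.\<close>

lemma determined_continuous:
  assumes "continuous_on UNIV \<psi>" shows "determined \<mu> (\<lambda>l. \<psi> (1 / (l + 1)))"
proof (rule determined_limit)
  have [measurable]: "\<psi> \<in> borel_measurable borel" using assms by (rule borel_measurable_continuous_onI)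
  show "(\<lambda>l. \<psi> (1 / (l + 1))) \<in> borel_measurable borel" by measurable
  fix e :: real assume e: "e > 0"
  have "continuous_on {0..1} \<psi>" using assms by (rule continuous_on_subset) simp
  then obtain g where g: "real_polynomial_function g" "\<And>x. x \<in> {0..1} \<Longrightarrow> \<bar>\<psi> x - g x\<bar> < e"
    using Stone_Weierstrass_real_polynomial_function[of "{0..1}" \<psi> e] e by auto
  obtain a n where an: "g = (\<lambda>x. \<Sum>i\<le>n. a i * x ^ i)" using g(1) real_polynomial_function_iff_sum by blast
  have "determined \<mu> (\<lambda>l. g (1 / (l + 1)))" unfolding an by (intro determined_sum determined_cmult determined_power) auto
  moreover have "\<bar>\<psi> (1 / (l + 1)) - g (1 / (l + 1))\<bar> \<le> e" if "l \<ge> 0" for l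
    using g(2)[of "1 / (l + 1)"] that by (simp add: field_simps)
  ultimately show "\<exists>\<psi>'. determined \<mu> \<psi>' \<and> (\<forall>l\<ge>0. \<bar>\<psi> (1 / (l + 1)) - \<psi>' l\<bar> \<le> e)" by blast
qed

text \<open>For \<open>0 \<le> r < s\<close> a continuous cutoff, 1 on [0, r] and 0 beyond s. It is
  linear in \<open>1 / (l + 1)\<close> in between, and not in l, so that it is a continuous function
  of that variable.\<close>

definition ramp :: "real \<Rightarrow> real \<Rightarrow> real \<Rightarrow> real" where
  "ramp r s l = max 0 (min 1 ((1 / (l + 1) - 1 / (s + 1)) / (1 / (r + 1) - 1 / (s + 1))))"

lemma determined_ramp: "determined \<mu> (ramp r s)"
proof -
  have "continuous_on UNIV (\<lambda>u. max 0 (min 1 ((u - 1 / (s + 1)) / (1 / (r + 1) - 1 / (s + 1)))))"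
    by (cases "1 / (r + 1) - 1 / (s + 1) = 0") (auto intro!: continuous_intros)
  from determined_continuous[OF this] show ?thesis unfolding ramp_def[abs_def] .
qed

lemma ramp_bounds:
  assumes rs: "0 \<le> r" "r < s" and l: "l \<ge> 0"
  shows "indicator {..r} l \<le> ramp r s l" "ramp r s l \<le> indicator {..s} l"
proof -
  have d: "1 / (r + 1) - 1 / (s + 1) > 0"
    using rs divide_strict_left_mono[of "r + 1" "s + 1" 1] by simp
  show "indicator {..r} l \<le> ramp r s l"
  proof (cases "l \<le> r")
    case True
    then have "1 / (l + 1) \<ge> 1 / (r + 1)" using l rs by (intro divide_left_mono) auto
    then show ?thesis using True d by (simp add: ramp_def)
  qed (simp add: ramp_def)
  show "ramp r s l \<le> indicator {..s} l"
  proof (cases "l \<le> s")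
    case False
    then have "1 / (l + 1) \<le> 1 / (s + 1)" using l rs by (intro divide_left_mono) auto
    then have "(1 / (l + 1) - 1 / (s + 1)) / (1 / (r + 1) - 1 / (s + 1)) \<le> 0" using d by (simp add: divide_nonpos_pos)
    then show ?thesis using False by (simp add: ramp_def)
  qed (simp add: ramp_def)
qed

lemma integral_indicator_cdf: "integral\<^sup>L \<mu> (indicator {..r}) = cdf \<mu> r"
proof -
  have "space \<mu> = UNIV" using sets_eq_imp_space_eq[OF sets_\<mu>] by simp
  then show ?thesis by (simp add: cdf_def)
qed

lemma integrable_indicator: "integrable \<mu> (indicator {..r} :: real \<Rightarrow> real)"
  by (rule integrable_bounded[where B = 1]) (auto simp: indicator_def)

lemma cdf_neg: "r < 0 \<Longrightarrow> cdf \<mu> r = 0"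
proof -
  assume "r < 0"
  then have "integral\<^sup>L \<mu> (indicator {..r}) = integral\<^sup>L \<mu> (\<lambda>_. 0 :: real)"
    using nonneg by (intro integral_cong_AE) (auto elim!: eventually_mono simp: indicator_def)
  then show ?thesis by (simp only: integral_indicator_cdf) simp
qed

lemma ramp_integral:
  assumes rs: "0 \<le> r" "r < s"
  shows "cdf \<mu> r \<le> integral\<^sup>L \<mu> (ramp r s)" "integral\<^sup>L \<mu> (ramp r s) \<le> cdf \<mu> s"
proof -
  have i: "integrable \<mu> (ramp r s)" using determined_ramp by (simp add: determined_def)
  show "cdf \<mu> r \<le> integral\<^sup>L \<mu> (ramp r s)"
    unfolding integral_indicator_cdf[symmetric]
    by (rule integral_mono_AE[OF integrable_indicator i]) (use nonneg in eventually_elim, rule ramp_bounds(1)[OF rs])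
  show "integral\<^sup>L \<mu> (ramp r s) \<le> cdf \<mu> s"
    unfolding integral_indicator_cdf[symmetric]
    by (rule integral_mono_AE[OF i integrable_indicator]) (use nonneg in eventually_elim, rule ramp_bounds(2)[OF rs])
qed

text \<open>The indicator lies below the ramp from r to s, and continuity lets s > r be so close to
  r that this costs at most half of \<open>\<epsilon>\<close>; the other half is for the Stieltjes
  approximation.\<close>

lemma close_on_cdf_upper:
  assumes r: "r \<ge> 0" and cont: "isCont (cdf \<mu>) r" and e: "\<epsilon> > 0"
  shows "\<exists>T \<delta>. finite T \<and> T \<subseteq> {0<..} \<and> \<delta> > 0 \<and> (\<forall>ls. close_on \<mu> T \<delta> ls \<longrightarrow> avg (indicator {..r}) ls \<le> cdf \<mu> r + \<epsilon>)"
proof -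
  have e2: "\<epsilon> / 2 > 0" using e by simp
  obtain h where h: "h > 0" "\<And>x. \<bar>x - r\<bar> < h \<Longrightarrow> \<bar>cdf \<mu> x - cdf \<mu> r\<bar> < \<epsilon> / 2"
    using cont e2 unfolding continuous_at_eps_delta dist_real_def by meson
  define s where "s = r + h / 2"
  have s: "r < s" "\<bar>s - r\<bar> < h" using h by (auto simp: s_def)
  obtain T \<delta> where T: "finite T" "T \<subseteq> {0<..}" "\<delta> > 0" "\<And>ls. close_on \<mu> T \<delta> ls \<Longrightarrow> \<bar>avg (ramp r s) ls - integral\<^sup>L \<mu> (ramp r s)\<bar> < \<epsilon> / 2"
    using determined_ramp[of r s] e2 unfolding determined_def by meson
  have "avg (indicator {..r}) ls \<le> cdf \<mu> r + \<epsilon>" if "close_on \<mu> T \<delta> ls" for ls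
  proof -
    have "avg (indicator {..r}) ls \<le> avg (ramp r s) ls"
      using that ramp_bounds(1)[OF r s(1)] by (intro avg_mono) (auto simp: close_on_def)
    then show ?thesis using T(4)[OF that] ramp_integral(2)[OF r s(1)] h(2)[OF s(2)] by linarith
  qed
  then show ?thesis using T by blast
qed

lemma close_on_cdf_lower:
  assumes cont: "isCont (cdf \<mu>) r" and e: "\<epsilon> > 0"
  shows "\<exists>T \<delta>. finite T \<and> T \<subseteq> {0<..} \<and> \<delta> > 0 \<and> (\<forall>ls. close_on \<mu> T \<delta> ls \<longrightarrow> cdf \<mu> r \<le> avg (indicator {..r}) ls + \<epsilon>)"
proof -
  have e2: "\<epsilon> / 2 > 0" using e by simp
  obtain h where h: "h > 0" "\<And>x. \<bar>x - r\<bar> < h \<Longrightarrow> \<bar>cdf \<mu> x - cdf \<mu> r\<bar> < \<epsilon> / 2"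
    using cont e2 unfolding continuous_at_eps_delta dist_real_def by meson
  define s where "s = r - h / 2"
  have s: "s < r" "\<bar>s - r\<bar> < h" using h by (auto simp: s_def)
  show ?thesis
  proof (cases "s < 0")
    \<comment> \<open>The ramp needs \<open>0 \<le> s\<close>. Below 0 the distribution function
      vanishes, so continuity already makes \<open>cdf \<mu> r\<close> small.\<close>
    case True
    have "cdf \<mu> r \<le> avg (indicator {..r}) ls + \<epsilon>" for ls
    proof -
      have "0 \<le> avg (indicator {..r}) ls" unfolding avg_def by (intro divide_nonneg_nonneg sum_list_nonneg) auto
      then show ?thesis using h(2)[OF s(2)] cdf_neg[OF True] e by linarith
    qed
    then show ?thesis by (intro exI[of _ "{}"] exI[of _ 1]) auto
  next
    case False
    then have s0: "0 \<le> s" by simp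
    obtain T \<delta> where T: "finite T" "T \<subseteq> {0<..}" "\<delta> > 0" "\<And>ls. close_on \<mu> T \<delta> ls \<Longrightarrow> \<bar>avg (ramp s r) ls - integral\<^sup>L \<mu> (ramp s r)\<bar> < \<epsilon> / 2"
      using determined_ramp[of s r] e2 unfolding determined_def by meson
    have "cdf \<mu> r \<le> avg (indicator {..r}) ls + \<epsilon>" if "close_on \<mu> T \<delta> ls" for ls
    proof -
      have "avg (ramp s r) ls \<le> avg (indicator {..r}) ls"
        using that ramp_bounds(2)[OF s0 s(1)] by (intro avg_mono) (auto simp: close_on_def)
      then show ?thesis using T(4)[OF that] ramp_integral(1)[OF s0 s(1)] h(2)[OF s(2)] by linarith
    qed
    then show ?thesis using T by blast
  qed
qed

lemma close_on_cdf:
  assumes cont: "isCont (cdf \<mu>) r" and e: "\<epsilon> > 0"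
  shows "\<exists>T \<delta>. finite T \<and> T \<subseteq> {0<..} \<and> \<delta> > 0 \<and> (\<forall>ls. close_on \<mu> T \<delta> ls \<longrightarrow> \<bar>avg (indicator {..r}) ls - cdf \<mu> r\<bar> \<le> \<epsilon>)"
proof (cases "r < 0")
  case True
  \<comment> \<open>Even with no test points \<open>close_on\<close> says that the list is
    nonnegative, which settles the case of negative r.\<close>
  have "avg (indicator {..r}) ls = 0" if "close_on \<mu> {} 1 ls" for ls
  proof -
    have "avg (indicator {..r}) ls \<le> avg (\<lambda>_. 0) ls" "avg (\<lambda>_. 0) ls \<le> avg (indicator {..r}) ls"
      using that True by (intro avg_mono; force simp: close_on_def indicator_def)+
    then have "avg (indicator {..r}) ls = avg (\<lambda>_. 0) ls" by (rule antisym)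
    then show ?thesis by (simp add: avg_def)
  qed
  then show ?thesis using cdf_neg[OF True] e by (intro exI[of _ "{}"] exI[of _ 1]) auto
next
  case False
  then have r: "r \<ge> 0" by simp
  obtain T \<delta> where 1: "finite T" "T \<subseteq> {0<..}" "\<delta> > 0" "\<And>ls. close_on \<mu> T \<delta> ls \<Longrightarrow> avg (indicator {..r}) ls \<le> cdf \<mu> r + \<epsilon>"
    using close_on_cdf_upper[OF r cont e] by blast
  obtain T' \<delta>' where 2: "finite T'" "T' \<subseteq> {0<..}" "\<delta>' > 0" "\<And>ls. close_on \<mu> T' \<delta>' ls \<Longrightarrow> cdf \<mu> r \<le> avg (indicator {..r}) ls + \<epsilon>"
    using close_on_cdf_lower[OF cont e] by blast
  have "\<bar>avg (indicator {..r}) ls - cdf \<mu> r\<bar> \<le> \<epsilon>" if "close_on \<mu> (T \<union> T') (min \<delta> \<delta>') ls" for ls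
  proof -
    have "close_on \<mu> T \<delta> ls" "close_on \<mu> T' \<delta>' ls" by (rule close_on_mono[OF that]; simp)+
    then show ?thesis using 1(4) 2(4) by (simp add: abs_le_iff) (metis add.commute diff_le_eq)
  qed
  then show ?thesis using 1 2 by (intro exI[of _ "T \<union> T'"] exI[of _ "min \<delta> \<delta>'"]) auto
qed

end

subsection \<open>Limits in probability\<close>

text \<open>A set that is not measurable has \<open>measure\<close> 0, so bounding a measurable
  superset covers every set. Events about eigenvalues are handled this way.\<close>

lemma (in finite_measure) measure_le_superset:
  assumes "A \<subseteq> B" "B \<in> sets M" shows "measure M A \<le> measure M B"
  by (cases "A \<in> sets M") (use assms in \<open>auto intro: finite_measure_mono simp: measure_notin_sets\<close>)

lemma tendsto_in_probI:
  assumes "\<And>\<epsilon>. \<epsilon> > 0 \<Longrightarrow> \<exists>b. b \<longlonglongrightarrow> 0 \<and>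
    (\<forall>\<^sub>F n in sequentially. measure (M n) {\<omega> \<in> space (M n). \<bar>X n \<omega> - l\<bar> > \<epsilon>} \<le> b n)"
  shows "tendsto_in_prob M X l"
  unfolding tendsto_in_prob_def
proof (intro allI impI)
  fix \<epsilon> :: real assume "\<epsilon> > 0"
  then obtain b where b: "b \<longlonglongrightarrow> 0"
    "\<forall>\<^sub>F n in sequentially. measure (M n) {\<omega> \<in> space (M n). \<bar>X n \<omega> - l\<bar> > \<epsilon>} \<le> b n" using assms by blast
  show "(\<lambda>n. measure (M n) {\<omega> \<in> space (M n). \<bar>X n \<omega> - l\<bar> > \<epsilon>}) \<longlonglongrightarrow> 0"
    by (rule tendsto_sandwich[OF _ b(2) tendsto_const b(1)]) simp
qed

section \<open>Deviation bounds for a single LKJ matrix\<close>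

context
  fixes N :: "'a measure" and X :: "'a \<Rightarrow> real mat" and h :: real and n :: nat and \<nu> :: real
  assumes h: "h > 0" and N: "prob_space N" and X: "X \<in> measurable N (lkj n h)"
    and law: "distr N (lkj n h) X = lkj n h" and n1: "n \<ge> 1" and \<nu>: "\<nu> = real n + 2 * h - 1"
begin

interpretation prob_space N by (rule N)

lemma \<nu>_gt: "\<nu> > real n - 1" "\<nu> > 0" using h n1 \<nu> by auto

lemma measurable_offdiag_lkj: "offdiag n \<in> measurable (lkj n h) (Pi\<^sub>M (upper_idx n) (\<lambda>_. borel))"
  using measurable_offdiag by (subst measurable_cong_sets[OF sets_lkj refl])

lemma measurable_coords [measurable]: "(\<lambda>\<omega>. offdiag n (X \<omega>)) \<in> measurable N (Pi\<^sub>M (upper_idx n) (\<lambda>_. borel))"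
  by (rule measurable_compose[OF X measurable_offdiag_lkj])

lemma distr_coords: "distr N (Pi\<^sub>M (upper_idx n) (\<lambda>_. borel)) (\<lambda>\<omega>. offdiag n (X \<omega>)) = corr_law \<nu> n"
proof -
  have "distr (distr N (lkj n h) X) (Pi\<^sub>M (upper_idx n) (\<lambda>_. borel)) (offdiag n) = corr_law \<nu> n"
    unfolding law \<nu> by (rule distr_offdiag_lkj[OF h])
  then show ?thesis by (simp add: distr_distr[OF measurable_offdiag_lkj X] comp_def)
qed

lemma coords_corr: "\<omega> \<in> space N \<Longrightarrow> X \<omega> \<in> corr_mats n"
  using measurable_space[OF X] by (simp add: space_lkj)

lemma coords_psd:
  assumes "\<omega> \<in> space N" shows "psd_fun n (corr_fun (offdiag n (X \<omega>)))"
proof -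
  have C: "X \<omega> \<in> corr_mats n" by (rule coords_corr[OF assms])
  then have "psd_fun n (\<lambda>i j. X \<omega> $$ (i, j))" using psd_mat_iff[of "X \<omega>" n] by (simp add: corr_mats_def)
  then show ?thesis by (simp add: psd_fun_def entry_corr_fun[OF C])
qed

lemma integral_coords:
  assumes "F \<in> borel_measurable (Pi\<^sub>M (upper_idx n) (\<lambda>_. borel))"
  shows "(\<integral>\<omega>. F (offdiag n (X \<omega>)) \<partial>N) = integral\<^sup>L (corr_law \<nu> n) (F :: _ \<Rightarrow> real)"
    and "integrable N (\<lambda>\<omega>. F (offdiag n (X \<omega>))) \<longleftrightarrow> integrable (corr_law \<nu> n) F"
  unfolding distr_coords[symmetric]
  using integral_distr[OF measurable_coords assms] integrable_distr_eq[OF measurable_coords assms] by simp_all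

text \<open>The exceptional set is an arbitrary subset of the space, so it may be described by the
  matrix and not by its coordinates; it is compared with a measurable event about F.\<close>

lemma coords_chebyshev:
  assumes F: "F \<in> borel_measurable (Pi\<^sub>M (upper_idx n) (\<lambda>_. borel))"
    and B: "\<And>x. psd_fun n (corr_fun x) \<Longrightarrow> \<bar>F x\<bar> \<le> B" and d: "\<delta> > 0"
    and A: "\<And>\<omega>. \<omega> \<in> space N \<Longrightarrow> \<omega> \<in> A \<Longrightarrow> \<delta> \<le> \<bar>F (offdiag n (X \<omega>))\<bar>" "A \<subseteq> space N"
  shows "measure N A \<le> (\<integral>x. (F x)\<^sup>2 \<partial>corr_law \<nu> n) / \<delta>\<^sup>2"
proof -
  have F2: "(\<lambda>x. (F x)\<^sup>2) \<in> borel_measurable (Pi\<^sub>M (upper_idx n) (\<lambda>_. borel))" using F by measurable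
  have FX [measurable]: "(\<lambda>\<omega>. F (offdiag n (X \<omega>))) \<in> borel_measurable N" by (rule measurable_compose[OF measurable_coords F])
  have "\<bar>(F x)\<^sup>2\<bar> \<le> B\<^sup>2" if "psd_fun n (corr_fun x)" for x
    using power_mono[OF B[OF that], of 2] by simp
  then have "integrable N (\<lambda>\<omega>. (F (offdiag n (X \<omega>)))\<^sup>2)"
    unfolding integral_coords(2)[OF F2] using \<nu>_gt by (intro integrable_corr_law F2)
  from second_moment_method[OF FX this d]
  have "measure N {\<omega> \<in> space N. \<delta> \<le> \<bar>F (offdiag n (X \<omega>))\<bar>} \<le> (\<integral>x. (F x)\<^sup>2 \<partial>corr_law \<nu> n) / \<delta>\<^sup>2"
    by (simp add: integral_coords(1)[OF F2])
  moreover have "measure N A \<le> measure N {\<omega> \<in> space N. \<delta> \<le> \<bar>F (offdiag n (X \<omega>))\<bar>}"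
    by (rule measure_le_superset) (use A in auto)
  ultimately show ?thesis by simp
qed

lemma frob_offsq:
  assumes "\<omega> \<in> space N" shows "(frob_norm (X \<omega> - 1\<^sub>m n))\<^sup>2 = 2 * offsq n (offdiag n (X \<omega>))"
proof -
  let ?x = "offdiag n (X \<omega>)"
  have C: "X \<omega> \<in> corr_mats n" by (rule coords_corr[OF assms])
  have e: "((X \<omega> - 1\<^sub>m n) $$ (i, j))\<^sup>2 = (corr_fun ?x i j)\<^sup>2 - (if i = j then 1 else 0)" if "i < n" "j < n" for i j
    using that entry_corr_fun[OF C that] C by (auto simp: corr_mats_def corr_fun_def)
  have "(frob_norm (X \<omega> - 1\<^sub>m n))\<^sup>2 = (\<Sum>i<n. \<Sum>j<n. ((X \<omega> - 1\<^sub>m n) $$ (i, j))\<^sup>2)"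
    using C unfolding frob_norm_def by (subst real_sqrt_pow2) (auto intro!: sum_nonneg simp: corr_mats_def)
  also have "\<dots> = (\<Sum>i<n. \<Sum>j<n. (corr_fun ?x i j)\<^sup>2 - (if i = j then 1 else 0))" by (intro sum.cong refl e) auto
  also have "\<dots> = (n + 2 * offsq n ?x) - (\<Sum>i<n. \<Sum>j<n. if i = j then 1 else 0)"
    by (simp only: sum_subtractf sum_corr_fun_sq)
  also have "(\<Sum>i<n. \<Sum>j<n. if i = j then 1 else (0::real)) = n" by simp
  finally show ?thesis by simp
qed

lemma frob_integrable: "integrable N (\<lambda>\<omega>. (frob_norm (X \<omega> - 1\<^sub>m n))\<^sup>2)"
  and frob_mean: "(\<integral>\<omega>. (frob_norm (X \<omega> - 1\<^sub>m n))\<^sup>2 \<partial>N) = real n * (real n - 1) / \<nu>"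
proof -
  have "integrable N (\<lambda>\<omega>. offsq n (offdiag n (X \<omega>)))"
    unfolding integral_coords(2)[OF measurable_offsq] using \<nu>_gt offsq_bound by (intro integrable_corr_law measurable_offsq)
  then have "integrable N (\<lambda>\<omega>. 2 * offsq n (offdiag n (X \<omega>)))" by simp
  then show "integrable N (\<lambda>\<omega>. (frob_norm (X \<omega> - 1\<^sub>m n))\<^sup>2)"
    by (subst Bochner_Integration.integrable_cong[OF refl frob_offsq])
  have "(\<integral>\<omega>. (frob_norm (X \<omega> - 1\<^sub>m n))\<^sup>2 \<partial>N) = (\<integral>\<omega>. 2 * offsq n (offdiag n (X \<omega>)) \<partial>N)"
    by (intro Bochner_Integration.integral_cong refl frob_offsq)
  then show "(\<integral>\<omega>. (frob_norm (X \<omega> - 1\<^sub>m n))\<^sup>2 \<partial>N) = real n * (real n - 1) / \<nu>"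
    using offsq_mean[OF \<nu>_gt(1)] by (simp add: integral_coords(1)[OF measurable_offsq])
qed

lemma frob_measurable: "(\<lambda>\<omega>. frob_norm (X \<omega> - 1\<^sub>m n)) \<in> borel_measurable N"
proof -
  have "(\<lambda>\<omega>. sqrt (2 * offsq n (offdiag n (X \<omega>)))) \<in> borel_measurable N" by measurable
  moreover have "frob_norm (X \<omega> - 1\<^sub>m n) = sqrt (2 * offsq n (offdiag n (X \<omega>)))" if "\<omega> \<in> space N" for \<omega>
  proof -
    have "frob_norm (X \<omega> - 1\<^sub>m n) \<ge> 0" unfolding frob_norm_def by (intro real_sqrt_ge_zero sum_nonneg) auto
    then show ?thesis unfolding frob_offsq[OF that, symmetric] by simp
  qed
  ultimately show ?thesis by (subst measurable_cong)
qed

text \<open>The squared norm is twice \<open>offsq\<close>. Halving the threshold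
  \<open>\<delta>\<close> turns the constant 2 of \<open>offsq_variance\<close> into 8.\<close>

lemma frob_chebyshev:
  assumes d: "\<delta> > 0"
  shows "measure N {\<omega> \<in> space N. \<delta> \<le> \<bar>(frob_norm (X \<omega> - 1\<^sub>m n))\<^sup>2 - real n * (real n - 1) / \<nu>\<bar>}
    \<le> 8 * (real n)\<^sup>2 / \<nu>\<^sup>2 / \<delta>\<^sup>2"
proof -
  define m where "m = real n * (real n - 1) / (2 * \<nu>)"
  have m: "real n * (real n - 1) / \<nu> = 2 * m" using \<nu>_gt(2) by (simp add: m_def)
  let ?A = "{\<omega> \<in> space N. \<delta> \<le> \<bar>(frob_norm (X \<omega> - 1\<^sub>m n))\<^sup>2 - 2 * m\<bar>}"
  have "measure N ?A \<le> (\<integral>x. (offsq n x - m)\<^sup>2 \<partial>corr_law \<nu> n) / (\<delta> / 2)\<^sup>2"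
  proof (rule coords_chebyshev[where B = "real (card (upper_idx n)) + \<bar>m\<bar>"])
    show "\<bar>offsq n x - m\<bar> \<le> real (card (upper_idx n)) + \<bar>m\<bar>" if "psd_fun n (corr_fun x)" for x
      using offsq_bound[OF that] by linarith
    show "\<delta> / 2 \<le> \<bar>offsq n (offdiag n (X \<omega>)) - m\<bar>" if "\<omega> \<in> space N" "\<omega> \<in> ?A" for \<omega>
    proof -
      have "\<delta> \<le> \<bar>2 * offsq n (offdiag n (X \<omega>)) - 2 * m\<bar>" using that(2) frob_offsq[OF that(1)] by simp
      then show ?thesis by linarith
    qed
  qed (use d in auto)
  also have "\<dots> \<le> (2 * (real n)\<^sup>2 / \<nu>\<^sup>2) / (\<delta> / 2)\<^sup>2"
    by (intro divide_right_mono) (use offsq_variance[OF \<nu>_gt(1)] in \<open>auto simp: m_def\<close>)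
  also have "\<dots> = 8 * (real n)\<^sup>2 / \<nu>\<^sup>2 / \<delta>\<^sup>2" using d by (simp add: power2_eq_square)
  finally show ?thesis unfolding m .
qed

lemma frob_markov:
  assumes K: "K > 0"
  shows "measure N {\<omega> \<in> space N. K < \<bar>frob_norm (X \<omega> - 1\<^sub>m n)\<bar>} \<le> real n * (real n - 1) / \<nu> / K\<^sup>2"
proof -
  note [measurable] = frob_measurable
  have "measure N {\<omega> \<in> space N. K < \<bar>frob_norm (X \<omega> - 1\<^sub>m n)\<bar>} \<le> measure N {\<omega> \<in> space N. K \<le> \<bar>frob_norm (X \<omega> - 1\<^sub>m n)\<bar>}"
    by (rule measure_le_superset) auto
  also have "\<dots> \<le> (\<integral>\<omega>. (frob_norm (X \<omega> - 1\<^sub>m n))\<^sup>2 \<partial>N) / K\<^sup>2"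
    by (rule second_moment_method[OF frob_measurable frob_integrable K])
  finally show ?thesis by (simp only: frob_mean)
qed

text \<open>The map of the fixed point equation is decreasing, so a point is at most as far from the
  fixed point as from its own image.\<close>

lemma stj_deviation:
  assumes t: "t > 0" and c: "0 < c" "c \<le> 1" and d: "\<delta> > 0"
  shows "measure N {\<omega> \<in> space N. \<delta> \<le> \<bar>stj t n (offdiag n (X \<omega>)) - (\<integral>l. 1 / (l + t) \<partial>mp_law c)\<bar>}
    \<le> (sqrt (2 * real n) / \<nu> + 1 / \<nu> + \<bar>real n / \<nu> - c\<bar>) / t ^ 3 / \<delta>\<^sup>2"
proof -
  define s where "s = (\<integral>l. 1 / (l + t) \<partial>mp_law c)"
  have s: "s \<ge> 0" "s * (1 + t - c * (1 - t * s)) = 1" using mp_stieltjes_fixed_point[OF c t] by (auto simp: s_def)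
  have pos: "1 + t - c * (1 - t * u) > 0" if "u \<ge> 0" for u
  proof -
    have "c * (t * u) \<ge> 0" using c t that by simp
    moreover have "1 + t - c > 0" using c t by simp
    ultimately show ?thesis by (simp add: right_diff_distrib)
  qed
  have fp: "mp_map t c s = s" using s(2) pos[OF s(1)] by (simp add: mp_map_def[OF t] divide_eq_eq)
  have anti: "mp_map t c v \<le> mp_map t c u" if "0 \<le> u" "u \<le> v" for u v
  proof -
    have "t * u \<le> t * v" using t that by simp
    then have "c * (1 - t * v) \<le> c * (1 - t * u)" using c by (intro mult_left_mono) auto
    then show ?thesis unfolding mp_map_def[OF t] using pos[of u] pos[of v] that by (intro divide_left_mono) auto
  qed
  have close: "\<bar>u - s\<bar> \<le> \<bar>u - mp_map t c u\<bar>" if "u \<ge> 0" for u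
    using anti[of s u] anti[of u s] fp s(1) that by linarith
  obtain m where m: "n = Suc m" using n1 by (cases n) auto
  let ?F = "\<lambda>x. stj t n x - mp_map t c (stj t n x)"
  let ?A = "{\<omega> \<in> space N. \<delta> \<le> \<bar>stj t n (offdiag n (X \<omega>)) - s\<bar>}"
  note [measurable] = measurable_stj[OF t] measurable_mp_map[OF t]
  have b: "0 \<le> stj t n x" "stj t n x \<le> 1 / t" "0 \<le> mp_map t c (stj t n x)" "mp_map t c (stj t n x) \<le> 1 / t"
    if "psd_fun n (corr_fun x)" for x
    using stj_bounds[OF t that] mp_map_bounds[OF t c stj_bounds[OF t that]] t by (auto simp: field_simps zero_le_mult_iff)
  have "measure N ?A \<le> (\<integral>x. (?F x)\<^sup>2 \<partial>corr_law \<nu> n) / \<delta>\<^sup>2"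
  proof (rule coords_chebyshev[where B = "1 / t"])
    show "\<bar>?F x\<bar> \<le> 1 / t" if "psd_fun n (corr_fun x)" for x using b[OF that] by linarith
    show "\<delta> \<le> \<bar>?F (offdiag n (X \<omega>))\<bar>" if "\<omega> \<in> space N" "\<omega> \<in> ?A" for \<omega>
      using that(2) close[OF b(1)[OF coords_psd[OF that(1)]]] by auto
  qed (use d in auto)
  also have "\<dots> \<le> (sqrt (2 * real m) / \<nu> + 1 / \<nu> + \<bar>real n / \<nu> - c\<bar>) / t ^ 3 / \<delta>\<^sup>2"
    using stj_fixed_point_L2[OF t _ c, of m \<nu>] \<nu>_gt unfolding m by (intro divide_right_mono) auto
  also have "\<dots> \<le> (sqrt (2 * real n) / \<nu> + 1 / \<nu> + \<bar>real n / \<nu> - c\<bar>) / t ^ 3 / \<delta>\<^sup>2"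
    using t \<nu>_gt(2) m by (intro divide_right_mono add_right_mono real_sqrt_le_mono) auto
  finally show ?thesis unfolding s_def .
qed

text \<open>The list of eigenvalues is obtained separately for each outcome, so no measurable choice
  of eigenvalues is involved.\<close>

lemma esd_close_on:
  assumes w: "\<omega> \<in> space N" and T: "T \<subseteq> {0<..}"
    and cl: "\<And>t. t \<in> T \<Longrightarrow> \<bar>stj t n (offdiag n (X \<omega>)) - (\<integral>l. 1 / (l + t) \<partial>\<mu>)\<bar> < \<delta>"
  shows "\<exists>ls. close_on \<mu> T \<delta> ls \<and> esd (X \<omega>) r = avg (indicator {..r}) ls"
proof -
  have C: "X \<omega> \<in> corr_mats n" by (rule coords_corr[OF w])
  then have C': "X \<omega> \<in> carrier_mat n n" "transpose_mat (X \<omega>) = X \<omega>" "psd_mat (X \<omega>)" by (auto simp: corr_mats_def)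
  obtain ls where ls: "char_poly (X \<omega>) = (\<Prod>a\<leftarrow>ls. [:- a, 1:])" "length ls = n" "\<forall>l\<in>set ls. l \<ge> 0"
    using char_poly_psd_splits[OF C'] by blast
  have "avg (\<lambda>l. 1 / (l + t)) ls = stj t n (offdiag n (X \<omega>))" if "t \<in> T" for t
  proof -
    have t: "t > 0" using T that by auto
    have "tres t (corr_fun (offdiag n (X \<omega>))) n = (\<Sum>l\<leftarrow>ls. 1 / (l + t))"
      by (rule trace_res_eigenvalues[OF C'(1) _ _ _ ls(1,3) t])
        (use n1 entry_corr_fun[OF C] coords_psd[OF w] in \<open>auto simp: corr_fun_sym\<close>)
    then show ?thesis by (simp add: avg_def stj_def[OF t] ctres_def[OF t] ls(2))
  qed
  then have "close_on \<mu> T \<delta> ls" using cl ls(2,3) n1 by (auto simp: close_on_def)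
  moreover have "esd (X \<omega>) r = avg (indicator {..r}) ls"
  proof -
    have "real (size {#l \<in># mset ls. l \<le> r#}) = (\<Sum>l\<leftarrow>ls. indicator {..r} l)"
      by (induction ls) (auto simp: indicator_def)
    then show ?thesis using C'(1) ls by (simp add: esd_def avg_def proots_prod_linear)
  qed
  ultimately show ?thesis by blast
qed

text \<open>If the Stieltjes transform is within \<open>\<delta>\<close> of its target at all points
  of T, the eigenvalues form a \<open>close_on\<close> list and the distribution function is
  controlled. A union bound over the finite set T estimates the remaining event.\<close>

lemma esd_deviation:
  assumes c: "0 < c" "c \<le> 1" and T: "finite T" "T \<subseteq> {0<..}" and d: "\<delta> > 0"
    and cdf: "\<And>ls. close_on (mp_law c) T \<delta> ls \<Longrightarrow> \<bar>avg (indicator {..r}) ls - cdf (mp_law c) r\<bar> \<le> \<epsilon>"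
  shows "measure N {\<omega> \<in> space N. \<bar>esd (X \<omega>) r - cdf (mp_law c) r\<bar> > \<epsilon>}
    \<le> (\<Sum>t\<in>T. (sqrt (2 * real n) / \<nu> + 1 / \<nu> + \<bar>real n / \<nu> - c\<bar>) / t ^ 3 / \<delta>\<^sup>2)"
proof -
  let ?A = "\<lambda>t. {\<omega> \<in> space N. \<delta> \<le> \<bar>stj t n (offdiag n (X \<omega>)) - (\<integral>l. 1 / (l + t) \<partial>mp_law c)\<bar>}"
  have A: "?A ` T \<subseteq> sets N"
  proof safe
    fix t assume "t \<in> T"
    then have t: "t > 0" using T by auto
    note [measurable] = measurable_stj[OF t]
    show "?A t \<in> sets N" by measurable
  qed
  have "measure N {\<omega> \<in> space N. \<bar>esd (X \<omega>) r - cdf (mp_law c) r\<bar> > \<epsilon>} \<le> measure N (\<Union>t\<in>T. ?A t)"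
  proof (rule measure_le_superset)
    show "(\<Union>t\<in>T. ?A t) \<in> sets N" using A T(1) by (intro sets.finite_UN) auto
    show "{\<omega> \<in> space N. \<bar>esd (X \<omega>) r - cdf (mp_law c) r\<bar> > \<epsilon>} \<subseteq> (\<Union>t\<in>T. ?A t)"
    proof (rule subsetI, rule ccontr)
      fix \<omega> assume w: "\<omega> \<in> {\<omega> \<in> space N. \<bar>esd (X \<omega>) r - cdf (mp_law c) r\<bar> > \<epsilon>}" "\<omega> \<notin> (\<Union>t\<in>T. ?A t)"
      then have "\<bar>stj t n (offdiag n (X \<omega>)) - (\<integral>l. 1 / (l + t) \<partial>mp_law c)\<bar> < \<delta>" if "t \<in> T" for t
        using that by force
      then obtain ls where "close_on (mp_law c) T \<delta> ls" "esd (X \<omega>) r = avg (indicator {..r}) ls"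
        using esd_close_on[of \<omega> T "mp_law c" \<delta> r] w(1) T(2) by blast
      then show False using cdf[of ls] w(1) by simp
    qed
  qed
  also have "\<dots> \<le> (\<Sum>t\<in>T. measure N (?A t))" by (rule finite_measure_subadditive_finite[OF T(1) A])
  also have "\<dots> \<le> (\<Sum>t\<in>T. (sqrt (2 * real n) / \<nu> + 1 / \<nu> + \<bar>real n / \<nu> - c\<bar>) / t ^ 3 / \<delta>\<^sup>2)"
    by (intro sum_mono stj_deviation c d) (use T(2) in auto)
  finally show ?thesis .
qed

end

section \<open>Asymptotics along the sequence\<close>

context
  fixes \<eta> :: "nat \<Rightarrow> real" and M :: "nat \<Rightarrow> 'a measure" and C :: "nat \<Rightarrow> 'a \<Rightarrow> real mat"
    and \<nu> :: "nat \<Rightarrow> real" and D :: "nat \<Rightarrow> 'a \<Rightarrow> real"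
  assumes eta_pos: "\<And>n. n \<ge> 1 \<Longrightarrow> \<eta> n > 0"
    and prob: "\<And>n. n \<ge> 1 \<Longrightarrow> prob_space (M n)"
    and meas: "\<And>n. n \<ge> 1 \<Longrightarrow> C n \<in> measurable (M n) (lkj n (\<eta> n))"
    and law: "\<And>n. n \<ge> 1 \<Longrightarrow> distr (M n) (lkj n (\<eta> n)) (C n) = lkj n (\<eta> n)"
    and nu: "\<And>n. \<nu> n = real n + 2 * \<eta> n - 1"
    and D: "\<And>n \<omega>. D n \<omega> = frob_norm (C n \<omega> - 1\<^sub>m n)"
begin

definition msq :: "nat \<Rightarrow> real" where "msq n = real n * (real n - 1) / \<nu> n"

lemma nu_pos: "n \<ge> 1 \<Longrightarrow> \<nu> n > 0" using eta_pos[of n] by (simp add: nu)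

lemma nu_ge: "n \<ge> 1 \<Longrightarrow> \<nu> n \<ge> 2 * \<eta> n" by (simp add: nu)

lemma D_nonneg: "D n \<omega> \<ge> 0"
  unfolding D frob_norm_def by (intro real_sqrt_ge_zero sum_nonneg) auto

lemma D_mean:
  assumes n: "n \<ge> 1"
  shows "integrable (M n) (\<lambda>\<omega>. (D n \<omega>)\<^sup>2)" "(\<integral>\<omega>. (D n \<omega>)\<^sup>2 \<partial>M n) = msq n"
  using frob_integrable[OF eta_pos[OF n] prob[OF n] meas[OF n] law[OF n] n nu]
    frob_mean[OF eta_pos[OF n] prob[OF n] meas[OF n] law[OF n] n nu]
  by (simp_all only: D[symmetric] msq_def)

lemma D_chebyshev:
  "n \<ge> 1 \<Longrightarrow> \<delta> > 0 \<Longrightarrow> measure (M n) {\<omega> \<in> space (M n). \<delta> \<le> \<bar>(D n \<omega>)\<^sup>2 - msq n\<bar>} \<le> 8 * (real n)\<^sup>2 / (\<nu> n)\<^sup>2 / \<delta>\<^sup>2"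
  using frob_chebyshev[OF eta_pos prob meas law _ nu] unfolding D[symmetric] msq_def[symmetric] by blast

lemma D_markov:
  "n \<ge> 1 \<Longrightarrow> K > 0 \<Longrightarrow> measure (M n) {\<omega> \<in> space (M n). K < \<bar>D n \<omega>\<bar>} \<le> msq n / K\<^sup>2"
  using frob_markov[OF eta_pos prob meas law _ nu] unfolding D[symmetric] msq_def[symmetric] by blast

lemma D_measurable: "n \<ge> 1 \<Longrightarrow> D n \<in> borel_measurable (M n)"
  using frob_measurable[OF eta_pos prob meas law _ nu] unfolding D[symmetric] by blast

lemma D_chebyshev':
  assumes n: "n \<ge> 1" and \<delta>: "\<delta> > 0" and A: "\<And>\<omega>. \<omega> \<in> A \<Longrightarrow> \<delta> \<le> \<bar>(D n \<omega>)\<^sup>2 - msq n\<bar>" "A \<subseteq> space (M n)"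
  shows "measure (M n) A \<le> 8 * (real n)\<^sup>2 / (\<nu> n)\<^sup>2 / \<delta>\<^sup>2"
proof -
  interpret prob_space "M n" by (rule prob[OF n])
  note [measurable] = D_measurable[OF n]
  have "measure (M n) A \<le> measure (M n) {\<omega> \<in> space (M n). \<delta> \<le> \<bar>(D n \<omega>)\<^sup>2 - msq n\<bar>}"
    by (rule measure_le_superset) (use A in auto)
  then show ?thesis using D_chebyshev[OF n \<delta>] by simp
qed

lemma msq_pos: "n \<ge> 2 \<Longrightarrow> msq n > 0" using nu_pos[of n] by (simp add: msq_def)

text \<open>Both the variance bound and the squared mean carry the factor
  \<open>1 / \<nu>^2\<close>, which cancels. The relative variance is therefore of order 1 / n^2 for
  every choice of \<open>\<eta>\<close>.\<close>

lemma relative_chebyshev_bound: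
  assumes n: "n \<ge> 2" and k: "k > 0"
  shows "8 * (real n)\<^sup>2 / (\<nu> n)\<^sup>2 / (k * msq n)\<^sup>2 = 8 / k\<^sup>2 / (real n - 1)\<^sup>2"
proof -
  have gen: "8 * a\<^sup>2 / v\<^sup>2 / (k * (a * b / v))\<^sup>2 = 8 / k\<^sup>2 / b\<^sup>2" if "a > 0" "b > 0" "v > 0" for a b v :: real
    using that k by (simp add: power_mult_distrib power_divide)
  show ?thesis unfolding msq_def by (rule gen) (use n nu_pos[of n] in auto)
qed

lemma inverse_square_limit: "(\<lambda>n. a / (real n - 1)\<^sup>2) \<longlonglongrightarrow> 0"
proof (rule LIMSEQ_imp_Suc)
  have "(\<lambda>n. a * (1 / real n)\<^sup>2) \<longlonglongrightarrow> a * 0\<^sup>2" by (intro tendsto_intros lim_1_over_n)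
  then show "(\<lambda>n. a / (real (Suc n) - 1)\<^sup>2) \<longlonglongrightarrow> 0" by (simp add: power_divide)
qed

lemma ratio_limit: "tendsto_in_prob M (\<lambda>n \<omega>. (D n \<omega>)\<^sup>2 / (\<integral>\<omega>. (D n \<omega>)\<^sup>2 \<partial>M n)) 1"
proof (rule tendsto_in_probI)
  fix \<epsilon> :: real assume e: "\<epsilon> > 0"
  show "\<exists>b. b \<longlonglongrightarrow> 0 \<and> (\<forall>\<^sub>F n in sequentially.
    measure (M n) {\<omega> \<in> space (M n). \<bar>(D n \<omega>)\<^sup>2 / (\<integral>\<omega>. (D n \<omega>)\<^sup>2 \<partial>M n) - 1\<bar> > \<epsilon>} \<le> b n)"
  proof (intro exI conjI)
    show "(\<lambda>n. 8 / \<epsilon>\<^sup>2 / (real n - 1)\<^sup>2) \<longlonglongrightarrow> 0" by (rule inverse_square_limit)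
    show "\<forall>\<^sub>F n in sequentially. measure (M n) {\<omega> \<in> space (M n). \<bar>(D n \<omega>)\<^sup>2 / (\<integral>\<omega>. (D n \<omega>)\<^sup>2 \<partial>M n) - 1\<bar> > \<epsilon>} \<le> 8 / \<epsilon>\<^sup>2 / (real n - 1)\<^sup>2"
      \<comment> \<open>For n = 1 the mean is 0, so the quotient is meaningful from n = 2
        on.\<close>
      using eventually_ge_at_top[of 2]
    proof eventually_elim
      case (elim n)
      have E: "msq n > 0" by (rule msq_pos[OF elim])
      have n1: "n \<ge> 1" using elim by simp
      have "\<epsilon> * msq n \<le> \<bar>d - msq n\<bar>" if "\<bar>d / msq n - 1\<bar> > \<epsilon>" for d
      proof -
        have "d / msq n - 1 = (d - msq n) / msq n" using E by (simp add: diff_divide_distrib)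
        then show ?thesis using that E by (simp add: abs_divide pos_less_divide_eq)
      qed
      then show ?case unfolding relative_chebyshev_bound[OF elim e, symmetric] D_mean(2)[OF n1]
        using E e n1 by (intro D_chebyshev') auto
    qed
  qed
qed

context
  fixes \<theta> :: real
  assumes \<theta>: "\<theta> \<ge> 0" and lim: "(\<lambda>n. \<eta> n / real n) \<longlonglongrightarrow> \<theta>"
begin

lemma n_over_nu_limit: "(\<lambda>n. real n / \<nu> n) \<longlonglongrightarrow> 1 / (1 + 2 * \<theta>)"
proof -
  have "(\<lambda>n. 1 / (1 + 2 * (\<eta> n / real n) - 1 / real n)) \<longlonglongrightarrow> 1 / (1 + 2 * \<theta> - 0)"
    using \<theta> by (intro tendsto_intros lim lim_1_over_n) auto
  moreover have "\<forall>\<^sub>F n in sequentially. 1 / (1 + 2 * (\<eta> n / real n) - 1 / real n) = real n / \<nu> n"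
    using eventually_ge_at_top[of 1]
  proof eventually_elim
    case (elim n)
    have "1 + 2 * (\<eta> n / real n) - 1 / real n = \<nu> n / real n" using elim by (simp add: nu add_divide_distrib diff_divide_distrib)
    then show ?case by simp
  qed
  ultimately show ?thesis by (simp add: Lim_transform_eventually)
qed

lemma over_nu_limit:
  assumes "(\<lambda>n. a n / real n) \<longlonglongrightarrow> 0" shows "(\<lambda>n. a n / \<nu> n) \<longlonglongrightarrow> 0"
proof -
  have "(\<lambda>n. a n / real n * (real n / \<nu> n)) \<longlonglongrightarrow> 0 * (1 / (1 + 2 * \<theta>))" by (intro tendsto_mult assms n_over_nu_limit)
  moreover have "\<forall>\<^sub>F n in sequentially. a n / real n * (real n / \<nu> n) = a n / \<nu> n"
    using eventually_ge_at_top[of 1] by eventually_elim auto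
  ultimately show ?thesis by (simp add: Lim_transform_eventually)
qed

lemma inverse_nu_limit: "(\<lambda>n. 1 / \<nu> n) \<longlonglongrightarrow> 0"
  by (rule over_nu_limit) (rule lim_1_over_n)

lemma esd_limit: "weak_conv_in_prob M (\<lambda>n \<omega>. esd (C n \<omega>)) (cdf (mp_law (1 / (1 + 2 * \<theta>))))"
  unfolding weak_conv_in_prob_def
proof (intro allI impI)
  define c where "c = 1 / (1 + 2 * \<theta>)"
  have c: "0 < c" "c \<le> 1" using \<theta> by (auto simp: c_def)
  fix r assume "isCont (cdf (mp_law (1 / (1 + 2 * \<theta>)))) r"
  then have cont: "isCont (cdf (mp_law c)) r" by (simp add: c_def)
  have "tendsto_in_prob M (\<lambda>n \<omega>. esd (C n \<omega>) r) (cdf (mp_law c) r)"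
  proof (rule tendsto_in_probI)
    fix \<epsilon> :: real assume e: "\<epsilon> > 0"
    obtain T \<delta> where T: "finite T" "T \<subseteq> {0<..}" "\<delta> > 0"
      "\<And>ls. close_on (mp_law c) T \<delta> ls \<Longrightarrow> \<bar>avg (indicator {..r}) ls - cdf (mp_law c) r\<bar> \<le> \<epsilon>"
      using close_on_cdf[OF prob_space_mp_law[OF c] sets_mp_law[OF c] AE_mp_law[OF c] cont e] by blast
    \<comment> \<open>T and \<open>\<delta>\<close> depend on r and \<open>\<epsilon>\<close> but
      not on n, so this is a fixed finite sum of null sequences.\<close>
    let ?b = "\<lambda>n. \<Sum>t\<in>T. (sqrt (2 * real n) / \<nu> n + 1 / \<nu> n + \<bar>real n / \<nu> n - c\<bar>) / t ^ 3 / \<delta>\<^sup>2"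
    have "(\<lambda>n. sqrt (2 * real n) / \<nu> n) \<longlonglongrightarrow> 0"
    proof (rule over_nu_limit)
      have "(\<lambda>n. sqrt (2 * (1 / real n))) \<longlonglongrightarrow> sqrt (2 * 0)" by (intro tendsto_intros lim_1_over_n)
      moreover have "sqrt (2 * (1 / real n)) = sqrt (2 * real n) / real n" for n
      proof -
        have "2 * (1 / real n) = 2 * real n / (real n)\<^sup>2" by (simp add: power2_eq_square)
        then show ?thesis by (simp only: real_sqrt_divide real_sqrt_abs abs_of_nat)
      qed
      ultimately show "(\<lambda>n. sqrt (2 * real n) / real n) \<longlonglongrightarrow> 0" by simp
    qed
    moreover have "(\<lambda>n. \<bar>real n / \<nu> n - c\<bar>) \<longlonglongrightarrow> \<bar>c - c\<bar>"
      using tendsto_rabs[OF tendsto_diff[OF n_over_nu_limit tendsto_const]] unfolding c_def .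
    ultimately have "(\<lambda>n. sqrt (2 * real n) / \<nu> n + 1 / \<nu> n + \<bar>real n / \<nu> n - c\<bar>) \<longlonglongrightarrow> 0 + 0 + 0"
      by (intro tendsto_add inverse_nu_limit) auto
    then have "?b \<longlonglongrightarrow> (\<Sum>t\<in>T. (0 + 0 + 0) / t ^ 3 / \<delta>\<^sup>2)"
      using T by (intro tendsto_sum tendsto_divide tendsto_const) auto
    moreover have "\<forall>\<^sub>F n in sequentially. measure (M n) {\<omega> \<in> space (M n). \<bar>esd (C n \<omega>) r - cdf (mp_law c) r\<bar> > \<epsilon>} \<le> ?b n"
      using eventually_ge_at_top[of 1]
    proof eventually_elim
      case (elim n)
      show ?case by (rule esd_deviation[OF eta_pos[OF elim] prob[OF elim] meas[OF elim] law[OF elim] elim nu c T])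
    qed
    ultimately show "\<exists>b. b \<longlonglongrightarrow> 0 \<and> (\<forall>\<^sub>F n in sequentially.
      measure (M n) {\<omega> \<in> space (M n). \<bar>esd (C n \<omega>) r - cdf (mp_law c) r\<bar> > \<epsilon>} \<le> b n)"
      by (intro exI[of _ ?b]) auto
  qed
  then show "tendsto_in_prob M (\<lambda>n \<omega>. esd (C n \<omega>) r) (cdf (mp_law (1 / (1 + 2 * \<theta>))) r)" by (simp add: c_def)
qed

lemma scaled_limit: "tendsto_in_prob M (\<lambda>n \<omega>. 1 / real n * (D n \<omega>)\<^sup>2) (1 / (1 + 2 * \<theta>))"
proof (rule tendsto_in_probI)
  fix \<epsilon> :: real assume e: "\<epsilon> > 0"
  define c where "c = 1 / (1 + 2 * \<theta>)"
  have "(\<lambda>n. real n / \<nu> n - 1 / \<nu> n) \<longlonglongrightarrow> c - 0"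
    unfolding c_def by (intro tendsto_diff n_over_nu_limit inverse_nu_limit)
  \<comment> \<open>Half of \<open>\<epsilon>\<close> is spent on the distance of the mean from its
    limit, the other half on the fluctuation around the mean.\<close>
  then have "\<forall>\<^sub>F n in sequentially. dist (real n / \<nu> n - 1 / \<nu> n) c < \<epsilon> / 2"
    using e by (intro tendstoD) auto
  then have ev: "\<forall>\<^sub>F n in sequentially. measure (M n) {\<omega> \<in> space (M n). \<bar>1 / real n * (D n \<omega>)\<^sup>2 - c\<bar> > \<epsilon>} \<le> 32 / \<epsilon>\<^sup>2 * (1 / \<nu> n)\<^sup>2"
    using eventually_ge_at_top[of 1]
  proof eventually_elim
    case (elim n)
    have n: "real n > 0" and v: "\<nu> n > 0" using elim(2) nu_pos[OF elim(2)] by auto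
    have m: "msq n / real n = real n / \<nu> n - 1 / \<nu> n" using n by (simp add: msq_def diff_divide_distrib)
    have "real n * (\<epsilon> / 2) \<le> \<bar>d - msq n\<bar>" if "\<bar>1 / real n * d - c\<bar> > \<epsilon>" for d
    proof -
      have "\<bar>d / real n - msq n / real n\<bar> \<ge> \<epsilon> / 2" using that elim(1) unfolding m dist_real_def by (simp only: times_divide_eq_left mult_1)
      moreover have "\<bar>d / real n - msq n / real n\<bar> = \<bar>d - msq n\<bar> / real n" by (simp add: diff_divide_distrib[symmetric] abs_divide)
      ultimately show ?thesis using n by (simp add: pos_le_divide_eq mult.commute)
    qed
    then have "measure (M n) {\<omega> \<in> space (M n). \<bar>1 / real n * (D n \<omega>)\<^sup>2 - c\<bar> > \<epsilon>} \<le> 8 * (real n)\<^sup>2 / (\<nu> n)\<^sup>2 / (real n * (\<epsilon> / 2))\<^sup>2"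
      using n e elim(2) by (intro D_chebyshev') auto
    also have "\<dots> = 32 / \<epsilon>\<^sup>2 * (1 / \<nu> n)\<^sup>2"
    proof -
      have gen: "8 * a\<^sup>2 / u\<^sup>2 / (a * (\<epsilon> / 2))\<^sup>2 = 32 / \<epsilon>\<^sup>2 * (1 / u)\<^sup>2" if "a > 0" "u > 0" for a u :: real
        using that e by (simp add: power_mult_distrib power_divide)
      show ?thesis by (rule gen[OF n v])
    qed
    finally show ?case .
  qed
  moreover have "(\<lambda>n. 32 / \<epsilon>\<^sup>2 * (1 / \<nu> n)\<^sup>2) \<longlonglongrightarrow> 32 / \<epsilon>\<^sup>2 * 0\<^sup>2" by (intro tendsto_intros inverse_nu_limit)
  ultimately show "\<exists>b. b \<longlonglongrightarrow> 0 \<and> (\<forall>\<^sub>F n in sequentially.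
      measure (M n) {\<omega> \<in> space (M n). \<bar>1 / real n * (D n \<omega>)\<^sup>2 - 1 / (1 + 2 * \<theta>)\<bar> > \<epsilon>} \<le> b n)"
    unfolding c_def by (intro exI[of _ "\<lambda>n. 32 / \<epsilon>\<^sup>2 * (1 / \<nu> n)\<^sup>2"]) auto
qed

end

lemma msq_le:
  assumes n: "n \<ge> 1" shows "msq n \<le> (real n)\<^sup>2 / \<eta> n / 2"
proof -
  have "msq n \<le> (real n)\<^sup>2 / \<nu> n"
    unfolding msq_def using nu_pos[OF n] n by (intro divide_right_mono) (auto simp: power2_eq_square intro!: mult_left_mono)
  also have "\<dots> \<le> (real n)\<^sup>2 / (2 * \<eta> n)" using nu_ge[OF n] eta_pos[OF n] by (intro divide_left_mono) auto
  finally show ?thesis by simp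
qed

text \<open>From \<open>1 / msq n = 1 / n + 2 * \<eta> n / (n * (n - 1))\<close> the mean of the
  squared norm tends to infinity, and by the relative bound the squared norm exceeds half its mean
  with probability tending to 1.\<close>

lemma divergence:
  assumes "\<eta> \<in> o(\<lambda>n. (real n)\<^sup>2)" shows "diverges_in_prob M D"
  unfolding diverges_in_prob_def
proof
  fix K :: real
  have "(\<lambda>n. \<eta> n / (real n)\<^sup>2) \<longlonglongrightarrow> 0"
    using assms by (intro smalloD_tendsto) auto
  then have "(\<lambda>n. 1 / real n + 4 * (\<eta> n / (real n)\<^sup>2)) \<longlonglongrightarrow> 0 + 4 * 0" by (intro tendsto_intros lim_1_over_n)
  \<comment> \<open>A mean above \<open>2 * K^2 + 1\<close> makes K^2 at most half of it, so
    \<open>D n \<omega> \<le> K\<close> is a relative deviation of at least 1/2. The added 1 keeps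
    the denominator positive for \<open>K = 0\<close>.\<close>
  then have "\<forall>\<^sub>F n in sequentially. 1 / real n + 4 * (\<eta> n / (real n)\<^sup>2) < 1 / (2 * K\<^sup>2 + 1)"
    by (rule order_tendstoD) (simp add: add_nonneg_pos)
  then have ev: "\<forall>\<^sub>F n in sequentially. 1 - 32 / (real n - 1)\<^sup>2 \<le> measure (M n) {\<omega> \<in> space (M n). D n \<omega> > K}"
    using eventually_ge_at_top[of 2]
  proof eventually_elim
    case (elim n)
    have n1: "n \<ge> 1" using elim by simp
    interpret prob_space "M n" by (rule prob[OF n1])
    note [measurable] = D_measurable[OF n1]
    have E: "msq n > 0" by (rule msq_pos[OF elim(2)])
    have "1 / msq n \<le> 1 / real n + 4 * (\<eta> n / (real n)\<^sup>2)"
    proof -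
      have "1 / msq n = 1 / real n + 2 * \<eta> n / (real n * (real n - 1))"
        using elim(2) by (simp add: msq_def nu field_simps)
      moreover have "2 * \<eta> n / (real n * (real n - 1)) \<le> 2 * \<eta> n / ((real n)\<^sup>2 / 2)"
        using elim(2) eta_pos[OF n1] by (intro divide_left_mono) (auto simp: power2_eq_square intro!: mult_pos_pos)
      ultimately show ?thesis by simp
    qed
    have gen: "a < b" if "1 / b < 1 / a" "a > 0" "b > 0" for a b :: real
      using that by (simp add: field_simps)
    from \<open>1 / msq n \<le> _\<close> have "1 / msq n < 1 / (2 * K\<^sup>2 + 1)" using elim(1) by simp
    then have "2 * K\<^sup>2 + 1 < msq n" by (rule gen) (use E in \<open>auto intro: add_nonneg_pos\<close>)
    then have big: "2 * K\<^sup>2 \<le> msq n" by simp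
    have "1 / 2 * msq n \<le> \<bar>(D n \<omega>)\<^sup>2 - msq n\<bar>" if "D n \<omega> \<le> K" for \<omega>
      using power_mono[OF that D_nonneg, of 2] big by linarith
    then have "prob {\<omega> \<in> space (M n). \<not> D n \<omega> > K} \<le> 8 / (1 / 2)\<^sup>2 / (real n - 1)\<^sup>2"
      using E n1 by (subst relative_chebyshev_bound[OF elim(2), symmetric])
        (simp, intro D_chebyshev', auto)
    moreover have "prob {\<omega> \<in> space (M n). \<not> D n \<omega> > K} = 1 - prob {\<omega> \<in> space (M n). D n \<omega> > K}"
      by (rule prob_neg) measurable
    ultimately show ?case by (simp add: power2_eq_square)
  qed
  have "(\<lambda>n. 1 - 32 / (real n - 1)\<^sup>2) \<longlonglongrightarrow> 1 - 0" by (intro tendsto_intros inverse_square_limit)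
  moreover have "\<forall>\<^sub>F n in sequentially. measure (M n) {\<omega> \<in> space (M n). D n \<omega> > K} \<le> 1"
    using eventually_ge_at_top[of 1] by eventually_elim (intro prob_space.prob_le_1 prob)
  ultimately show "(\<lambda>n. measure (M n) {\<omega> \<in> space (M n). D n \<omega> > K}) \<longlonglongrightarrow> 1"
    by (intro tendsto_sandwich[OF ev _ _ tendsto_const]) simp_all
qed

lemma boundedness:
  assumes "\<eta> \<in> \<Theta>(\<lambda>n. (real n)\<^sup>2)" shows "bounded_in_prob M D"
  unfolding bounded_in_prob_def
proof (intro allI impI)
  fix \<epsilon> :: real assume e: "\<epsilon> > 0"
  have "\<eta> \<in> \<Omega>(\<lambda>n. (real n)\<^sup>2)" using assms by (rule bigthetaD2)
  then obtain k where k: "k > 0" "\<forall>\<^sub>F n in sequentially. norm (\<eta> n) \<ge> k * norm ((real n)\<^sup>2)"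
    by (elim landau_omega.bigE)
  then obtain n0 where n0: "\<And>n. n \<ge> n0 \<Longrightarrow> \<bar>\<eta> n\<bar> \<ge> k * (real n)\<^sup>2" by (auto simp: eventually_sequentially)
  \<comment> \<open>\<open>bounded_in_prob\<close> asks for one bound valid for all n \<ge> 1. The
    sum takes care of the finitely many n before the asymptotic bound sets in.\<close>
  define B where "B = 1 / (2 * k) + (\<Sum>n<n0. \<bar>msq n\<bar>)"
  have B0: "B \<ge> 0" using k unfolding B_def by (intro add_nonneg_nonneg sum_nonneg) auto
  have B: "msq n \<le> B" if n: "n \<ge> 1" for n
  proof (cases "n < n0")
    case True
    then have "\<bar>msq n\<bar> \<le> (\<Sum>n<n0. \<bar>msq n\<bar>)" by (intro member_le_sum) auto
    moreover have "1 / (2 * k) > 0" using k by simp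
    ultimately show ?thesis unfolding B_def by linarith
  next
    case False
    then have "k * (real n)\<^sup>2 \<le> \<eta> n" using n0[of n] eta_pos[OF n] by simp
    then have "(real n)\<^sup>2 / \<eta> n \<le> (real n)\<^sup>2 / (k * (real n)\<^sup>2)" using k(1) n eta_pos[OF n] by (intro divide_left_mono) auto
    also have "\<dots> = 1 / k" using n by simp
    finally have "msq n \<le> 1 / (2 * k)" using msq_le[OF n] by simp
    moreover have "(\<Sum>n<n0. \<bar>msq n\<bar>) \<ge> 0" by (intro sum_nonneg) auto
    ultimately show ?thesis unfolding B_def by linarith
  qed
  \<comment> \<open>The threshold makes the bound of \<open>D_markov\<close> at most
    \<open>\<epsilon>\<close>; \<open>B + 1\<close> in place of \<open>B\<close> keeps it
    positive.\<close>
  have "measure (M n) {\<omega> \<in> space (M n). \<bar>D n \<omega>\<bar> > sqrt ((B + 1) / \<epsilon>)} \<le> \<epsilon>" if n: "n \<ge> 1" for n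
  proof -
    have "measure (M n) {\<omega> \<in> space (M n). \<bar>D n \<omega>\<bar> > sqrt ((B + 1) / \<epsilon>)} \<le> msq n / (sqrt ((B + 1) / \<epsilon>))\<^sup>2"
      by (rule D_markov[OF n]) (use B0 e in simp)
    also have "\<dots> = msq n / (B + 1) * \<epsilon>" using B0 e by simp
    also have "\<dots> \<le> 1 * \<epsilon>" using B[OF n] B0 e by (intro mult_right_mono) auto
    finally show ?thesis by simp
  qed
  then show "\<exists>K. \<forall>n\<ge>1. measure (M n) {\<omega> \<in> space (M n). \<bar>D n \<omega>\<bar> > K} \<le> \<epsilon>" by blast
qed

lemma vanishing:
  assumes "(\<lambda>n. (real n)\<^sup>2) \<in> o(\<eta>)" shows "tendsto_in_prob M D 0"
proof (rule tendsto_in_probI)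
  fix \<epsilon> :: real assume e: "\<epsilon> > 0"
  have "(\<lambda>n. (real n)\<^sup>2 / \<eta> n) \<longlonglongrightarrow> 0"
    using assms by (rule smalloD_tendsto)
  then have "(\<lambda>n. (real n)\<^sup>2 / \<eta> n / 2 / \<epsilon>\<^sup>2) \<longlonglongrightarrow> 0 / 2 / \<epsilon>\<^sup>2" using e by (intro tendsto_intros) auto
  moreover have "\<forall>\<^sub>F n in sequentially. measure (M n) {\<omega> \<in> space (M n). \<bar>D n \<omega> - 0\<bar> > \<epsilon>} \<le> (real n)\<^sup>2 / \<eta> n / 2 / \<epsilon>\<^sup>2"
    using eventually_ge_at_top[of 1]
  proof eventually_elim
    case (elim n)
    have "measure (M n) {\<omega> \<in> space (M n). \<bar>D n \<omega>\<bar> > \<epsilon>} \<le> msq n / \<epsilon>\<^sup>2" by (rule D_markov[OF elim e])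
    also have "\<dots> \<le> (real n)\<^sup>2 / \<eta> n / 2 / \<epsilon>\<^sup>2" by (intro divide_right_mono msq_le elim) auto
    finally show ?case by simp
  qed
  ultimately show "\<exists>b. b \<longlonglongrightarrow> 0 \<and> (\<forall>\<^sub>F n in sequentially. measure (M n) {\<omega> \<in> space (M n). \<bar>D n \<omega> - 0\<bar> > \<epsilon>} \<le> b n)"
    by (intro exI[of _ "\<lambda>n. (real n)\<^sup>2 / \<eta> n / 2 / \<epsilon>\<^sup>2"]) auto
qed

end

theorem theorem4:
  fixes \<eta> :: "nat \<Rightarrow> real"
    and M :: "nat \<Rightarrow> 'a measure"
    and C :: "nat \<Rightarrow> 'a \<Rightarrow> real mat"
    and \<nu> :: "nat \<Rightarrow> real"
    and D :: "nat \<Rightarrow> 'a \<Rightarrow> real"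
  assumes eta_pos: "\<And>n. n \<ge> 1 \<Longrightarrow> \<eta> n > 0"
    and prob: "\<And>n. n \<ge> 1 \<Longrightarrow> prob_space (M n)"
    and meas: "\<And>n. n \<ge> 1 \<Longrightarrow> C n \<in> measurable (M n) (lkj n (\<eta> n))"
    and law: "\<And>n. n \<ge> 1 \<Longrightarrow> distr (M n) (lkj n (\<eta> n)) (C n) = lkj n (\<eta> n)"
    and nu: "\<And>n. \<nu> n = real n + 2 * \<eta> n - 1"
    and D: "\<And>n \<omega>. D n \<omega> = frob_norm (C n \<omega> - 1\<^sub>m n)"
  shows
    "(\<forall>\<theta>\<ge>0. (\<lambda>n. \<eta> n / real n) \<longlonglongrightarrow> \<theta> \<longrightarrow>
        weak_conv_in_prob M (\<lambda>n \<omega>. esd (C n \<omega>)) (cdf (mp_law (1 / (1 + 2 * \<theta>)))))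
     \<and> (\<forall>n\<ge>1. integrable (M n) (\<lambda>\<omega>. (D n \<omega>)\<^sup>2) \<and>
          integral\<^sup>L (M n) (\<lambda>\<omega>. (D n \<omega>)\<^sup>2) = real n * (real n - 1) / \<nu> n)
     \<and> tendsto_in_prob M (\<lambda>n \<omega>. (D n \<omega>)\<^sup>2 / integral\<^sup>L (M n) (\<lambda>\<omega>. (D n \<omega>)\<^sup>2)) 1
     \<and> (\<forall>\<theta>\<ge>0. (\<lambda>n. \<eta> n / real n) \<longlonglongrightarrow> \<theta> \<longrightarrow>
          tendsto_in_prob M (\<lambda>n \<omega>. 1 / real n * (D n \<omega>)\<^sup>2) (1 / (1 + 2 * \<theta>)))
     \<and> (filterlim (\<lambda>n. \<eta> n / real n) at_top sequentially \<longrightarrow>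
          (\<eta> \<in> o(\<lambda>n. (real n)\<^sup>2) \<longrightarrow> diverges_in_prob M D)
          \<and> (\<eta> \<in> \<Theta>(\<lambda>n. (real n)\<^sup>2) \<longrightarrow> bounded_in_prob M D)
          \<and> ((\<lambda>n. (real n)\<^sup>2) \<in> o(\<eta>) \<longrightarrow> tendsto_in_prob M D 0))"
proof -
  note A = eta_pos prob meas law nu D
  have mean: "\<forall>n\<ge>1. integrable (M n) (\<lambda>\<omega>. (D n \<omega>)\<^sup>2) \<and>
    integral\<^sup>L (M n) (\<lambda>\<omega>. (D n \<omega>)\<^sup>2) = real n * (real n - 1) / \<nu> n"
    by (intro allI impI conjI) (simp_all only: D_mean[OF A] msq_def[OF A])
  have esd: "\<forall>\<theta>\<ge>0. (\<lambda>n. \<eta> n / real n) \<longlonglongrightarrow> \<theta> \<longrightarrow>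
    weak_conv_in_prob M (\<lambda>n \<omega>. esd (C n \<omega>)) (cdf (mp_law (1 / (1 + 2 * \<theta>))))"
    by (intro allI impI esd_limit[OF A])
  have scaled: "\<forall>\<theta>\<ge>0. (\<lambda>n. \<eta> n / real n) \<longlonglongrightarrow> \<theta> \<longrightarrow>
    tendsto_in_prob M (\<lambda>n \<omega>. 1 / real n * (D n \<omega>)\<^sup>2) (1 / (1 + 2 * \<theta>))"
    by (intro allI impI scaled_limit[OF A])
  show ?thesis
    by (intro conjI impI esd mean scaled ratio_limit[OF A] divergence[OF A] boundedness[OF A] vanishing[OF A])
qed

end
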